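(* Let $\mathcal C$ be a small category and $E$ a directed graph, and suppose that $(\mathcal C,E^* )$ is a length-preserving matched pair (i.e. $|c\triangleright\alpha|=|\alpha|$ for all $(c,\alpha)\in\mathcal C*E^*$). For $p,q\ge0$ let $N_{p,q}\subseteq C_{p,q}$ be the subgroup generated by the chains $[c;\alpha_1,\dots,\alpha_q]$ with no $\alpha_i$ in $E^0$. With the convention that the empty sum is zero, for $p\ge0$ and $q\ge1$ define $s^v_{p,q}\colon N_{p,q}\to N_{p,q+1}$ by $$s^v_{p,q}[c;\alpha_1,\dots,\alpha_q]=-\sum_{i=1}^{|\alpha_1|-1}\big[c\triangleleft\alpha_1^{[0,i-1]};\ \alpha_1^i,\ \alpha_1^{[i,|\alpha_1|]},\ \alpha_2,\dots,\alpha_q\big]$$ for $c\in\mathcal C^p$ and $(\alpha_1,\dots,\alpha_q)\in(E^* )^q$ with $s(c)=r(\alpha_1)$. Then for $q\ge2$, $$d^v_{p,q}\,s^v_{p,q}+s^v_{p,q-1}\,d^v_{p,q-1}=\mathrm{id}_{N_{p,q}}.$$ In particular, for $q\ge2$ the vertical homology $H^v_{p,q}(\mathcal C,E^* )$ vanishes, and, writing $E^{hv,2}_{p,q}=H^h_pH^v_q(\mathcal C,E^* )$ for the second page of the spectral sequence converging to $H^{\bowtie}_\bullet(\mathcal C,E^* )$, there is a long exact sequence $$\cdots\to H^{\bowtie}_{p+1}(\mathcal C,E^* )\to E^{hv,2}_{p+1,0}\xrightarrow{d}E^{hv,2}_{p-1,1}\to H^{\bowtie}_p(\mathcal C,E^*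 )\to E^{hv,2}_{p,0}\xrightarrow{d}E^{hv,2}_{p-2,1}\to H^{\bowtie}_{p-1}(\mathcal C,E^* )\to\cdots$$ (with $d$ the second-page differentials).
   Context: A small category $\mathcal C$ is identified with its set of morphisms; $\mathcal C^0$ its identities (objects), $r,s$ codomain and domain, $\mathcal C^n$ the composable $n$-tuples; $\mathcal C^p*\mathcal D^q$ the composable tuples with first $p$ entries in $\mathcal C$ and last $q$ in $\mathcal D$ (when $\mathcal C^0=\mathcal D^0$; $\mathcal C^0*\mathcal D^q=\mathcal D^q$, $\mathcal C^p*\mathcal D^0=\mathcal C^p$). A matched pair $(\mathcal C,\mathcal D)$: small categories with $\mathcal C^0=\mathcal D^0$, a left action $\triangleright\colon\mathcal C*\mathcal D\to\mathcal D$ ($r(d)\triangleright d=d$, $r(c\triangleright d)=r(c)$, $(c_1c_2)\triangleright d=c_1\triangleright(c_2\triangleright d)$, $c\triangleright s(c)=r(c)$) and a right action $\triangleleft\colon\mathcal C*\mathcal D\to\mathcal C$ ($c\triangleleft s(c)=c$, $s(c\triangleleft d)=s(d)$, $c\triangleleft(d_1d_2)=(c\triangleleft d_1)\triangleleft d_2$, $r(d)\triangleleft d=s(d)$) with $s(c\triangleright d)=r(c\triangleleft d)$, $c\triangleright(d_1d_2)=(c\triangleright d_1)((c\triangleleft d_1)\triangleright d_2)$, $(c_1c_2)\triangleleft d=(c_1\triangleleft(c_2\triangleright d))(c_2\triangleleft d)$. $\mathcal C\bowtie\mathcal D$ is the category with morphisms $dc:=(d,c)$, $s(d)=r(c)$,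 and composition $(d_1c_1)(d_2c_2)=(d_1(c_1\triangleright d_2))((c_1\triangleleft d_2)c_2)$. $H^{\bowtie}_\bullet(\mathcal C,\mathcal D)$ is its categorical homology: the homology of $C_k=\mathbb Z(\mathcal C\bowtie\mathcal D)^k$ with boundary the alternating sum of faces deleting the first entry, composing adjacent entries, deleting the last entry ($[e]\mapsto[s(e)]-[r(e)]$ in lowest degree). Actions on tuples: $c\triangleright(d_1,\dots,d_q)=(c\triangleright d_1,(c\triangleleft d_1)\triangleright d_2,\dots,(c\triangleleft(d_1\cdots d_{q-1}))\triangleright d_q)$; $(c_1,\dots,c_p)\triangleleft d=(c_1\triangleleft((c_2\cdots c_p)\triangleright d),\dots,c_{p-1}\triangleleft(c_p\triangleright d),c_p\triangleleft d)$. Matched complex: $C_{p,q}=\mathbb Z(\mathcal C^p*\mathcal D^q)$. $d^h_{p,q}\colon C_{p+1,q}\to C_{p,q}$ sends $[c_0,\dots,c_p;d]$ to $[c_1,\dots,c_p;d]+\sum_{i=1}^p(-1)^i[c_0,\dots,c_{i-1}c_i,\dots,c_p;d]+(-1)^{p+1}[c_0,\dots,c_{p-1};c_p\triangleright d]$ (for $q=0$ it is the categorical boundary of $\mathcal C$). $d^v_{p,q}\colon C_{p,q+1}\to C_{p,q}$ sends $[c;d_0,\dots,d_q]$ to $(-1)^p$ times $[c\triangleleft d_0;d_1,\dots,d_q]+\sum_{j=1}^q(-1)^j[c;d_0,\dots,d_{j-1}d_j,\dots,d_q]+(-1)^{q+1}[c;d_0,\dots,d_{q-1}]$ (for $p=0$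 it is the categorical boundary of $\mathcal D$). In the claim, $d^v_{p,q}$ also denotes its restriction $N_{p,q+1}\to N_{p,q}$. $H^v_{p,q}$ is the $q$-th homology of the column $(C_{p,\bullet},d^v)$, and $H^h_pH^v_q$ is the $p$-th homology of the complex $(H^v_{\bullet,q},\widetilde d^h)$ induced by $d^h$. There is a first-quadrant spectral sequence with $E^{hv,1}_{p,q}=H^v_{p,q}$, $E^{hv,2}_{p,q}=H^h_pH^v_q$, converging to $H^{\bowtie}_{p+q}(\mathcal C,\mathcal D)$. Path categories: $E^*$ is the category of finite paths $\alpha=\alpha^1\cdots\alpha^{|\alpha|}$ of edges with $s(\alpha^i)=r(\alpha^{i+1})$ (vertices being paths of length $0$), composition is concatenation, $|\alpha|$ is length. For $0\le i\le j\le|\alpha|$, $\alpha^{[i,j]}$ is the path of length $j-i$ with $\alpha=\alpha'\alpha^{[i,j]}\alpha''$, $|\alpha'|=i$, $|\alpha''|=|\alpha|-j$.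
   Formalization: Since d^v carries the sign (-1)^p and s^v does not, the printed homotopy identity fails for odd p; the formal statement proves d^v s^v + s^v d^v = (-1)^p id, equivalently that (-1)^p s^v satisfies the printed identity. *)

theory Defs
  imports
    "HOL-Algebra.Free_Abelian_Groups"
    "Graph_Theory.Digraph"
begin

section \<open>Small categories\<close>

text \<open>
  Morphisms compose as in \<open>c\<^sub>1c\<^sub>2\<close> with \<open>src c\<^sub>1 = rng c\<^sub>2\<close> (\<open>src\<close> is the domain, \<open>rng\<close> the
  codomain). Objects are kept in a type of their own and \<open>ident\<close> embeds them as identity morphisms;
  so two categories over the same object set need not have the same type of morphisms.
\<close>

record ('o, 'm) cat =
  Obj :: "'o set"
  Arr :: "'m set"
  rng :: "'m \<Rightarrow> 'o"
  src :: "'m \<Rightarrow> 'o"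
  ident :: "'o \<Rightarrow> 'm"
  cmp :: "'m \<Rightarrow> 'm \<Rightarrow> 'm"

locale small_category =
  fixes K :: "('o, 'm) cat"
  assumes rng_Obj: "a \<in> Arr K \<Longrightarrow> rng K a \<in> Obj K"
    and src_Obj: "a \<in> Arr K \<Longrightarrow> src K a \<in> Obj K"
    and ident_Arr: "v \<in> Obj K \<Longrightarrow> ident K v \<in> Arr K"
    and rng_ident: "v \<in> Obj K \<Longrightarrow> rng K (ident K v) = v"
    and src_ident: "v \<in> Obj K \<Longrightarrow> src K (ident K v) = v"
    and cmp_Arr: "\<lbrakk>a \<in> Arr K; b \<in> Arr K; src K a = rng K b\<rbrakk> \<Longrightarrow> cmp K a b \<in> Arr K"
    and rng_cmp: "\<lbrakk>a \<in> Arr K; b \<in> Arr K; src K a = rng K b\<rbrakk> \<Longrightarrow> rng K (cmp K a b) = rng K a"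
    and src_cmp: "\<lbrakk>a \<in> Arr K; b \<in> Arr K; src K a = rng K b\<rbrakk> \<Longrightarrow> src K (cmp K a b) = src K b"
    and cmp_assoc: "\<lbrakk>a \<in> Arr K; b \<in> Arr K; c \<in> Arr K; src K a = rng K b; src K b = rng K c\<rbrakk>
      \<Longrightarrow> cmp K (cmp K a b) c = cmp K a (cmp K b c)"
    and cmp_ident_left: "a \<in> Arr K \<Longrightarrow> cmp K (ident K (rng K a)) a = a"
    and cmp_ident_right: "a \<in> Arr K \<Longrightarrow> cmp K a (ident K (src K a)) = a"

text \<open>\<open>composable K v ms w\<close>: \<open>ms\<close> is a composable tuple of morphisms with codomain \<open>v\<close> and domain \<open>w\<close>.\<close>

fun composable :: "('o, 'm) cat \<Rightarrow> 'o \<Rightarrow> 'm list \<Rightarrow> 'o \<Rightarrow> bool" where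
  "composable K v [] w \<longleftrightarrow> v \<in> Obj K \<and> w = v"
| "composable K v (m # ms) w \<longleftrightarrow> m \<in> Arr K \<and> rng K m = v \<and> composable K (src K m) ms w"

text \<open>The composite of a composable tuple with codomain \<open>v\<close>; the empty tuple gives the identity.\<close>

fun composite :: "('o, 'm) cat \<Rightarrow> 'o \<Rightarrow> 'm list \<Rightarrow> 'm" where
  "composite K v [] = ident K v"
| "composite K v (m # ms) = cmp K m (composite K (src K m) ms)"

text \<open>Replaces the entries number \<open>i - 1\<close> and \<open>i\<close> (counting from 0) by their composite.\<close>

definition merge :: "('o, 'm) cat \<Rightarrow> nat \<Rightarrow> 'm list \<Rightarrow> 'm list" where
  "merge K i ms = take (i - 1) ms @ [cmp K (ms ! (i - 1)) (ms ! i)] @ drop (i + 1) ms"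


section \<open>Homology of complexes of abelian groups\<close>

text \<open>
  Complexes are indexed by the integers, \<open>d n\<close> being the differential from \<open>G n\<close> to \<open>G (n - 1)\<close>;
  the complexes below vanish in negative degrees.
\<close>

definition homology :: "(int \<Rightarrow> 'a monoid) \<Rightarrow> (int \<Rightarrow> 'a \<Rightarrow> 'a) \<Rightarrow> int \<Rightarrow> 'a set monoid" where
  "homology G d n =
     (G n)\<lparr>carrier := kernel (G n) (G (n - 1)) (d n)\<rparr> Mod (d (n + 1) ` carrier (G (n + 1)))"

definition exact_at ::
  "'a monoid \<Rightarrow> ('a \<Rightarrow> 'b) \<Rightarrow> 'b monoid \<Rightarrow> ('b \<Rightarrow> 'c) \<Rightarrow> 'c monoid \<Rightarrow> bool" where
  "exact_at A f B g C \<longleftrightarrow> group_hom A B f \<and> group_hom B C g \<and> f ` carrier A = kernel B C g"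


section \<open>Categorical homology\<close>

text \<open>
  An element of \<open>K\<^sup>n\<close> is encoded as \<open>(v, ms)\<close> with \<open>ms\<close> a composable list of length \<open>n\<close> and \<open>v\<close>
  its codomain; \<open>v\<close> carries information only for \<open>n = 0\<close>, where it is the object itself.
\<close>

definition cat_chains :: "('o, 'm) cat \<Rightarrow> int \<Rightarrow> ('o \<times> 'm list \<Rightarrow>\<^sub>0 int) monoid" where
  "cat_chains K n =
     free_Abelian_group {(v, ms). int (length ms) = n \<and> (\<exists>w. composable K v ms w)}"

definition cat_boundary :: "('o, 'm) cat \<Rightarrow> ('o \<times> 'm list \<Rightarrow>\<^sub>0 int) \<Rightarrow> ('o \<times> 'm list \<Rightarrow>\<^sub>0 int)" where
  "cat_boundary K = frag_extend (\<lambda>(v, ms). if ms = [] then 0 else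
       frag_of (src K (hd ms), tl ms)
       + (\<Sum>i\<in>{1..<length ms}. frag_cmul ((-1) ^ i) (frag_of (v, merge K i ms)))
       + frag_cmul ((-1) ^ length ms) (frag_of (v, butlast ms)))"

definition cat_homology :: "('o, 'm) cat \<Rightarrow> int \<Rightarrow> ('o \<times> 'm list \<Rightarrow>\<^sub>0 int) set monoid" where
  "cat_homology K = homology (cat_chains K) (\<lambda>_. cat_boundary K)"


section \<open>Matched pairs and their Zappa--Szep products\<close>

text \<open>\<open>lact M c d\<close> is \<open>c \<triangleright> d\<close> and \<open>ract M c d\<close> is \<open>c \<triangleleft> d\<close>.\<close>

record ('o, 'c, 'd) matched_data =
  lcat :: "('o, 'c) cat"
  rcat :: "('o, 'd) cat"
  lact :: "'c \<Rightarrow> 'd \<Rightarrow> 'd"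
  ract :: "'c \<Rightarrow> 'd \<Rightarrow> 'c"

locale matched_pair =
  fixes M :: "('o, 'c, 'd) matched_data"
    and C :: "('o, 'c) cat" and D :: "('o, 'd) cat"
    and l :: "'c \<Rightarrow> 'd \<Rightarrow> 'd" (infixr \<open>\<triangleright>\<close> 75) and r :: "'c \<Rightarrow> 'd \<Rightarrow> 'c" (infixl \<open>\<triangleleft>\<close> 75)
  defines "C \<equiv> lcat M" and "D \<equiv> rcat M" and "l \<equiv> lact M" and "r \<equiv> ract M"
  assumes small_C: "small_category C"
    and small_D: "small_category D"
    and same_Obj: "Obj C = Obj D"
    and lact_Arr: "\<lbrakk>c \<in> Arr C; d \<in> Arr D; src C c = rng D d\<rbrakk> \<Longrightarrow> c \<triangleright> d \<in> Arr D"
    and ident_lact: "d \<in> Arr D \<Longrightarrow> ident C (rng D d) \<triangleright> d = d"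
    and rng_lact: "\<lbrakk>c \<in> Arr C; d \<in> Arr D; src C c = rng D d\<rbrakk> \<Longrightarrow> rng D (c \<triangleright> d) = rng C c"
    and cmp_lact: "\<lbrakk>c1 \<in> Arr C; c2 \<in> Arr C; d \<in> Arr D; src C c1 = rng C c2; src C c2 = rng D d\<rbrakk>
      \<Longrightarrow> cmp C c1 c2 \<triangleright> d = c1 \<triangleright> (c2 \<triangleright> d)"
    and lact_ident: "c \<in> Arr C \<Longrightarrow> c \<triangleright> ident D (src C c) = ident D (rng C c)"
    and ract_Arr: "\<lbrakk>c \<in> Arr C; d \<in> Arr D; src C c = rng D d\<rbrakk> \<Longrightarrow> c \<triangleleft> d \<in> Arr C"
    and ract_ident: "c \<in> Arr C \<Longrightarrow> c \<triangleleft> ident D (src C c) = c"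
    and src_ract: "\<lbrakk>c \<in> Arr C; d \<in> Arr D; src C c = rng D d\<rbrakk> \<Longrightarrow> src C (c \<triangleleft> d) = src D d"
    and ract_cmp: "\<lbrakk>c \<in> Arr C; d1 \<in> Arr D; d2 \<in> Arr D; src C c = rng D d1; src D d1 = rng D d2\<rbrakk>
      \<Longrightarrow> c \<triangleleft> cmp D d1 d2 = (c \<triangleleft> d1) \<triangleleft> d2"
    and ident_ract: "d \<in> Arr D \<Longrightarrow> ident C (rng D d) \<triangleleft> d = ident C (src D d)"
    and src_lact_rng_ract: "\<lbrakk>c \<in> Arr C; d \<in> Arr D; src C c = rng D d\<rbrakk>
      \<Longrightarrow> src D (c \<triangleright> d) = rng C (c \<triangleleft> d)"
    and lact_cmp: "\<lbrakk>c \<in> Arr C; d1 \<in> Arr D; d2 \<in> Arr D; src C c = rng D d1; src D d1 = rng D d2\<rbrakk>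
      \<Longrightarrow> c \<triangleright> cmp D d1 d2 = cmp D (c \<triangleright> d1) ((c \<triangleleft> d1) \<triangleright> d2)"
    and cmp_ract: "\<lbrakk>c1 \<in> Arr C; c2 \<in> Arr C; d \<in> Arr D; src C c1 = rng C c2; src C c2 = rng D d\<rbrakk>
      \<Longrightarrow> cmp C c1 c2 \<triangleleft> d = cmp C (c1 \<triangleleft> (c2 \<triangleright> d)) (c2 \<triangleleft> d)"

definition zs_product :: "('o, 'c, 'd) matched_data \<Rightarrow> ('o, 'd \<times> 'c) cat" where
  "zs_product M = \<lparr>
     Obj = Obj (lcat M),
     Arr = {(d, c). d \<in> Arr (rcat M) \<and> c \<in> Arr (lcat M) \<and> src (rcat M) d = rng (lcat M) c},
     rng = (\<lambda>(d, c). rng (rcat M) d),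
     src = (\<lambda>(d, c). src (lcat M) c),
     ident = (\<lambda>v. (ident (rcat M) v, ident (lcat M) v)),
     cmp = (\<lambda>(d1, c1) (d2, c2).
       (cmp (rcat M) d1 (lact M c1 d2), cmp (lcat M) (ract M c1 d2) c2))\<rparr>"

definition H_bowtie ::
  "('o, 'c, 'd) matched_data \<Rightarrow> int \<Rightarrow> ('o \<times> ('d \<times> 'c) list \<Rightarrow>\<^sub>0 int) set monoid" where
  "H_bowtie M = cat_homology (zs_product M)"


section \<open>The matched complex\<close>

definition lact_tuple :: "('o, 'c, 'd) matched_data \<Rightarrow> 'c \<Rightarrow> 'd list \<Rightarrow> 'd list" where
  "lact_tuple M c ds =
     map (\<lambda>k. lact M (ract M c (composite (rcat M) (src (lcat M) c) (take k ds))) (ds ! k))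
       [0..<length ds]"

definition ract_tuple :: "('o, 'c, 'd) matched_data \<Rightarrow> 'c list \<Rightarrow> 'd \<Rightarrow> 'c list" where
  "ract_tuple M cs d =
     map (\<lambda>k. ract M (cs ! k)
            (lact M (composite (lcat M) (src (lcat M) (cs ! k)) (drop (Suc k) cs)) d))
       [0..<length cs]"

text \<open>
  An element \<open>(c\<^sub>1, \<dots>, c\<^sub>p, d\<^sub>1, \<dots>, d\<^sub>q)\<close> of \<open>C\<^sup>p * D\<^sup>q\<close> is encoded as \<open>(cs, v, ds)\<close>, where \<open>v\<close> is the
  object at which the two parts meet, i.e. the domain of \<open>c\<^sub>p\<close> and the codomain of \<open>d\<^sub>1\<close>. It is
  determined by \<open>cs\<close> and \<open>ds\<close> unless both are empty.
\<close>

type_synonym ('o, 'c, 'd) bitup = "'c list \<times> 'o \<times> 'd list"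

definition bituples :: "('o, 'c, 'd) matched_data \<Rightarrow> int \<Rightarrow> int \<Rightarrow> ('o, 'c, 'd) bitup set" where
  "bituples M p q = {(cs, v, ds). int (length cs) = p \<and> int (length ds) = q \<and>
     (\<exists>u. composable (lcat M) u cs v) \<and> (\<exists>w. composable (rcat M) v ds w)}"

definition Cpq ::
  "('o, 'c, 'd) matched_data \<Rightarrow> int \<Rightarrow> int \<Rightarrow> (('o, 'c, 'd) bitup \<Rightarrow>\<^sub>0 int) monoid" where
  "Cpq M p q = free_Abelian_group (bituples M p q)"

definition Npq ::
  "('o, 'c, 'd) matched_data \<Rightarrow> int \<Rightarrow> int \<Rightarrow> (('o, 'c, 'd) bitup \<Rightarrow>\<^sub>0 int) monoid" where
  "Npq M p q = free_Abelian_group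
     {(cs, v, ds) \<in> bituples M p q. set ds \<inter> ident (rcat M) ` Obj (rcat M) = {}}"

text \<open>
  The maps \<open>dh\<close> and \<open>dv\<close> act on chains of all bidegrees at once: \<open>dh\<close> maps \<open>C\<^bsub>p+1,q\<^esub>\<close> to \<open>C\<^bsub>p,q\<^esub>\<close> and
  \<open>dv\<close> maps \<open>C\<^bsub>p,q+1\<^esub>\<close> to \<open>C\<^bsub>p,q\<^esub>\<close>, and they are zero on \<open>C\<^bsub>0,q\<^esub>\<close> and \<open>C\<^bsub>p,0\<^esub>\<close> respectively.
  The meeting point changes only in the faces deleting the last entry of \<open>cs\<close> or the first of \<open>ds\<close>.
\<close>

definition dh :: "('o, 'c, 'd) matched_data \<Rightarrow>
    (('o, 'c, 'd) bitup \<Rightarrow>\<^sub>0 int) \<Rightarrow> (('o, 'c, 'd) bitup \<Rightarrow>\<^sub>0 int)" where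
  "dh M = frag_extend (\<lambda>(cs, v, ds). if cs = [] then 0 else
       frag_of (tl cs, v, ds)
       + (\<Sum>i\<in>{1..<length cs}. frag_cmul ((-1) ^ i) (frag_of (merge (lcat M) i cs, v, ds)))
       + frag_cmul ((-1) ^ length cs)
           (frag_of (butlast cs, rng (lcat M) (last cs), lact_tuple M (last cs) ds)))"

definition dv :: "('o, 'c, 'd) matched_data \<Rightarrow>
    (('o, 'c, 'd) bitup \<Rightarrow>\<^sub>0 int) \<Rightarrow> (('o, 'c, 'd) bitup \<Rightarrow>\<^sub>0 int)" where
  "dv M = frag_extend (\<lambda>(cs, v, ds). if ds = [] then 0 else
     frag_cmul ((-1) ^ length cs)
      (frag_of (ract_tuple M cs (hd ds), src (rcat M) (hd ds), tl ds)
       + (\<Sum>j\<in>{1..<length ds}. frag_cmul ((-1) ^ j) (frag_of (cs, v, merge (rcat M) j ds)))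
       + frag_cmul ((-1) ^ length ds) (frag_of (cs, v, butlast ds))))"


section \<open>The spectral sequence up to its second differential\<close>

definition Hv :: "('o, 'c, 'd) matched_data \<Rightarrow> int \<Rightarrow> int \<Rightarrow> (('o, 'c, 'd) bitup \<Rightarrow>\<^sub>0 int) set monoid" where
  "Hv M p = homology (Cpq M p) (\<lambda>_. dv M)"

definition Hv_class :: "('o, 'c, 'd) matched_data \<Rightarrow> int \<Rightarrow> int \<Rightarrow>
    (('o, 'c, 'd) bitup \<Rightarrow>\<^sub>0 int) \<Rightarrow> (('o, 'c, 'd) bitup \<Rightarrow>\<^sub>0 int) set" where
  "Hv_class M p q x = (dv M ` carrier (Cpq M p (q + 1))) #>\<^bsub>Cpq M p q\<^esub> x"

text \<open>
  The map from \<open>Hv M p q\<close> to \<open>Hv M (p - 1) q\<close> induced by \<open>dh M\<close>: the classes united here are all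
  equal, since \<open>X\<close> is itself a coset of boundaries.
\<close>

definition dh_induced :: "('o, 'c, 'd) matched_data \<Rightarrow> int \<Rightarrow> int \<Rightarrow>
    (('o, 'c, 'd) bitup \<Rightarrow>\<^sub>0 int) set \<Rightarrow> (('o, 'c, 'd) bitup \<Rightarrow>\<^sub>0 int) set" where
  "dh_induced M p q X = (\<Union>x\<in>X. Hv_class M (p - 1) q (dh M x))"

definition E2 ::
  "('o, 'c, 'd) matched_data \<Rightarrow> int \<Rightarrow> int \<Rightarrow> (('o, 'c, 'd) bitup \<Rightarrow>\<^sub>0 int) set set monoid" where
  "E2 M p q = homology (\<lambda>p'. Hv M p' q) (\<lambda>p'. dh_induced M p' q) p"

definition E2_class :: "('o, 'c, 'd) matched_data \<Rightarrow> int \<Rightarrow> int \<Rightarrow>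
    (('o, 'c, 'd) bitup \<Rightarrow>\<^sub>0 int) \<Rightarrow> (('o, 'c, 'd) bitup \<Rightarrow>\<^sub>0 int) set set" where
  "E2_class M p q x =
     (dh_induced M (p + 1) q ` carrier (Hv M (p + 1) q)) #>\<^bsub>Hv M p q\<^esub> Hv_class M p q x"

text \<open>
  The second-page differential from \<open>E2 M p q\<close> to \<open>E2 M (p - 2) (q + 1)\<close> in the spectral sequence
  of the total complex, with differential \<open>dh + dv\<close>, filtered by \<open>p\<close>. A class in \<open>E2 M p q\<close> is
  represented by the leading term \<open>x\<close> of a chain \<open>x + y + \<dots>\<close> with \<open>x\<close> in bidegree \<open>(p, q)\<close>, \<open>y\<close> in
  bidegree \<open>(p - 1, q + 1)\<close>, and with boundary in filtration degree \<open>p - 2\<close>, that is, with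
  \<open>dv x = 0\<close> and \<open>dh x + dv y = 0\<close>. Its image is the class of the boundary of that chain, which is
  the class of \<open>dh y\<close>.
\<close>

definition d2 :: "('o, 'c, 'd) matched_data \<Rightarrow> int \<Rightarrow> int \<Rightarrow>
    (('o, 'c, 'd) bitup \<Rightarrow>\<^sub>0 int) set set \<Rightarrow> (('o, 'c, 'd) bitup \<Rightarrow>\<^sub>0 int) set set" where
  "d2 M p q X = (THE Y. \<exists>x \<in> carrier (Cpq M p q). \<exists>y \<in> carrier (Cpq M (p - 1) (q + 1)).
      dv M x = 0 \<and> dh M x + dv M y = 0 \<and>
      X = E2_class M p q x \<and> Y = E2_class M (p - 2) (q + 1) (dh M y))"


section \<open>Path categories\<close>

text \<open>
  Paths run against the direction of \<^theory>\<open>Graph_Theory.Digraph\<close> walks: the tail of an edge is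
  the head of the next one. A path is a pair of its codomain and its list of edges, so that the
  paths of length 0 are the pairs \<open>(v, [])\<close>.
\<close>

type_synonym ('v, 'e) path = "'v \<times> 'e list"

fun is_path :: "('v, 'e) pre_digraph \<Rightarrow> 'v \<Rightarrow> 'e list \<Rightarrow> bool" where
  "is_path E v [] \<longleftrightarrow> v \<in> verts E"
| "is_path E v (e # es) \<longleftrightarrow> e \<in> arcs E \<and> head E e = v \<and> is_path E (tail E e) es"

definition path_length :: "('v, 'e) path \<Rightarrow> nat" where
  "path_length \<alpha> = length (snd \<alpha>)"

text \<open>The vertex reached after the first \<open>i\<close> edges.\<close>

definition path_vertex :: "('v, 'e) pre_digraph \<Rightarrow> ('v, 'e) path \<Rightarrow> nat \<Rightarrow> 'v" where
  "path_vertex E \<alpha> i = (if i = 0 then fst \<alpha> else tail E (snd \<alpha> ! (i - 1)))"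

text \<open>The segment \<open>\<alpha>\<^bsup>[i,j]\<^esup>\<close>; in particular the \<open>i\<close>-th edge \<open>\<alpha>\<^sup>i\<close> is \<open>\<alpha>\<^bsup>[i-1,i]\<^esup>\<close>.\<close>

definition subpath :: "('v, 'e) pre_digraph \<Rightarrow> ('v, 'e) path \<Rightarrow> nat \<Rightarrow> nat \<Rightarrow> ('v, 'e) path" where
  "subpath E \<alpha> i j = (path_vertex E \<alpha> i, take (j - i) (drop i (snd \<alpha>)))"

definition path_category :: "('v, 'e) pre_digraph \<Rightarrow> ('v, ('v, 'e) path) cat" where
  "path_category E = \<lparr>
     Obj = verts E,
     Arr = {(v, es). is_path E v es},
     rng = fst,
     src = (\<lambda>\<alpha>. path_vertex E \<alpha> (path_length \<alpha>)),
     ident = (\<lambda>v. (v, [])),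
     cmp = (\<lambda>\<alpha> \<beta>. (fst \<alpha>, snd \<alpha> @ snd \<beta>))\<rparr>"

text \<open>
  \<open>sv\<close> carries no sign depending on \<open>p\<close>, whereas \<open>dv\<close> carries the factor \<open>(-1)\<^sup>p\<close>; so
  \<open>dv \<circ> sv + sv \<circ> dv\<close> is \<open>(-1)\<^sup>p\<close> times the identity, and it is \<open>(-1)\<^sup>p sv\<close> that contracts the columns.
\<close>

definition sv :: "('v, 'e) pre_digraph \<Rightarrow> ('v, 'c, ('v, 'e) path) matched_data \<Rightarrow>
    (('v, 'c, ('v, 'e) path) bitup \<Rightarrow>\<^sub>0 int) \<Rightarrow> (('v, 'c, ('v, 'e) path) bitup \<Rightarrow>\<^sub>0 int)" where
  "sv E M = frag_extend (\<lambda>(cs, v, \<alpha>s). if \<alpha>s = [] then 0 else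
     (let \<alpha> = hd \<alpha>s; n = path_length \<alpha> in
       - (\<Sum>i\<in>{1..n - 1}. frag_of
            (ract_tuple M cs (subpath E \<alpha> 0 (i - 1)), path_vertex E \<alpha> (i - 1),
             subpath E \<alpha> (i - 1) i # subpath E \<alpha> i n # tl \<alpha>s))))"

end

theory Submission
  imports Defs
begin

text \<open>
  The columns of the matched complex are bar complexes of the path category with coefficients in a
  right module, and the Fox derivative of a path, which splits off each of its edges in turn,
  contracts them above degree 1; on non-normalised chains it does so only up to tuples starting with
  an identity, which a second homotopy removes. For the total complex, let the Zappa--Szep product
  act freely from the right on the matched tuples. The resulting complex resolves the constant
  module, since a morphism \<open>dc\<close> of the product can be absorbed into a tuple by first moving \<open>d\<close> to
  the end of the \<open>D\<close>-part and then \<open>c\<close> to the end of the \<open>C\<close>-part. Comparing it with the bar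
  resolution identifies the homology of the total complex with \<open>H\<^sup>\<bowtie>\<close>, and the exact
  sequence is that of a double complex with only two rows of vertical homology.
\<close>

section \<open>Maps of free abelian groups\<close>

text \<open>Convergence of the spectral sequence enters only through one consequence: additive maps
  from total cycles to cycles of the Zappa-Szep category that preserve and reflect boundaries and
  are onto up to boundaries. No such map is written down; it exists because both complexes arise, by
  forgetting the coefficient \<open>k\<close>, from free resolutions over the same category. The
  identities of the double complex are proved in the resolution as well.

  The contraction of the normalised chains does not give the vanishing of \<open>Hv\<close>, whose
  columns contain identities. Hence the sum of edge splittings occurs in two versions: without the
  splitting that leaves an empty remainder it preserves normalised chains, with it the product rule
  holds for all paths.

  Homology groups are sets of cosets, those of \<open>E2\<close> even cosets of cosets. To compute
  with chains only, each group is presented as cycles modulo boundaries, and the maps of the exact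
  sequence are additive relations between representatives, so that no lift has to be chosen.\<close>

definition frag_map :: "('a \<Rightarrow> 'b) \<Rightarrow> ('a \<Rightarrow>\<^sub>0 int) \<Rightarrow> ('b \<Rightarrow>\<^sub>0 int)" where
  "frag_map f = frag_extend (\<lambda>x. frag_of (f x))"

lemma frag_extend_extend:
  "frag_extend g (frag_extend f z) = frag_extend (\<lambda>x. frag_extend g (f x)) z"
  by (rule frag_induction[OF subset_UNIV]) (auto simp: frag_extend_diff)

lemma frag_extend_plus_fun: "frag_extend (\<lambda>x. f x + g x) z = frag_extend f z + frag_extend g z"
  by (simp add: frag_extend_def frag_cmul_distrib2 sum.distrib)

lemma frag_extend_minus_fun: "frag_extend (\<lambda>x. - f x) z = - frag_extend f z"
  by (rule frag_induction[OF subset_UNIV, of _ z]) (auto simp: frag_extend_diff)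

lemma frag_extend_diff_fun: "frag_extend (\<lambda>x. f x - g x) z = frag_extend f z - frag_extend g z"
  using frag_extend_plus_fun[of f "\<lambda>x. - g x" z] by (simp add: frag_extend_minus_fun)

lemma frag_extend_zero_fun [simp]: "frag_extend (\<lambda>x. 0) z = 0"
  by (simp add: frag_extend_eq_0)

lemma frag_cmul_diff: "frag_cmul c (a - b) = frag_cmul c a - frag_cmul c b"
  by (rule poly_mapping_eqI) (simp add: lookup_minus algebra_simps)

lemma frag_cmul_minus: "frag_cmul c (- a) = - frag_cmul c a"
  using frag_cmul_diff[of c 0 a] by simp

lemma frag_extend_cmul_fun: "frag_extend (\<lambda>x. frag_cmul c (f x)) z = frag_cmul c (frag_extend f z)"
  by (rule frag_induction[OF subset_UNIV, of _ z]) (simp_all add: frag_extend_diff frag_cmul_diff)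

lemma frag_extend_frag_of [simp]: "frag_extend frag_of z = z"
  by (simp add: frag_expansion[symmetric])

lemma frag_map_0 [simp]: "frag_map f 0 = 0"
  and frag_map_of [simp]: "frag_map f (frag_of x) = frag_of (f x)"
  and frag_map_minus: "frag_map f (- z) = - frag_map f z"
  and frag_map_add: "frag_map f (z + z') = frag_map f z + frag_map f z'"
  and frag_map_diff: "frag_map f (z - z') = frag_map f z - frag_map f z'"
  and frag_map_cmul: "frag_map f (frag_cmul c z) = frag_cmul c (frag_map f z)"
  by (simp_all add: frag_map_def frag_extend_minus frag_extend_add frag_extend_diff frag_extend_cmul)

lemma frag_extend_map: "frag_extend g (frag_map f z) = frag_extend (\<lambda>x. g (f x)) z"
  by (simp add: frag_map_def frag_extend_extend)

lemma frag_map_extend: "frag_map g (frag_extend f z) = frag_extend (\<lambda>x. frag_map g (f x)) z"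
  by (simp add: frag_map_def frag_extend_extend)

lemma frag_map_map: "frag_map g (frag_map f z) = frag_map (\<lambda>x. g (f x)) z"
  by (simp add: frag_map_def frag_extend_extend)

lemma frag_map_cong:
  "(\<And>x. x \<in> Poly_Mapping.keys z \<Longrightarrow> f x = g x) \<Longrightarrow> frag_map f z = frag_map g z"
  unfolding frag_map_def by (rule frag_extend_eq) simp

lemma frag_map_id [simp]: "frag_map (\<lambda>x. x) z = z"
  by (simp add: frag_map_def)

lemma keys_frag_map: "Poly_Mapping.keys (frag_map f z) \<subseteq> f ` Poly_Mapping.keys z"
  unfolding frag_map_def using keys_frag_extend[of "\<lambda>x. frag_of (f x)" z] by auto

lemma keys_frag_mapD: "x \<in> Poly_Mapping.keys (frag_map f z) \<Longrightarrow> \<exists>y\<in>Poly_Mapping.keys z. x = f y"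
  using keys_frag_map by fastforce

lemma keys_frag_extend_subset:
  "(\<And>x. x \<in> Poly_Mapping.keys z \<Longrightarrow> Poly_Mapping.keys (f x) \<subseteq> S) \<Longrightarrow>
    Poly_Mapping.keys (frag_extend f z) \<subseteq> S"
  using keys_frag_extend[of f z] by blast

lemma keys_diff_subset:
  "Poly_Mapping.keys a \<subseteq> S \<Longrightarrow> Poly_Mapping.keys b \<subseteq> S \<Longrightarrow> Poly_Mapping.keys (a - b) \<subseteq> S"
  using keys_diff[of a b] by blast

lemma keys_add_subset:
  "Poly_Mapping.keys a \<subseteq> S \<Longrightarrow> Poly_Mapping.keys b \<subseteq> S \<Longrightarrow> Poly_Mapping.keys (a + b) \<subseteq> S"
  using keys_add[of a b] by blast

lemmas frag_linear = frag_extend_add frag_extend_minus frag_extend_diff frag_extend_cmul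
  frag_map_add frag_map_minus frag_map_diff frag_map_cmul

section \<open>Two-sided bar constructions\<close>

text \<open>
  \<open>bar\<close> is the boundary of the two-sided bar construction on a right \<open>K\<close>-set \<open>A\<close> and a left
  \<open>K\<close>-set \<open>Y\<close>; \<open>bar_inner\<close> collects its faces other than the first one. Rows and columns of the
  matched complex, their resolutions and the categorical complex are all instances.
\<close>

fun bar_inner :: "('o, 'm) cat \<Rightarrow> ('m \<Rightarrow> 'y \<Rightarrow> 'y) \<Rightarrow> 'm list \<Rightarrow> 'y \<Rightarrow> ('m list \<times> 'y \<Rightarrow>\<^sub>0 int)" where
  "bar_inner K \<beta> [] y = 0"
| "bar_inner K \<beta> [m] y = - frag_of ([], \<beta> m y)"
| "bar_inner K \<beta> (m # m' # ms) y =
     - frag_of (cmp K m m' # ms, y) - frag_map (apfst ((#) m)) (bar_inner K \<beta> (m' # ms) y)"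

definition bar :: "('o, 'm) cat \<Rightarrow> ('a \<Rightarrow> 'm \<Rightarrow> 'a) \<Rightarrow> ('m \<Rightarrow> 'y \<Rightarrow> 'y) \<Rightarrow>
    'a \<times> 'm list \<times> 'y \<Rightarrow> ('a \<times> 'm list \<times> 'y \<Rightarrow>\<^sub>0 int)" where
  "bar K \<alpha> \<beta> = (\<lambda>(a, ms, y). if ms = [] then 0 else
     frag_of (\<alpha> a (hd ms), tl ms, y) + frag_map (Pair a) (bar_inner K \<beta> ms y))"

lemma bar_Nil [simp]: "bar K \<alpha> \<beta> (a, [], y) = 0"
  and bar_Cons: "bar K \<alpha> \<beta> (a, m # ms, y) =
    frag_of (\<alpha> a m, ms, y) + frag_map (Pair a) (bar_inner K \<beta> (m # ms) y)"
  by (simp_all add: bar_def)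

lemma bar_inner_length:
  "x \<in> Poly_Mapping.keys (bar_inner K \<beta> ms y) \<Longrightarrow> length ms = Suc (length (fst x))"
  by (induction K \<beta> ms y arbitrary: x rule: bar_inner.induct)
    (auto dest!: keys_frag_mapD set_mp[OF keys_diff])

lemma bar_inner_Cons:
  "ms \<noteq> [] \<Longrightarrow> bar_inner K \<beta> (m # ms) y =
     - frag_of (cmp K m (hd ms) # tl ms, y) - frag_map (apfst ((#) m)) (bar_inner K \<beta> ms y)"
  by (cases ms) auto

text \<open>The recursion of \<open>bar_inner\<close> extended to chains. Empty tuples are excluded,
  since prefixing \<open>m\<close> to one of them creates the absorbing face
  \<open>\<beta> m y\<close> instead of a product with a next entry.\<close>

lemma bar_inner_ext_Cons:
  assumes "\<And>x. x \<in> Poly_Mapping.keys z \<Longrightarrow> fst x \<noteq> []"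
  shows "frag_extend (\<lambda>(ms, y). bar_inner K \<beta> ms y) (frag_map (apfst ((#) m)) z) =
    - frag_map (\<lambda>(ms, y). (cmp K m (hd ms) # tl ms, y)) z
    - frag_map (apfst ((#) m)) (frag_extend (\<lambda>(ms, y). bar_inner K \<beta> ms y) z)"
proof -
  have "frag_extend (\<lambda>(ms, y). bar_inner K \<beta> ms y) (frag_map (apfst ((#) m)) z) =
    frag_extend (\<lambda>(ms, y). - frag_of (cmp K m (hd ms) # tl ms, y)
       - frag_map (apfst ((#) m)) (bar_inner K \<beta> ms y)) z"
    unfolding frag_extend_map
    by (rule frag_extend_eq) (auto dest!: assms simp: bar_inner_Cons)
  also have "\<dots> = frag_extend (\<lambda>x. - frag_of ((\<lambda>(ms, y). (cmp K m (hd ms) # tl ms, y)) x)) z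
       - frag_extend (\<lambda>x. frag_map (apfst ((#) m)) ((\<lambda>(ms, y). bar_inner K \<beta> ms y) x)) z"
    unfolding frag_extend_diff_fun[symmetric] by (rule frag_extend_eq) auto
  finally show ?thesis
    by (simp only: frag_extend_minus_fun frag_map_extend frag_map_def[symmetric])
qed

text \<open>The sign is that of the last face of the lengthened tuple, so that this face gives back
  \<open>(ms, y)\<close> with coefficient 1 whenever
  \<open>\<beta> (lam y) (rho y) = y\<close>.\<close>

definition bar_split :: "('y \<Rightarrow> 'm) \<Rightarrow> ('y \<Rightarrow> 'y) \<Rightarrow> 'm list \<times> 'y \<Rightarrow> ('m list \<times> 'y \<Rightarrow>\<^sub>0 int)" where
  "bar_split lam rho = (\<lambda>(ms, y). frag_cmul ((-1) ^ Suc (length ms)) (frag_of (ms @ [lam y], rho y)))"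

text \<open>
  The extra degeneracy: if every \<open>y\<close> factors naturally as \<open>\<beta> (lam y) (rho y)\<close>, then
  appending \<open>lam y\<close> to the tuple contracts the complex in positive degrees.
\<close>

lemma bar_split_Cons:
  "bar_split lam rho (m # ms, y) = - frag_map (apfst ((#) m)) (bar_split lam rho (ms, y))"
  by (simp add: bar_split_def frag_linear)

lemma (in small_category) composable_Obj: "composable K v ms w \<Longrightarrow> v \<in> Obj K \<and> w \<in> Obj K"
  by (induction ms arbitrary: v) (auto intro: rng_Obj)

text \<open>\<open>t y\<close> is the object over which \<open>y\<close> lies: \<open>m\<close> acts on \<open>y\<close> when \<open>src K m = t y\<close>.\<close>

locale left_action = small_category K for K :: "('o, 'm) cat" +
  fixes Y :: "'y set" and t :: "'y \<Rightarrow> 'o" and \<beta> :: "'m \<Rightarrow> 'y \<Rightarrow> 'y"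
  assumes act_closed: "\<lbrakk>m \<in> Arr K; y \<in> Y; src K m = t y\<rbrakk> \<Longrightarrow> \<beta> m y \<in> Y"
    and t_act: "\<lbrakk>m \<in> Arr K; y \<in> Y; src K m = t y\<rbrakk> \<Longrightarrow> t (\<beta> m y) = rng K m"
    and act_cmp: "\<lbrakk>m \<in> Arr K; m' \<in> Arr K; y \<in> Y; src K m = rng K m'; src K m' = t y\<rbrakk>
      \<Longrightarrow> \<beta> (cmp K m m') y = \<beta> m (\<beta> m' y)"
begin

text \<open>Multiplying two entries or absorbing the last one does not change what the whole tuple
  does to \<open>y\<close>. This invariant \<open>foldr \<beta> ms y\<close> is what later lets the
  first vertical face commute with the horizontal ones.\<close>

lemma bar_inner_keys:
  assumes "composable K v ms (t y)" "y \<in> Y" "(ms', y') \<in> Poly_Mapping.keys (bar_inner K \<beta> ms y)"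
  shows "composable K v ms' (t y') \<and> y' \<in> Y \<and> foldr \<beta> ms' y' = foldr \<beta> ms y"
  using assms
proof (induction ms arbitrary: v ms' y')
  case (Cons m ms)
  note mms = Cons.prems
  show ?case
  proof (cases ms)
    case Nil
    with mms show ?thesis by (auto simp: act_closed t_act rng_Obj)
  next
    case (Cons m1 ms1)
    from mms(3) consider "ms' = cmp K m m1 # ms1" "y' = y"
      | ms'' where "ms' = m # ms''" "(ms'', y') \<in> Poly_Mapping.keys (bar_inner K \<beta> ms y)"
      unfolding Cons by (fastforce dest!: keys_frag_mapD set_mp[OF keys_diff])
    then show ?thesis
    proof cases
      case 1
      \<comment> \<open>\<open>act_cmp\<close> can be applied to \<open>m\<close> and
        \<open>m1\<close> only if the rest of the tuple carries \<open>y\<close> to an element of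
        \<open>Y\<close> that lies over the right object.\<close>
      have Y: "foldr \<beta> ms1 y \<in> Y \<and> t (foldr \<beta> ms1 y) = u" if "composable K u ms1 (t y)" for u
        using that
      proof (induction ms1 arbitrary: u)
        case (Cons a ms1)
        then show ?case by (auto simp: act_closed t_act)
      qed (use mms in auto)
      with 1 mms show ?thesis
        by (auto simp: Cons cmp_Arr src_cmp rng_cmp intro!: act_cmp)
    next
      case 2
      then have "composable K (src K m) ms'' (t y') \<and> y' \<in> Y \<and> foldr \<beta> ms'' y' = foldr \<beta> ms y"
        using mms by (intro Cons.IH) auto
      with 2 mms show ?thesis by auto
    qed
  qed
qed auto

text \<open>The inner faces do not notice that the first entry has been multiplied by
  \<open>m\<close> from the left; only its product with \<open>m''\<close> needs associativity. The
  entry \<open>m''\<close> keeps every face nonempty, so that \<open>hd\<close> is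
  meaningful.\<close>

lemma bar_inner_cmp:
  assumes "composable K v (m # m' # m'' # ms) w"
  shows "bar_inner K \<beta> (cmp K m m' # m'' # ms) y =
    frag_map (\<lambda>(ms, y). (cmp K m (hd ms) # tl ms, y)) (bar_inner K \<beta> (m' # m'' # ms) y)"
  using assms
  by (auto simp: frag_linear frag_map_map cmp_assoc apfst_def map_prod_def case_prod_unfold)

text \<open>The terms that multiply \<open>m\<close> into the boundary of the rest occur twice with
  opposite signs, by \<open>bar_inner_cmp\<close> and \<open>bar_inner_ext_Cons\<close>; what
  remains is the double boundary of the rest, prefixed by \<open>m\<close>.\<close>

lemma bar_inner_bar_inner:
  assumes "composable K v ms (t y)" "y \<in> Y"
  shows "frag_extend (\<lambda>(ms, y). bar_inner K \<beta> ms y) (bar_inner K \<beta> ms y) = 0"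
  using assms
proof (induction ms arbitrary: v)
  case (Cons m ms)
  show ?case
  proof (cases ms)
    case Nil
    then show ?thesis by (simp add: frag_linear)
  next
    case ms: (Cons m' ms')
    show ?thesis
    proof (cases ms')
      case Nil
      with Cons.prems show ?thesis by (simp add: ms frag_linear act_cmp)
    next
      case ms': (Cons m'' ms'')
      have IH: "frag_extend (\<lambda>(ms, y). bar_inner K \<beta> ms y) (bar_inner K \<beta> ms y) = 0"
        using Cons by auto
      have "bar_inner K \<beta> (m # ms) y = - frag_of (cmp K m m' # ms', y)
          - frag_map (apfst ((#) m)) (bar_inner K \<beta> ms y)"
        by (simp add: ms)
      moreover have "frag_extend (\<lambda>(ms, y). bar_inner K \<beta> ms y)
            (frag_map (apfst ((#) m)) (bar_inner K \<beta> ms y)) =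
          - frag_map (\<lambda>(ms, y). (cmp K m (hd ms) # tl ms, y)) (bar_inner K \<beta> ms y)"
        by (subst bar_inner_ext_Cons) (auto simp: IH, auto simp: ms ms' simp del: bar_inner.simps dest: bar_inner_length)
      ultimately show ?thesis
        using bar_inner_cmp[of v m m' m'' ms'' "t y" y] Cons.prems
        by (simp add: ms ms' frag_linear del: bar_inner.simps)
    qed
  qed
qed auto

text \<open>Products of \<open>m\<close> with the next entry cancel between the two composites,
  which leaves the claim for the rest, prefixed by \<open>m\<close>. For a single entry, absorbing
  before splitting agrees with multiplying after splitting because
  \<open>lam (\<beta> m y) = cmp K m (lam y)\<close>.\<close>

lemma bar_inner_split:
  assumes fac: "\<And>y. y \<in> Y \<Longrightarrow> \<beta> (lam y) (rho y) = y"
    and lam_act: "\<And>m y. \<lbrakk>m \<in> Arr K; y \<in> Y; src K m = t y\<rbrakk> \<Longrightarrow> lam (\<beta> m y) = cmp K m (lam y)"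
    and rho_act: "\<And>m y. \<lbrakk>m \<in> Arr K; y \<in> Y; src K m = t y\<rbrakk> \<Longrightarrow> rho (\<beta> m y) = rho y"
    and comp: "composable K v ms (t y)" and y: "y \<in> Y" and ne: "ms \<noteq> []"
  shows "frag_extend (\<lambda>(ms, y). bar_inner K \<beta> ms y) (bar_split lam rho (ms, y))
      + frag_extend (bar_split lam rho) (bar_inner K \<beta> ms y) = frag_of (ms, y)"
  using ne comp
proof (induction ms arbitrary: v)
  case (Cons m ms)
  show ?case
  proof (cases ms)
    case Nil
    then show ?thesis using Cons.prems y
      by (auto simp: bar_split_def frag_linear fac lam_act rho_act)
  next
    case ms: (Cons m' ms')
    let ?s = "bar_split lam rho" and ?b = "\<lambda>(ms, y). bar_inner K \<beta> ms y"
    let ?m = "\<lambda>(ms, y). (cmp K m (hd ms) # tl ms, y)"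
    let ?c = "apfst ((#) m)"
    have IH: "frag_extend ?b (?s (ms, y)) + frag_extend ?s (bar_inner K \<beta> ms y) = frag_of (ms, y)"
      using Cons ms by auto
    have 1: "frag_extend ?b (?s (m # ms, y)) =
        frag_map ?m (?s (ms, y)) + frag_map ?c (frag_extend ?b (?s (ms, y)))"
      unfolding bar_split_Cons frag_extend_minus
      by (subst bar_inner_ext_Cons) (auto simp: bar_split_def)
    have 2: "frag_extend ?s (frag_map ?c z) = - frag_map ?c (frag_extend ?s z)" for z
      unfolding frag_extend_map frag_map_extend frag_extend_minus_fun[symmetric]
      by (rule frag_extend_eq) (auto simp: bar_split_Cons)
    have 3: "?s (cmp K m m' # ms', y) = frag_map ?m (?s (ms, y))"
      by (simp add: ms bar_split_def frag_linear)
    have "frag_extend ?s (bar_inner K \<beta> (m # ms) y) =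
        - frag_map ?m (?s (ms, y)) + frag_map ?c (frag_extend ?s (bar_inner K \<beta> ms y))"
      using 3 by (simp add: ms frag_linear 2)
    then have "frag_extend ?b (?s (m # ms, y)) + frag_extend ?s (bar_inner K \<beta> (m # ms) y) =
        frag_map ?c (frag_extend ?b (?s (ms, y)) + frag_extend ?s (bar_inner K \<beta> ms y))"
      by (simp add: 1 frag_linear)
    then show ?thesis by (simp add: IH)
  qed
qed simp

text \<open>The face that acts on \<open>a\<close> cancels between the two composites unless the
  tuple is empty: then the split tuple has the single entry \<open>lam y\<close>, and its first face
  has no counterpart.\<close>

lemma bar_split_homotopy:
  assumes fac: "\<And>y. y \<in> Y \<Longrightarrow> \<beta> (lam y) (rho y) = y"
    and lam_act: "\<And>m y. \<lbrakk>m \<in> Arr K; y \<in> Y; src K m = t y\<rbrakk> \<Longrightarrow> lam (\<beta> m y) = cmp K m (lam y)"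
    and rho_act: "\<And>m y. \<lbrakk>m \<in> Arr K; y \<in> Y; src K m = t y\<rbrakk> \<Longrightarrow> rho (\<beta> m y) = rho y"
    and comp: "composable K v ms (t y)" and y: "y \<in> Y"
  shows "frag_extend (bar K \<alpha> \<beta>) (frag_map (Pair a) (bar_split lam rho (ms, y)))
      + frag_extend (\<lambda>(a, x). frag_map (Pair a) (bar_split lam rho x)) (bar K \<alpha> \<beta> (a, ms, y))
    = frag_of (a, ms, y) - (if ms = [] then frag_of (\<alpha> a (lam y), [], rho y) else 0)"
proof (cases ms)
  case Nil
  then show ?thesis
    by (simp add: bar_split_def frag_linear bar_Cons fac y)
next
  case (Cons m ms')
  let ?s = "bar_split lam rho" and ?b = "\<lambda>(ms, y). bar_inner K \<beta> ms y"
  have inner: "frag_extend ?b (?s (ms, y)) + frag_extend ?s (bar_inner K \<beta> ms y) = frag_of (ms, y)"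
    by (rule bar_inner_split[OF fac lam_act rho_act comp y]) (use Cons in auto)
  have 1: "frag_extend (bar K \<alpha> \<beta>) (frag_map (Pair a) (?s (ms, y))) =
     - frag_map (Pair (\<alpha> a m)) (?s (ms', y)) + frag_map (Pair a) (frag_extend ?b (?s (ms, y)))"
    by (simp add: Cons bar_split_def frag_linear bar_Cons frag_cmul_distrib2)
  have 2: "frag_extend (\<lambda>(a, x). frag_map (Pair a) (?s x)) (frag_map (Pair a) z)
    = frag_map (Pair a) (frag_extend ?s z)" for z
    by (simp add: frag_extend_map frag_map_extend)
  have 3: "frag_extend (\<lambda>(a, x). frag_map (Pair a) (?s x)) (bar K \<alpha> \<beta> (a, ms, y)) =
     frag_map (Pair (\<alpha> a m)) (?s (ms', y)) + frag_map (Pair a) (frag_extend ?s (bar_inner K \<beta> ms y))"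
    by (simp add: Cons bar_Cons frag_linear 2)
  show ?thesis
    unfolding 1 3 using arg_cong[OF inner, of "frag_map (Pair a)"]
    by (simp add: Cons frag_linear)
qed

end

text \<open>Elements of the right set are paired with the object over which they lie, because they
  need not determine it: for the rows \<open>a\<close> is the unit and lies over every
  object.\<close>

locale two_sided = left_action K Y t \<beta> for K :: "('o, 'm) cat" and Y :: "'y set" and t \<beta> +
  fixes A :: "('a \<times> 'o) set" and \<alpha> :: "'a \<Rightarrow> 'm \<Rightarrow> 'a"
  assumes ract_closed: "\<lbrakk>m \<in> Arr K; (a, rng K m) \<in> A\<rbrakk> \<Longrightarrow> (\<alpha> a m, src K m) \<in> A"
    and ract_cmp: "\<lbrakk>m \<in> Arr K; m' \<in> Arr K; (a, rng K m) \<in> A; src K m = rng K m'\<rbrakk>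
      \<Longrightarrow> \<alpha> a (cmp K m m') = \<alpha> (\<alpha> a m) m'"
begin

definition bar_tuples :: "('a \<times> 'm list \<times> 'y) set" where
  "bar_tuples = {(a, ms, y). y \<in> Y \<and> (\<exists>v. (a, v) \<in> A \<and> composable K v ms (t y))}"

lemma bar_keys:
  assumes "(a, ms, y) \<in> bar_tuples" "(a', ms', y') \<in> Poly_Mapping.keys (bar K \<alpha> \<beta> (a, ms, y))"
  shows "(a', ms', y') \<in> bar_tuples \<and> length ms = Suc (length ms')"
proof (cases ms)
  case (Cons m ms1)
  from assms(1) obtain v where v: "y \<in> Y" "(a, v) \<in> A" "composable K v ms (t y)"
    by (auto simp: bar_tuples_def)
  from assms(2) consider "a' = \<alpha> a m" "ms' = ms1" "y' = y"
    | "a' = a" "(ms', y') \<in> Poly_Mapping.keys (bar_inner K \<beta> ms y)"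
    unfolding Cons bar_Cons by (auto dest!: keys_frag_mapD set_mp[OF keys_add])
  then show ?thesis
  proof cases
    case 1
    with v show ?thesis by (auto simp: Cons bar_tuples_def intro!: exI[of _ "src K m"] ract_closed)
  next
    case 2
    with v show ?thesis
      using bar_inner_keys[OF v(3) v(1) 2(2)] bar_inner_length[OF 2(2)] by (auto simp: bar_tuples_def)
  qed
qed (use assms in auto)

text \<open>The terms in which \<open>a\<close> has been acted on cancel in pairs, those with two
  actions by \<open>ract_cmp\<close>; the others vanish by
  \<open>bar_inner_bar_inner\<close>.\<close>

lemma bar_bar:
  assumes "(a, ms, y) \<in> bar_tuples"
  shows "frag_extend (bar K \<alpha> \<beta>) (bar K \<alpha> \<beta> (a, ms, y)) = 0"
proof (cases ms)
  case (Cons m ms1)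
  from assms obtain v where v: "y \<in> Y" "(a, v) \<in> A" "composable K v ms (t y)"
    by (auto simp: bar_tuples_def)
  show ?thesis
  proof (cases ms1)
    case Nil
    then show ?thesis by (simp add: Cons bar_Cons frag_linear)
  next
    case ms1: (Cons m' ms2)
    let ?b = "\<lambda>(ms, y). bar_inner K \<beta> ms y" and ?B = "bar_inner K \<beta> ms1 y"
    have "frag_extend (bar K \<alpha> \<beta>) (frag_map (Pair a) (bar_inner K \<beta> ms y)) =
       frag_extend (\<lambda>(ms, y). frag_of (\<alpha> a (hd ms), tl ms, y)
          + frag_map (Pair a) (bar_inner K \<beta> ms y)) (bar_inner K \<beta> ms y)"
      unfolding frag_extend_map
    proof (rule frag_extend_eq, safe)
      fix L z assume "(L, z) \<in> Poly_Mapping.keys (bar_inner K \<beta> ms y)"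
      then show "bar K \<alpha> \<beta> (a, L, z) = frag_of (\<alpha> a (hd L), tl L, z) + frag_map (Pair a) (bar_inner K \<beta> L z)"
        by (cases L) (auto simp: bar_Cons Cons ms1 simp del: bar_inner.simps dest: bar_inner_length)
    qed
    also have "\<dots> = frag_map (\<lambda>(ms, y). (\<alpha> a (hd ms), tl ms, y)) (bar_inner K \<beta> ms y)
       + frag_map (Pair a) (frag_extend ?b (bar_inner K \<beta> ms y))"
      unfolding frag_map_extend unfolding frag_map_def frag_extend_plus_fun[symmetric]
      by (rule frag_extend_eq) auto
    also have "\<dots> = frag_map (\<lambda>(ms, y). (\<alpha> a (hd ms), tl ms, y)) (bar_inner K \<beta> ms y)"
      using bar_inner_bar_inner[OF v(3) v(1)] by simp
    also have "\<dots> = - frag_of (\<alpha> a (cmp K m m'), ms2, y) - frag_map (Pair (\<alpha> a m)) ?B"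
      by (auto simp: Cons ms1 frag_linear frag_map_map case_prod_unfold simp del: bar_inner.simps(2)
        intro!: frag_map_cong)
    also have "\<alpha> a (cmp K m m') = \<alpha> (\<alpha> a m) m'"
      using v by (auto simp: Cons ms1 intro!: ract_cmp)
    finally show ?thesis
      by (simp add: Cons bar_Cons ms1 frag_linear)
  qed
qed simp

end

text \<open>
  Naturality in the left \<open>K\<close>-set, along maps \<open>\<Omega>\<close> with values in chains so that the operators of
  the other direction of a double complex are covered.
\<close>

lemma bar_inner_natural:
  assumes "left_action K Y t \<beta>" "composable K v ms (t y)" "y \<in> Y"
    and nat: "\<And>m y. \<lbrakk>m \<in> Arr K; y \<in> Y; src K m = t y\<rbrakk> \<Longrightarrow> \<Omega> (\<beta> m y) = frag_map (\<beta>' m) (\<Omega> y)"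
  shows "frag_extend (\<lambda>(ms, y). frag_map (Pair ms) (\<Omega> y)) (bar_inner K \<beta> ms y) =
    frag_extend (bar_inner K \<beta>' ms) (\<Omega> y)"
  using assms(2)
proof (induction ms arbitrary: v)
  case (Cons m ms)
  let ?O = "\<lambda>(ms, y). frag_map (Pair ms) (\<Omega> y)"
  show ?case
  proof (cases ms)
    case Nil
    have "frag_extend (bar_inner K \<beta>' [m]) (\<Omega> y) = - frag_map (\<lambda>x. ([], \<beta>' m x)) (\<Omega> y)"
      unfolding frag_map_def frag_extend_minus_fun[symmetric] by (rule frag_extend_eq) simp
    moreover have "frag_extend ?O (bar_inner K \<beta> [m] y) = - frag_map (\<lambda>x. ([], \<beta>' m x)) (\<Omega> y)"
      using Nil Cons.prems assms(3) by (simp add: frag_linear nat frag_map_map)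
    ultimately show ?thesis
      unfolding Nil by (simp only:)
  next
    case ms: (Cons m' ms')
    have 1: "frag_extend ?O (frag_map (apfst ((#) m)) z) = frag_map (apfst ((#) m)) (frag_extend ?O z)" for z
      unfolding frag_extend_map frag_map_extend
      by (rule frag_extend_eq) (auto simp: frag_map_map)
    have "frag_extend (bar_inner K \<beta>' (m # ms)) (\<Omega> y) =
      - frag_map (Pair (cmp K m m' # ms')) (\<Omega> y)
      - frag_map (apfst ((#) m)) (frag_extend (bar_inner K \<beta>' ms) (\<Omega> y))"
      unfolding frag_map_def[of "Pair (cmp K m m' # ms')"] frag_map_extend
        frag_extend_minus_fun[symmetric] frag_extend_diff_fun[symmetric]
      by (rule frag_extend_eq) (simp add: ms)
    moreover have "frag_extend ?O (bar_inner K \<beta> (m # ms) y) =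
      - frag_map (Pair (cmp K m m' # ms')) (\<Omega> y)
      - frag_map (apfst ((#) m)) (frag_extend ?O (bar_inner K \<beta> ms y))"
      by (simp add: ms frag_linear 1)
    moreover have "frag_extend ?O (bar_inner K \<beta> ms y) = frag_extend (bar_inner K \<beta>' ms) (\<Omega> y)"
      using Cons.IH[of "src K m"] Cons.prems by simp
    ultimately show ?thesis
      by (simp only:)
  qed
qed (simp add: frag_extend_eq_0)

lemma bar_natural:
  assumes "left_action K Y t \<beta>" "composable K v ms (t y)" "y \<in> Y"
    and nat: "\<And>m y. \<lbrakk>m \<in> Arr K; y \<in> Y; src K m = t y\<rbrakk> \<Longrightarrow> \<Omega> (\<beta> m y) = frag_map (\<beta>' m) (\<Omega> y)"
  shows "frag_extend (\<lambda>(a, ms, y). frag_map (\<lambda>y. (a, ms, y)) (\<Omega> y)) (bar K \<alpha> \<beta> (a, ms, y)) =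
    frag_extend (bar K \<alpha> \<beta>') (frag_map (\<lambda>y. (a, ms, y)) (\<Omega> y))"
proof (cases ms)
  case (Cons m ms')
  let ?O = "\<lambda>(ms, y). frag_map (Pair ms) (\<Omega> y)"
  have 1: "frag_extend (\<lambda>(a, ms, y). frag_map (\<lambda>y. (a, ms, y)) (\<Omega> y)) (frag_map (Pair a) z) =
    frag_map (Pair a) (frag_extend ?O z)" for z
    unfolding frag_extend_map frag_map_extend
    by (rule frag_extend_eq) (auto simp: frag_map_map)
  have "frag_extend (bar K \<alpha> \<beta>') (frag_map (\<lambda>y. (a, ms, y)) (\<Omega> y)) =
     frag_map (\<lambda>y. (\<alpha> a m, ms', y)) (\<Omega> y) + frag_map (Pair a) (frag_extend (bar_inner K \<beta>' ms) (\<Omega> y))"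
    unfolding frag_extend_map frag_map_extend frag_map_def[of "\<lambda>y. (\<alpha> a m, ms', y)"]
      frag_extend_plus_fun[symmetric]
    by (rule frag_extend_eq) (simp add: Cons bar_Cons)
  moreover have "frag_extend ?O (bar_inner K \<beta> ms y) = frag_extend (bar_inner K \<beta>' ms) (\<Omega> y)"
    by (rule bar_inner_natural[OF assms(1-3)]) (rule nat)
  ultimately show ?thesis
    by (simp add: Cons bar_Cons frag_linear 1 del: bar_inner.simps)
qed (simp add: frag_extend_map)

lemma bar_natural_map:
  assumes "left_action K Y t \<beta>" "composable K v ms (t y)" "y \<in> Y"
    and nat: "\<And>m y. \<lbrakk>m \<in> Arr K; y \<in> Y; src K m = t y\<rbrakk> \<Longrightarrow> g (\<beta> m y) = \<beta>' m (g y)"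
  shows "frag_map (\<lambda>(a, ms, y). (a, ms, g y)) (bar K \<alpha> \<beta> (a, ms, y)) = bar K \<alpha> \<beta>' (a, ms, g y)"
  using bar_natural[OF assms(1-3), of "\<lambda>y. frag_of (g y)" \<beta>' \<alpha> a] nat
  by (simp add: frag_map_def case_prod_unfold)

section \<open>Comparison with sums over faces\<close>

lemma merge_Cons: "1 \<le> i \<Longrightarrow> merge K (Suc i) (m # ms) = m # merge K i ms"
  by (cases i) (auto simp: merge_def)

text \<open>Links the recursive form, on which all inductions run, with the alternating sums in
  \<open>dh\<close>, \<open>dv\<close> and \<open>cat_boundary\<close>.\<close>

lemma bar_inner_sum:
  assumes "ms \<noteq> []"
  shows "bar_inner K \<beta> ms y =
    (\<Sum>i\<in>{1..<length ms}. frag_cmul ((-1) ^ i) (frag_of (merge K i ms, y)))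
    + frag_cmul ((-1) ^ length ms) (frag_of (butlast ms, \<beta> (last ms) y))"
  using assms
proof (induction ms)
  case (Cons m ms)
  show ?case
  proof (cases ms)
    case ms: (Cons m' ms')
    let ?f = "\<lambda>i. frag_cmul ((-1) ^ i) (frag_of (merge K i (m # ms), y))"
    have "(\<Sum>i\<in>{1..<length (m # ms)}. ?f i) = ?f 1 + (\<Sum>i\<in>{1..<length ms}. ?f (Suc i))"
      by (simp add: ms sum.atLeast_Suc_lessThan sum.shift_bounds_Suc_ivl del: sum.op_ivl_Suc)
    also have "?f 1 = - frag_of (cmp K m m' # ms', y)"
      by (simp add: merge_def ms)
    also have "(\<Sum>i\<in>{1..<length ms}. ?f (Suc i)) =
        - frag_map (apfst ((#) m)) (\<Sum>i\<in>{1..<length ms}. frag_cmul ((-1) ^ i) (frag_of (merge K i ms, y)))"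
      by (auto simp: frag_map_def frag_extend_sum merge_Cons frag_extend_cmul sum_negf[symmetric] intro!: sum.cong)
    finally show ?thesis
      using Cons.IH by (simp add: ms frag_linear del: sum.op_ivl_Suc)
  qed simp
qed simp

section \<open>Comparison of free resolutions\<close>

definition right_mult :: "('o, 'k) cat \<Rightarrow> 'k \<Rightarrow> ('x \<times> 'k \<Rightarrow>\<^sub>0 int) \<Rightarrow> ('x \<times> 'k \<Rightarrow>\<^sub>0 int)" where
  "right_mult K h = frag_map (\<lambda>(x, k). (x, cmp K k h))"

text \<open>A map of free right modules is determined by its values on the generators:
  \<open>f x\<close> is the value at \<open>x\<close> with identity coefficient, and multiplication
  by \<open>k\<close> gives the rest.\<close>

definition lin_ext :: "('o, 'k) cat \<Rightarrow> ('x \<Rightarrow> ('y \<times> 'k \<Rightarrow>\<^sub>0 int)) \<Rightarrow>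
    ('x \<times> 'k \<Rightarrow>\<^sub>0 int) \<Rightarrow> ('y \<times> 'k \<Rightarrow>\<^sub>0 int)" where
  "lin_ext K f = frag_extend (\<lambda>(x, k). right_mult K k (f x))"

abbreviation aug :: "('x \<Rightarrow>\<^sub>0 int) \<Rightarrow> (unit \<Rightarrow>\<^sub>0 int)" where
  "aug \<equiv> frag_map (\<lambda>_. ())"

definition free_chains :: "('o, 'k) cat \<Rightarrow> (nat \<Rightarrow> 'x set) \<Rightarrow> ('x \<Rightarrow> 'o) \<Rightarrow> nat \<Rightarrow> 'o \<Rightarrow> ('x \<times> 'k \<Rightarrow>\<^sub>0 int) set" where
  "free_chains K X \<sigma> n w = {z. Poly_Mapping.keys z \<subseteq>
     {(x, k). x \<in> X n \<and> k \<in> Arr K \<and> rng K k = \<sigma> x \<and> src K k = w}}"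

text \<open>
  A free resolution of the constant right \<open>K\<close>-module with value the integers. A generator \<open>x\<close> of
  degree \<open>n\<close> lives at the object \<open>\<sigma> x\<close>, and the pair \<open>(x, k)\<close> is \<open>x\<close> multiplied by \<open>k\<close>; so
  \<open>free_chains K X \<sigma> n w\<close> is the value of the degree \<open>n\<close> module at the object \<open>w\<close>. Tensoring with the constant
  left module means forgetting \<open>k\<close>.
\<close>

locale free_resolution = small_category K for K :: "('o, 'k) cat" +
  fixes X :: "nat \<Rightarrow> 'x set" and \<sigma> :: "'x \<Rightarrow> 'o" and bd :: "'x \<times> 'k \<Rightarrow> ('x \<times> 'k \<Rightarrow>\<^sub>0 int)"
  assumes \<sigma>_Obj: "x \<in> X n \<Longrightarrow> \<sigma> x \<in> Obj K"
    and bd_zero: "x \<in> X 0 \<Longrightarrow> bd (x, k) = 0"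
    and bd_closed: "\<lbrakk>x \<in> X (Suc n); k \<in> Arr K; rng K k = \<sigma> x\<rbrakk> \<Longrightarrow> bd (x, k) \<in> free_chains K X \<sigma> n (src K k)"
    and bd_bd: "\<lbrakk>x \<in> X n; k \<in> Arr K; rng K k = \<sigma> x\<rbrakk> \<Longrightarrow> frag_extend bd (bd (x, k)) = 0"
    and bd_aug: "\<lbrakk>x \<in> X (Suc 0); k \<in> Arr K; rng K k = \<sigma> x\<rbrakk> \<Longrightarrow> aug (bd (x, k)) = 0"
    and bd_right_mult: "\<lbrakk>x \<in> X n; k \<in> Arr K; rng K k = \<sigma> x; h \<in> Arr K; src K k = rng K h\<rbrakk>
      \<Longrightarrow> bd (x, cmp K k h) = right_mult K h (bd (x, k))"
    and exact: "\<lbrakk>z \<in> free_chains K X \<sigma> (Suc n) w; frag_extend bd z = 0\<rbrakk>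
      \<Longrightarrow> \<exists>y\<in>free_chains K X \<sigma> (Suc (Suc n)) w. frag_extend bd y = z"
    and exact_aug: "\<lbrakk>z \<in> free_chains K X \<sigma> 0 w; aug z = 0\<rbrakk> \<Longrightarrow> \<exists>y\<in>free_chains K X \<sigma> (Suc 0) w. frag_extend bd y = z"
    and point: "w \<in> Obj K \<Longrightarrow> \<exists>z\<in>free_chains K X \<sigma> 0 w. aug z = frag_of ()"
begin

abbreviation res_chains :: "nat \<Rightarrow> 'o \<Rightarrow> ('x \<times> 'k \<Rightarrow>\<^sub>0 int) set" where
  "res_chains \<equiv> free_chains K X \<sigma>"

text \<open>The boundary after tensoring with the constant left module. Evaluation at the identity
  loses nothing: by \<open>bd_right_mult\<close> any other \<open>k\<close> gives the same result
  once \<open>k\<close> is forgotten, see \<open>fst_bd\<close>.\<close>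

definition qbd :: "'x \<Rightarrow> ('x \<Rightarrow>\<^sub>0 int)" where
  "qbd x = frag_map fst (bd (x, ident K (\<sigma> x)))"

text \<open>Cycles of the augmented complex, so that the single statement \<open>exact_cycle\<close>
  covers all degrees.\<close>

definition cycle :: "nat \<Rightarrow> ('x \<times> 'k \<Rightarrow>\<^sub>0 int) \<Rightarrow> bool" where
  "cycle n z \<longleftrightarrow> (if n = 0 then aug z = 0 else frag_extend bd z = 0)"

definition qcycles :: "nat \<Rightarrow> ('x \<Rightarrow>\<^sub>0 int) set" where
  "qcycles n = {z. Poly_Mapping.keys z \<subseteq> X n \<and> frag_extend qbd z = 0}"

definition qboundaries :: "nat \<Rightarrow> ('x \<Rightarrow>\<^sub>0 int) set" where
  "qboundaries n = frag_extend qbd ` {z. Poly_Mapping.keys z \<subseteq> X (Suc n)}"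

lemma exact_cycle: "z \<in> res_chains n w \<Longrightarrow> cycle n z \<Longrightarrow> \<exists>y\<in>res_chains (Suc n) w. frag_extend bd y = z"
  using exact exact_aug by (cases n) (auto simp: cycle_def)

lemma chains_induct [consumes 1, case_names zero gen diff]:
  assumes "z \<in> res_chains n w" "P 0"
    and "\<And>x k. \<lbrakk>x \<in> X n; k \<in> Arr K; rng K k = \<sigma> x; src K k = w\<rbrakk> \<Longrightarrow> P (frag_of (x, k))"
    and "\<And>a b. P a \<Longrightarrow> P b \<Longrightarrow> P (a - b)"
  shows "P z"
  using assms(1) unfolding free_chains_def mem_Collect_eq
  by (rule frag_induction) (use assms in auto)

lemma chains_zero: "0 \<in> res_chains n w"
  and chains_diff: "a \<in> res_chains n w \<Longrightarrow> b \<in> res_chains n w \<Longrightarrow> a - b \<in> res_chains n w"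
  and chains_gen: "\<lbrakk>x \<in> X n; k \<in> Arr K; rng K k = \<sigma> x; src K k = w\<rbrakk> \<Longrightarrow> frag_of (x, k) \<in> res_chains n w"
  by (auto simp: free_chains_def keys_diff_subset)

lemma bd_chains: "z \<in> res_chains (Suc n) w \<Longrightarrow> frag_extend bd z \<in> res_chains n w"
  by (induction rule: chains_induct) (auto simp: frag_linear chains_zero chains_diff bd_closed)

lemma cycle_bd: "z \<in> res_chains (Suc n) w \<Longrightarrow> cycle n (frag_extend bd z)"
proof (induction rule: chains_induct)
  case (gen x k)
  then show ?case by (auto simp: cycle_def bd_bd bd_aug)
qed (auto simp: cycle_def frag_linear)

lemma right_mult_chains:
  assumes "z \<in> res_chains n w" "h \<in> Arr K" "rng K h = w"
  shows "right_mult K h z \<in> res_chains n (src K h)"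
  using assms(1)
proof (induction rule: chains_induct)
  case (gen x k)
  then show ?case using assms
    by (auto simp: right_mult_def intro!: chains_gen cmp_Arr simp: rng_cmp src_cmp)
qed (auto simp: right_mult_def frag_linear chains_zero chains_diff)

lemma right_mult_bd:
  assumes "z \<in> res_chains n w" "h \<in> Arr K" "rng K h = w"
  shows "frag_extend bd (right_mult K h z) = right_mult K h (frag_extend bd z)"
  using assms(1)
proof (induction rule: chains_induct)
  case (gen x k)
  then have "bd (x, cmp K k h) = right_mult K h (bd (x, k))"
    using assms by (intro bd_right_mult) auto
  then show ?case
    by (simp add: right_mult_def)
qed (auto simp: right_mult_def frag_linear)

lemma right_mult_right_mult:
  assumes "z \<in> res_chains n w" "h \<in> Arr K" "rng K h = w" "h' \<in> Arr K" "rng K h' = src K h"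
  shows "right_mult K h' (right_mult K h z) = right_mult K (cmp K h h') z"
  using assms(1)
proof (induction rule: chains_induct)
  case (gen x k)
  then show ?case using assms by (auto simp: right_mult_def cmp_assoc)
qed (auto simp: right_mult_def frag_linear)

lemma right_mult_ident:
  assumes "z \<in> res_chains n w"
  shows "right_mult K (ident K w) z = z"
  using assms
proof (induction rule: chains_induct)
  case (gen x k)
  then show ?case by (auto simp: right_mult_def cmp_ident_right)
qed (auto simp: right_mult_def frag_linear)

lemma aug_right_mult: "aug (right_mult K h z) = aug z"
  by (simp add: right_mult_def frag_map_map case_prod_unfold)

lemma fst_right_mult: "frag_map fst (right_mult K h z) = frag_map fst z"
  by (simp add: right_mult_def frag_map_map case_prod_unfold)

lemma gen_chains: "x \<in> X n \<Longrightarrow> frag_of (x, ident K (\<sigma> x)) \<in> res_chains n (\<sigma> x)"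
  by (rule chains_gen) (simp_all add: ident_Arr rng_ident src_ident \<sigma>_Obj)

lemma bd_gen_chains: "x \<in> X (Suc n) \<Longrightarrow> bd (x, ident K (\<sigma> x)) \<in> res_chains n (\<sigma> x)"
  using bd_closed[of x n "ident K (\<sigma> x)"] by (simp add: \<sigma>_Obj ident_Arr rng_ident src_ident)

lemma bd_gen_mult:
  assumes "x \<in> X n" "k \<in> Arr K" "rng K k = \<sigma> x"
  shows "bd (x, k) = right_mult K k (bd (x, ident K (\<sigma> x)))"
  using bd_right_mult[of x n "ident K (\<sigma> x)" k] assms
  by (simp add: \<sigma>_Obj ident_Arr rng_ident src_ident) (metis cmp_ident_left)

lemma fst_bd:
  assumes "z \<in> res_chains n w"
  shows "frag_map fst (frag_extend bd z) = frag_extend qbd (frag_map fst z)"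
  using assms
proof (induction rule: chains_induct)
  case (gen x k)
  then have "frag_map fst (bd (x, k)) = qbd x"
    by (subst bd_gen_mult) (auto simp: fst_right_mult qbd_def)
  then show ?case by simp
qed (auto simp: frag_linear)

lemma fst_chains: "z \<in> res_chains n w \<Longrightarrow> Poly_Mapping.keys (frag_map fst z) \<subseteq> X n"
  by (auto simp: free_chains_def dest!: keys_frag_mapD)

end

section \<open>Chain maps between two resolutions and their homotopies\<close>

locale resolution_pair =
  R: free_resolution K X \<sigma> bd + S: free_resolution K X' \<sigma>' bd'
  for K :: "('o, 'k) cat" and X :: "nat \<Rightarrow> 'x set" and \<sigma> bd
    and X' :: "nat \<Rightarrow> 'y set" and \<sigma>' bd'
begin

abbreviation "res_chains \<equiv> R.res_chains"
abbreviation "res_chains' \<equiv> S.res_chains"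

lemma lin_ext_closed:
  assumes "\<And>x. x \<in> X n \<Longrightarrow> f x \<in> res_chains' m (\<sigma> x)" "z \<in> res_chains n w"
  shows "lin_ext K f z \<in> res_chains' m w"
  using assms(2)
proof (induction rule: R.chains_induct)
  case (gen x k)
  then show ?case using S.right_mult_chains[OF assms(1)] by (auto simp: lin_ext_def)
qed (auto simp: lin_ext_def frag_linear S.chains_zero S.chains_diff)

lemma lin_ext_right_mult:
  assumes "\<And>x. x \<in> X n \<Longrightarrow> f x \<in> res_chains' m (\<sigma> x)" "z \<in> res_chains n w" "h \<in> Arr K" "rng K h = w"
  shows "lin_ext K f (right_mult K h z) = right_mult K h (lin_ext K f z)"
  using assms(2)
proof (induction rule: R.chains_induct)
  case (gen x k)
  then have "right_mult K (cmp K k h) (f x) = right_mult K h (right_mult K k (f x))"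
    using assms S.right_mult_right_mult[OF assms(1)[of x], of k h] by simp
  then show ?case
    by (simp add: lin_ext_def right_mult_def)
qed (auto simp: lin_ext_def right_mult_def frag_linear)

lemma lin_ext_bd:
  assumes f: "\<And>x. x \<in> X n \<Longrightarrow> f x \<in> res_chains' m (\<sigma> x)"
    and z: "z \<in> res_chains n w"
    and eq: "\<And>x. x \<in> X n \<Longrightarrow> frag_extend bd' (f x) = g x"
  shows "frag_extend bd' (lin_ext K f z) = lin_ext K g z"
  using z
proof (induction rule: R.chains_induct)
  case (gen x k)
  then show ?case using S.right_mult_bd[OF f[of x]] eq by (simp add: lin_ext_def)
qed (auto simp: lin_ext_def frag_linear)

lemma lin_ext_bd_gen:
  assumes f: "\<And>x. x \<in> X n \<Longrightarrow> f x \<in> res_chains' m (\<sigma> x)" and z: "z \<in> res_chains (Suc n) w"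
  shows "lin_ext K (\<lambda>x. lin_ext K f (bd (x, ident K (\<sigma> x)))) z = lin_ext K f (frag_extend bd z)"
  using z
proof (induction rule: R.chains_induct)
  case (gen x k)
  have "right_mult K k (lin_ext K f (bd (x, ident K (\<sigma> x)))) =
    lin_ext K f (right_mult K k (bd (x, ident K (\<sigma> x))))"
    using gen by (intro lin_ext_right_mult[OF f, symmetric]) (auto intro: R.bd_gen_chains)
  also have "\<dots> = lin_ext K f (bd (x, k))"
    using R.bd_gen_mult[OF gen(1-3)] by simp
  finally show ?case by (simp add: lin_ext_def)
qed (auto simp: lin_ext_def frag_linear)

lemma lin_ext_diff: "lin_ext K (\<lambda>x. f x - g x) z = lin_ext K f z - lin_ext K g z"
  unfolding lin_ext_def frag_extend_diff_fun[symmetric]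
  by (rule frag_extend_eq) (auto simp: right_mult_def frag_linear)

lemma lin_ext_zero: "lin_ext K f 0 = 0"
  by (simp add: lin_ext_def)

text \<open>The comparison theorem of homological algebra: freeness lets the map be chosen on
  generators, and exactness of the target provides each value from those one degree below.\<close>

lemma comparison_map:
  "\<exists>f. (\<forall>n. \<forall>x\<in>X n. f n x \<in> res_chains' n (\<sigma> x)) \<and> (\<forall>x\<in>X 0. aug (f 0 x) = frag_of ()) \<and>
    (\<forall>n. \<forall>x\<in>X (Suc n). frag_extend bd' (f (Suc n) x) = lin_ext K (f n) (bd (x, ident K (\<sigma> x))))"
proof -
  \<comment> \<open>Preservation of cycles is carried along because exactness yields a lift in the
    next degree only for a cycle.\<close>
  define P where "P n f \<longleftrightarrow> (\<forall>x\<in>X n. f x \<in> res_chains' n (\<sigma> x)) \<and>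
     (n = 0 \<longrightarrow> (\<forall>x\<in>X 0. aug (f x) = frag_of ())) \<and>
     (\<forall>w. \<forall>z\<in>res_chains n w. R.cycle n z \<longrightarrow> S.cycle n (lin_ext K f z))" for n f
  define Q where "Q n f g \<longleftrightarrow>
     (\<forall>x\<in>X (Suc n). frag_extend bd' (g x) = lin_ext K f (bd (x, ident K (\<sigma> x))))" for n f g
  have "\<exists>f. \<forall>n. P n (f n) \<and> Q n (f n) (f (Suc n))"
  proof (rule dependent_nat_choice)
    have "\<forall>x\<in>X 0. \<exists>y. y \<in> res_chains' 0 (\<sigma> x) \<and> aug y = frag_of ()"
      using S.point R.\<sigma>_Obj by blast
    then obtain f where f: "\<And>x. x \<in> X 0 \<Longrightarrow> f x \<in> res_chains' 0 (\<sigma> x)"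
        "\<And>x. x \<in> X 0 \<Longrightarrow> aug (f x) = frag_of ()"
      by metis
    have "aug (lin_ext K f z) = aug z" if "z \<in> res_chains 0 w" for z w
      using that
    proof (induction rule: R.chains_induct)
      case (gen x k)
      then show ?case by (simp add: lin_ext_def S.aug_right_mult f)
    qed (auto simp: lin_ext_def frag_linear)
    with f show "\<exists>f. P 0 f"
      by (intro exI[of _ f]) (auto simp: P_def R.cycle_def S.cycle_def)
  next
    fix f n assume P: "P n f"
    then have f: "\<And>x. x \<in> X n \<Longrightarrow> f x \<in> res_chains' n (\<sigma> x)" by (auto simp: P_def)
    have "\<forall>x\<in>X (Suc n). \<exists>y. y \<in> res_chains' (Suc n) (\<sigma> x) \<and>
        frag_extend bd' y = lin_ext K f (bd (x, ident K (\<sigma> x)))"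
    proof
      fix x assume x: "x \<in> X (Suc n)"
      have "R.cycle n (bd (x, ident K (\<sigma> x)))"
        using R.cycle_bd[OF R.gen_chains[OF x]] by simp
      then have "S.cycle n (lin_ext K f (bd (x, ident K (\<sigma> x))))"
        using P R.bd_gen_chains[OF x] by (auto simp: P_def)
      moreover have "lin_ext K f (bd (x, ident K (\<sigma> x))) \<in> res_chains' n (\<sigma> x)"
        by (rule lin_ext_closed[OF f R.bd_gen_chains[OF x]])
      ultimately show "\<exists>y. y \<in> res_chains' (Suc n) (\<sigma> x) \<and>
          frag_extend bd' y = lin_ext K f (bd (x, ident K (\<sigma> x)))"
        using S.exact_cycle by blast
    qed
    then obtain g where g: "\<And>x. x \<in> X (Suc n) \<Longrightarrow> g x \<in> res_chains' (Suc n) (\<sigma> x)"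
      "\<And>x. x \<in> X (Suc n) \<Longrightarrow> frag_extend bd' (g x) = lin_ext K f (bd (x, ident K (\<sigma> x)))"
      by metis
    have "frag_extend bd' (lin_ext K g z) = lin_ext K f (frag_extend bd z)" if "z \<in> res_chains (Suc n) w" for z w
      using lin_ext_bd[OF g(1) that g(2)] lin_ext_bd_gen[OF f that] by simp
    then have "P (Suc n) g"
      using g(1) by (auto simp: P_def R.cycle_def S.cycle_def lin_ext_zero)
    with g show "\<exists>g. P (Suc n) g \<and> Q n f g"
      by (auto simp: Q_def)
  qed
  then obtain f where "\<And>n. P n (f n)" "\<And>n. Q n (f n) (f (Suc n))"
    by blast
  then show ?thesis
    by (intro exI[of _ f]) (simp add: P_def Q_def)
qed

text \<open>A chain map covering zero under the augmentation is null-homotopic, by the same lifting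
  argument applied to \<open>g (Suc n) x\<close> minus what the homotopy in degree \<open>n\<close>
  already accounts for.\<close>

lemma null_homotopy:
  assumes g: "\<And>n x. x \<in> X n \<Longrightarrow> g n x \<in> res_chains' n (\<sigma> x)"
    and g0: "\<And>x. x \<in> X 0 \<Longrightarrow> aug (g 0 x) = 0"
    and gbd: "\<And>n x. x \<in> X (Suc n) \<Longrightarrow>
      frag_extend bd' (g (Suc n) x) = lin_ext K (g n) (bd (x, ident K (\<sigma> x)))"
  shows "\<exists>h. (\<forall>n. \<forall>x\<in>X n. h n x \<in> res_chains' (Suc n) (\<sigma> x)) \<and>
    (\<forall>x\<in>X 0. frag_extend bd' (h 0 x) = g 0 x) \<and>
    (\<forall>n. \<forall>x\<in>X (Suc n). frag_extend bd' (h (Suc n) x) =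
       g (Suc n) x - lin_ext K (h n) (bd (x, ident K (\<sigma> x))))"
proof -
  \<comment> \<open>On cycles the homotopy formula has no lower term. This clause shows that the
    next element to be lifted is a cycle.\<close>
  define P where "P n h \<longleftrightarrow> (\<forall>x\<in>X n. h x \<in> res_chains' (Suc n) (\<sigma> x)) \<and>
     (n = 0 \<longrightarrow> (\<forall>x\<in>X 0. frag_extend bd' (h x) = g 0 x)) \<and>
     (\<forall>w. \<forall>z\<in>res_chains n w. R.cycle n z \<longrightarrow> frag_extend bd' (lin_ext K h z) = lin_ext K (g n) z)" for n h
  define Q where "Q n h h' \<longleftrightarrow> (\<forall>x\<in>X (Suc n). frag_extend bd' (h' x) =
       g (Suc n) x - lin_ext K h (bd (x, ident K (\<sigma> x))))" for n h h'
  have "\<exists>h. \<forall>n. P n (h n) \<and> Q n (h n) (h (Suc n))"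
  proof (rule dependent_nat_choice)
    have "\<forall>x\<in>X 0. \<exists>y. y \<in> res_chains' (Suc 0) (\<sigma> x) \<and> frag_extend bd' y = g 0 x"
      using S.exact_aug[OF g g0] by blast
    then obtain h where h: "\<And>x. x \<in> X 0 \<Longrightarrow> h x \<in> res_chains' (Suc 0) (\<sigma> x)"
        "\<And>x. x \<in> X 0 \<Longrightarrow> frag_extend bd' (h x) = g 0 x"
      by metis
    with lin_ext_bd[OF h(1) _ h(2)] show "\<exists>f. P 0 f"
      by (intro exI[of _ h]) (auto simp: P_def)
  next
    fix h n assume P: "P n h"
    then have h: "\<And>x. x \<in> X n \<Longrightarrow> h x \<in> res_chains' (Suc n) (\<sigma> x)" by (auto simp: P_def)
    have "\<forall>x\<in>X (Suc n). \<exists>y. y \<in> res_chains' (Suc (Suc n)) (\<sigma> x) \<and>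
        frag_extend bd' y = g (Suc n) x - lin_ext K h (bd (x, ident K (\<sigma> x)))"
    proof
      fix x assume x: "x \<in> X (Suc n)"
      have "R.cycle n (bd (x, ident K (\<sigma> x)))"
        using R.cycle_bd[OF R.gen_chains[OF x]] by simp
      then have "frag_extend bd' (lin_ext K h (bd (x, ident K (\<sigma> x)))) = lin_ext K (g n) (bd (x, ident K (\<sigma> x)))"
        using P R.bd_gen_chains[OF x] by (auto simp: P_def)
      then have "S.cycle (Suc n) (g (Suc n) x - lin_ext K h (bd (x, ident K (\<sigma> x))))"
        by (simp add: S.cycle_def frag_linear gbd x)
      moreover have "lin_ext K h (bd (x, ident K (\<sigma> x))) \<in> res_chains' (Suc n) (\<sigma> x)"
        by (rule lin_ext_closed[OF h R.bd_gen_chains[OF x]])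
      ultimately show "\<exists>y. y \<in> res_chains' (Suc (Suc n)) (\<sigma> x) \<and>
          frag_extend bd' y = g (Suc n) x - lin_ext K h (bd (x, ident K (\<sigma> x)))"
        using S.exact_cycle S.chains_diff g[OF x] by blast
    qed
    then obtain h' where h': "\<And>x. x \<in> X (Suc n) \<Longrightarrow> h' x \<in> res_chains' (Suc (Suc n)) (\<sigma> x)"
      "\<And>x. x \<in> X (Suc n) \<Longrightarrow> frag_extend bd' (h' x) = g (Suc n) x - lin_ext K h (bd (x, ident K (\<sigma> x)))"
      by metis
    have "frag_extend bd' (lin_ext K h' z) = lin_ext K (g (Suc n)) z - lin_ext K h (frag_extend bd z)"
      if "z \<in> res_chains (Suc n) w" for z w
      using lin_ext_bd[OF h'(1) that h'(2)] lin_ext_bd_gen[OF h that] by (simp add: lin_ext_diff)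
    then have "P (Suc n) h'"
      using h'(1) by (auto simp: P_def R.cycle_def lin_ext_zero)
    with h' show "\<exists>g. P (Suc n) g \<and> Q n h g"
      by (auto simp: Q_def)
  qed
  then obtain h where "\<And>n. P n (h n)" "\<And>n. Q n (h n) (h (Suc n))"
    by blast
  then show ?thesis
    by (intro exI[of _ h]) (simp add: P_def Q_def)
qed

definition qmap :: "('x \<Rightarrow> ('y \<times> 'k \<Rightarrow>\<^sub>0 int)) \<Rightarrow> ('x \<Rightarrow>\<^sub>0 int) \<Rightarrow> ('y \<Rightarrow>\<^sub>0 int)" where
  "qmap f = frag_extend (\<lambda>x. frag_map fst (f x))"

lemma qmap_fst: "frag_map fst (lin_ext K f z) = qmap f (frag_map fst z)"
  unfolding lin_ext_def qmap_def frag_map_extend frag_extend_map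
  by (rule frag_extend_eq) (auto simp: S.fst_right_mult)

lemma qmap_keys:
  assumes "\<And>x. x \<in> X n \<Longrightarrow> f x \<in> res_chains' m (\<sigma> x)" "Poly_Mapping.keys z \<subseteq> X n"
  shows "Poly_Mapping.keys (qmap f z) \<subseteq> X' m"
  unfolding qmap_def using assms by (intro keys_frag_extend_subset S.fst_chains) auto

lemma qmap_chain_map:
  assumes f: "\<And>n x. x \<in> X n \<Longrightarrow> f n x \<in> res_chains' n (\<sigma> x)"
    and fbd: "\<And>n x. x \<in> X (Suc n) \<Longrightarrow>
      frag_extend bd' (f (Suc n) x) = lin_ext K (f n) (bd (x, ident K (\<sigma> x)))"
    and z: "Poly_Mapping.keys z \<subseteq> X (Suc n)"
  shows "frag_extend S.qbd (qmap (f (Suc n)) z) = qmap (f n) (frag_extend R.qbd z)"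
  using z
proof (induction rule: frag_induction)
  case (one x)
  have "frag_extend S.qbd (frag_map fst (f (Suc n) x)) = frag_map fst (frag_extend bd' (f (Suc n) x))"
    using S.fst_bd[OF f[OF one]] by simp
  also have "\<dots> = qmap (f n) (frag_map fst (bd (x, ident K (\<sigma> x))))"
    using fbd[OF one] by (simp add: qmap_fst)
  finally show ?case
    by (simp add: qmap_def R.qbd_def)
qed (auto simp: qmap_def frag_linear)

lemma qbd_zero: "x \<in> X' 0 \<Longrightarrow> S.qbd x = 0"
  by (simp add: S.qbd_def S.bd_zero)

lemma qbd_zero_chain: "Poly_Mapping.keys z \<subseteq> X' 0 \<Longrightarrow> frag_extend S.qbd z = 0"
  by (intro frag_extend_eq_0 qbd_zero) auto

lemma qmap_null:
  assumes g: "\<And>n x. x \<in> X n \<Longrightarrow> g n x \<in> res_chains' n (\<sigma> x)"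
    and g0: "\<And>x. x \<in> X 0 \<Longrightarrow> aug (g 0 x) = 0"
    and gbd: "\<And>n x. x \<in> X (Suc n) \<Longrightarrow>
      frag_extend bd' (g (Suc n) x) = lin_ext K (g n) (bd (x, ident K (\<sigma> x)))"
    and z: "z \<in> R.qcycles n"
  shows "qmap (g n) z \<in> S.qboundaries n"
proof -
  obtain h where h: "\<And>n x. x \<in> X n \<Longrightarrow> h n x \<in> res_chains' (Suc n) (\<sigma> x)"
    "\<And>x. x \<in> X 0 \<Longrightarrow> frag_extend bd' (h 0 x) = g 0 x"
    "\<And>n x. x \<in> X (Suc n) \<Longrightarrow> frag_extend bd' (h (Suc n) x) =
       g (Suc n) x - lin_ext K (h n) (bd (x, ident K (\<sigma> x)))"
    using null_homotopy[OF g g0 gbd] by blast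
  from z have kz: "Poly_Mapping.keys z \<subseteq> X n" and dz: "frag_extend R.qbd z = 0"
    by (auto simp: R.qcycles_def)
  have "frag_extend S.qbd (qmap (h n) z) = qmap (g n) z"
  proof (cases n)
    case 0
    show ?thesis using kz unfolding 0
    proof (induction rule: frag_induction)
      case (one x)
      then show ?case using S.fst_bd[OF h(1)[OF one]] h(2) by (simp add: qmap_def)
    qed (auto simp: qmap_def frag_linear)
  next
    case (Suc m)
    have "frag_extend S.qbd (qmap (h (Suc m)) z) = qmap (g (Suc m)) z - qmap (h m) (frag_extend R.qbd z)"
      using kz unfolding Suc
    proof (induction rule: frag_induction)
      case (one x)
      then show ?case using S.fst_bd[OF h(1)[OF one]] h(3)[OF one]
        by (simp add: qmap_def[of "h (Suc m)"] qmap_def[of "g (Suc m)"] frag_linear qmap_fst R.qbd_def)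
    qed (auto simp: qmap_def frag_linear)
    then show ?thesis by (simp add: Suc dz) (simp add: qmap_def)
  qed
  moreover have "Poly_Mapping.keys (qmap (h n) z) \<subseteq> X' (Suc n)"
    by (rule qmap_keys[OF h(1) kz])
  ultimately show ?thesis
    unfolding S.qboundaries_def by (metis (mono_tags, lifting) image_eqI mem_Collect_eq)
qed

lemma qmap_cycles:
  assumes f: "\<And>n x. x \<in> X n \<Longrightarrow> f n x \<in> res_chains' n (\<sigma> x)"
    and fbd: "\<And>n x. x \<in> X (Suc n) \<Longrightarrow>
      frag_extend bd' (f (Suc n) x) = lin_ext K (f n) (bd (x, ident K (\<sigma> x)))"
  shows "z \<in> R.qcycles n \<Longrightarrow> qmap (f n) z \<in> S.qcycles n"
    and "z \<in> R.qboundaries n \<Longrightarrow> qmap (f n) z \<in> S.qboundaries n"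
proof -
  assume z: "z \<in> R.qcycles n"
  then have k: "Poly_Mapping.keys (qmap (f n) z) \<subseteq> X' n"
    by (intro qmap_keys[OF f]) (auto simp: R.qcycles_def)
  moreover have "frag_extend S.qbd (qmap (f n) z) = 0"
  proof (cases n)
    case 0
    then show ?thesis using k qbd_zero_chain by simp
  next
    case (Suc m)
    then show ?thesis
      using qmap_chain_map[OF f fbd, of z m] z by (simp add: R.qcycles_def) (simp add: qmap_def)
  qed
  ultimately show "qmap (f n) z \<in> S.qcycles n"
    by (simp add: S.qcycles_def)
next
  assume "z \<in> R.qboundaries n"
  then obtain y where y: "Poly_Mapping.keys y \<subseteq> X (Suc n)" "z = frag_extend R.qbd y"
    by (auto simp: R.qboundaries_def)
  then show "qmap (f n) z \<in> S.qboundaries n"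
    using qmap_chain_map[OF f fbd y(1)] qmap_keys[of "Suc n" "f (Suc n)" "Suc n" y, OF f y(1)]
    unfolding S.qboundaries_def by (metis (mono_tags, lifting) image_eqI mem_Collect_eq)
qed

end

section \<open>Uniqueness of resolutions up to homotopy\<close>

locale resolution_triple =
  RS: resolution_pair K X \<sigma> bd X' \<sigma>' bd'
  for K :: "('o, 'k) cat" and X :: "nat \<Rightarrow> 'x set" and \<sigma> bd
    and X' :: "nat \<Rightarrow> 'y set" and \<sigma>' bd'
begin

abbreviation "res_chains \<equiv> RS.R.res_chains"
abbreviation "res_chains' \<equiv> RS.S.res_chains"

sublocale SR: resolution_pair K X' \<sigma>' bd' X \<sigma> bd
  by unfold_locales

sublocale RR: resolution_pair K X \<sigma> bd X \<sigma> bd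
  by unfold_locales

text \<open>The round trip minus the identity is a chain map \<open>g\<close> of the first
  resolution to itself that covers zero under the augmentation. It is null-homotopic, so after
  forgetting \<open>k\<close> it sends cycles to boundaries.\<close>

lemma comparison_inverse:
  assumes f: "\<And>n x. x \<in> X n \<Longrightarrow> f n x \<in> res_chains' n (\<sigma> x)"
    and f0: "\<And>x. x \<in> X 0 \<Longrightarrow> aug (f 0 x) = frag_of ()"
    and fbd: "\<And>n x. x \<in> X (Suc n) \<Longrightarrow>
      frag_extend bd' (f (Suc n) x) = lin_ext K (f n) (bd (x, ident K (\<sigma> x)))"
    and f': "\<And>n x. x \<in> X' n \<Longrightarrow> f' n x \<in> res_chains n (\<sigma>' x)"
    and f'0: "\<And>x. x \<in> X' 0 \<Longrightarrow> aug (f' 0 x) = frag_of ()"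
    and f'bd: "\<And>n x. x \<in> X' (Suc n) \<Longrightarrow>
      frag_extend bd (f' (Suc n) x) = lin_ext K (f' n) (bd' (x, ident K (\<sigma>' x)))"
    and z: "z \<in> RS.R.qcycles n"
  shows "SR.qmap (f' n) (RS.qmap (f n) z) - z \<in> RS.R.qboundaries n"
proof -
  define g where "g n x = lin_ext K (f' n) (f n x) - frag_of (x, ident K (\<sigma> x))" for n x
  have augf': "aug (lin_ext K (f' 0) z) = aug z" if "z \<in> res_chains' 0 w" for z w
    using that
  proof (induction rule: RS.S.chains_induct)
    case (gen x k)
    then show ?case by (simp add: lin_ext_def RS.R.aug_right_mult f'0)
  qed (auto simp: lin_ext_def frag_linear)
  have lin: "lin_ext K (f' n) (lin_ext K (f n) z) = lin_ext K (\<lambda>x. lin_ext K (f' n) (f n x)) z"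
    if "z \<in> res_chains n w" for n z w
    using that
  proof (induction rule: RS.R.chains_induct)
    case (gen x k)
    then show ?case using SR.lin_ext_right_mult[OF f' f[OF gen(1)] gen(2,3)]
      by (simp add: lin_ext_def)
  qed (auto simp: lin_ext_def frag_linear)
  have idl: "lin_ext K (\<lambda>x. frag_of (x, ident K (\<sigma> x))) z = z" if "z \<in> res_chains n w" for n z w
    using that
  proof (induction rule: RS.R.chains_induct)
    case (gen x k)
    then show ?case using RS.R.cmp_ident_left[of k] by (simp add: lin_ext_def right_mult_def)
  qed (auto simp: lin_ext_def frag_linear)
  have "RR.qmap (g n) z \<in> RS.R.qboundaries n"
  proof (rule RR.qmap_null[OF _ _ _ z])
    fix n x assume x: "x \<in> X n"
    show "g n x \<in> res_chains n (\<sigma> x)"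
      unfolding g_def
      by (intro RS.R.chains_diff SR.lin_ext_closed[OF f' f[OF x]] RS.R.gen_chains x)
  next
    fix x assume x: "x \<in> X 0"
    show "aug (g 0 x) = 0"
      using augf'[OF f[OF x]] f0[OF x] by (simp add: g_def frag_linear)
  next
    fix n x assume x: "x \<in> X (Suc n)"
    let ?e = "bd (x, ident K (\<sigma> x))"
    have e: "?e \<in> res_chains n (\<sigma> x)" by (rule RS.R.bd_gen_chains[OF x])
    have "frag_extend bd (lin_ext K (f' (Suc n)) (f (Suc n) x)) = lin_ext K (f' n) (lin_ext K (f n) ?e)"
      using SR.lin_ext_bd[OF f' f[OF x] f'bd] SR.lin_ext_bd_gen[OF f' f[OF x]] fbd[OF x] by simp
    then show "frag_extend bd (g (Suc n) x) = lin_ext K (g n) ?e"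
      using lin[OF e] idl[OF e] unfolding g_def RR.lin_ext_diff by (simp add: frag_linear)
  qed
  moreover have "RR.qmap (g n) z = SR.qmap (f' n) (RS.qmap (f n) z) - z"
    by (simp add: g_def RR.qmap_def RS.qmap_def frag_linear SR.qmap_fst frag_extend_diff_fun)
      (simp add: SR.qmap_def frag_extend_extend)
  ultimately show ?thesis by simp
qed

end

text \<open>The conclusion has the form consumed by \<open>presents_transfer\<close>: an additive
  map of chains instead of an isomorphism of quotient groups. Reflection of boundaries and
  surjectivity come from the comparison map in the opposite direction.\<close>

theorem (in resolution_triple) quasi_isomorphism:
  "\<exists>\<Phi>. (\<forall>n z z'. \<Phi> n (z + z') = \<Phi> n z + \<Phi> n z') \<and>
     (\<forall>n. \<forall>z\<in>RS.R.qcycles n. \<Phi> n z \<in> RS.S.qcycles n \<and> (\<Phi> n z \<in> RS.S.qboundaries n \<longleftrightarrow> z \<in> RS.R.qboundaries n)) \<and>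
     (\<forall>n. \<forall>y\<in>RS.S.qcycles n. \<exists>z\<in>RS.R.qcycles n. y - \<Phi> n z \<in> RS.S.qboundaries n)"
proof -
  interpret opp: resolution_triple K X' \<sigma>' bd' X \<sigma> bd
    by unfold_locales
  obtain f where f: "\<And>n x. x \<in> X n \<Longrightarrow> f n x \<in> res_chains' n (\<sigma> x)"
      "\<And>x. x \<in> X 0 \<Longrightarrow> aug (f 0 x) = frag_of ()"
      "\<And>n x. x \<in> X (Suc n) \<Longrightarrow> frag_extend bd' (f (Suc n) x) = lin_ext K (f n) (bd (x, ident K (\<sigma> x)))"
    using RS.comparison_map by blast
  obtain f' where f': "\<And>n x. x \<in> X' n \<Longrightarrow> f' n x \<in> res_chains n (\<sigma>' x)"
      "\<And>x. x \<in> X' 0 \<Longrightarrow> aug (f' 0 x) = frag_of ()"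
      "\<And>n x. x \<in> X' (Suc n) \<Longrightarrow> frag_extend bd (f' (Suc n) x) = lin_ext K (f' n) (bd' (x, ident K (\<sigma>' x)))"
    using SR.comparison_map by blast
  have neg: "- b \<in> RS.S.qboundaries n" if b: "b \<in> RS.S.qboundaries n" for b n
  proof -
    from b obtain y where "Poly_Mapping.keys y \<subseteq> X' (Suc n)" "b = frag_extend RS.S.qbd y"
      by (auto simp: RS.S.qboundaries_def)
    then show ?thesis
      unfolding RS.S.qboundaries_def by (intro image_eqI[of _ _ "- y"]) (auto simp: frag_linear)
  qed
  have diff: "a - b \<in> RS.R.qboundaries n" if ab: "a \<in> RS.R.qboundaries n" "b \<in> RS.R.qboundaries n" for a b n
  proof -
    from ab obtain x y where "Poly_Mapping.keys x \<subseteq> X (Suc n)" "a = frag_extend RS.R.qbd x"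
      "Poly_Mapping.keys y \<subseteq> X (Suc n)" "b = frag_extend RS.R.qbd y"
      by (auto simp: RS.R.qboundaries_def)
    then show ?thesis
      unfolding RS.R.qboundaries_def
      by (intro image_eqI[of _ _ "x - y"]) (auto simp: frag_linear dest!: set_mp[OF keys_diff])
  qed
  have inv: "SR.qmap (f' n) (RS.qmap (f n) z) - z \<in> RS.R.qboundaries n" if "z \<in> RS.R.qcycles n" for z n
    by (intro comparison_inverse[where f = f and f' = f'] f f' that)
  have inv': "RS.qmap (f n) (SR.qmap (f' n) z) - z \<in> RS.S.qboundaries n" if "z \<in> RS.S.qcycles n" for z n
    by (intro opp.comparison_inverse[where f = f' and f' = f] f f' that)
  show ?thesis
  proof (intro exI[of _ "\<lambda>n. RS.qmap (f n)"] conjI allI ballI)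
    fix n z z' show "RS.qmap (f n) (z + z') = RS.qmap (f n) z + RS.qmap (f n) z'"
      by (simp add: RS.qmap_def frag_linear)
  next
    fix n z assume z: "z \<in> RS.R.qcycles n"
    show "RS.qmap (f n) z \<in> RS.S.qcycles n"
      by (intro RS.qmap_cycles(1)[where f = f] f(1) f(3) z)
    show "RS.qmap (f n) z \<in> RS.S.qboundaries n \<longleftrightarrow> z \<in> RS.R.qboundaries n"
    proof
      assume "RS.qmap (f n) z \<in> RS.S.qboundaries n"
      then have "SR.qmap (f' n) (RS.qmap (f n) z) \<in> RS.R.qboundaries n"
        by (intro SR.qmap_cycles(2)[where f = f'] f'(1) f'(3))
      from diff[OF this inv[OF z]] show "z \<in> RS.R.qboundaries n" by simp
    qed (intro RS.qmap_cycles(2)[where f = f] f(1) f(3))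
  next
    fix n y assume y: "y \<in> RS.S.qcycles n"
    show "\<exists>z\<in>RS.R.qcycles n. y - RS.qmap (f n) z \<in> RS.S.qboundaries n"
    proof
      show "SR.qmap (f' n) y \<in> RS.R.qcycles n"
        by (intro SR.qmap_cycles(1)[where f = f'] f'(1) f'(3) y)
      show "y - RS.qmap (f n) (SR.qmap (f' n) y) \<in> RS.S.qboundaries n"
        using neg[OF inv'[OF y]] by simp
    qed
  qed
qed

text \<open>The contraction \<open>S\<close> need not respect the action of \<open>K\<close>.\<close>

lemma free_resolutionI:
  assumes K: "small_category K"
    and \<sigma>_Obj: "\<And>x n. x \<in> X n \<Longrightarrow> \<sigma> x \<in> Obj K"
    and bd_zero: "\<And>x k. x \<in> X 0 \<Longrightarrow> bd (x, k) = 0"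
    and bd_closed: "\<And>x k n. \<lbrakk>x \<in> X (Suc n); k \<in> Arr K; rng K k = \<sigma> x\<rbrakk> \<Longrightarrow>
      bd (x, k) \<in> free_chains K X \<sigma> n (src K k)"
    and bd_bd: "\<And>x k n. \<lbrakk>x \<in> X n; k \<in> Arr K; rng K k = \<sigma> x\<rbrakk> \<Longrightarrow> frag_extend bd (bd (x, k)) = 0"
    and bd_aug: "\<And>x k. \<lbrakk>x \<in> X (Suc 0); k \<in> Arr K; rng K k = \<sigma> x\<rbrakk> \<Longrightarrow> aug (bd (x, k)) = 0"
    and bd_right_mult: "\<And>x k h n. \<lbrakk>x \<in> X n; k \<in> Arr K; rng K k = \<sigma> x; h \<in> Arr K; src K k = rng K h\<rbrakk>
      \<Longrightarrow> bd (x, cmp K k h) = right_mult K h (bd (x, k))"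
    and pt: "\<And>w. w \<in> Obj K \<Longrightarrow> frag_of (pt w) \<in> free_chains K X \<sigma> 0 w"
    and S_closed: "\<And>x k n. \<lbrakk>x \<in> X n; k \<in> Arr K; rng K k = \<sigma> x\<rbrakk> \<Longrightarrow>
      S (x, k) \<in> free_chains K X \<sigma> (Suc n) (src K k)"
    and S0: "\<And>x k. \<lbrakk>x \<in> X 0; k \<in> Arr K; rng K k = \<sigma> x\<rbrakk> \<Longrightarrow>
      frag_extend bd (S (x, k)) = frag_of (x, k) - frag_of (pt (src K k))"
    and S_Suc: "\<And>x k n. \<lbrakk>x \<in> X (Suc n); k \<in> Arr K; rng K k = \<sigma> x\<rbrakk> \<Longrightarrow>
      frag_extend bd (S (x, k)) + frag_extend S (bd (x, k)) = frag_of (x, k)"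
  shows "free_resolution K X \<sigma> bd"
proof -
  have ind: "P z" if "z \<in> free_chains K X \<sigma> n w" "P 0"
    "\<And>x k. \<lbrakk>x \<in> X n; k \<in> Arr K; rng K k = \<sigma> x; src K k = w\<rbrakk> \<Longrightarrow> P (frag_of (x, k))"
    "\<And>a b. P a \<Longrightarrow> P b \<Longrightarrow> P (a - b)" for P n w z
    using that(1) unfolding free_chains_def mem_Collect_eq
    by (rule frag_induction) (use that in auto)
  have S: "frag_extend S z \<in> free_chains K X \<sigma> (Suc n) w" if "z \<in> free_chains K X \<sigma> n w" for z n w
    using that
  proof (rule ind)
    show "frag_extend S 0 \<in> free_chains K X \<sigma> (Suc n) w"
      by (simp add: free_chains_def)
    show "frag_extend S (a - b) \<in> free_chains K X \<sigma> (Suc n) w"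
      if "frag_extend S a \<in> free_chains K X \<sigma> (Suc n) w" "frag_extend S b \<in> free_chains K X \<sigma> (Suc n) w" for a b
      using that by (simp add: free_chains_def frag_linear keys_diff_subset)
  qed (use S_closed in auto)
  show ?thesis
  proof (intro free_resolution.intro K free_resolution_axioms.intro)
    fix z n w assume z: "z \<in> free_chains K X \<sigma> (Suc n) w" and dz: "frag_extend bd z = 0"
    have "frag_extend bd (frag_extend S z) + frag_extend S (frag_extend bd z) = z"
      using z
    proof (rule ind)
      fix a b
      assume "frag_extend bd (frag_extend S a) + frag_extend S (frag_extend bd a) = a"
        "frag_extend bd (frag_extend S b) + frag_extend S (frag_extend bd b) = b"
      from arg_cong2[OF this, of "(-)"]
      show "frag_extend bd (frag_extend S (a - b)) + frag_extend S (frag_extend bd (a - b)) = a - b"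
        by (simp add: frag_linear algebra_simps)
    qed (auto simp: S_Suc)
    with S[OF z] show "\<exists>y\<in>free_chains K X \<sigma> (Suc (Suc n)) w. frag_extend bd y = z"
      by (auto simp: dz)
  next
    fix z w assume z: "z \<in> free_chains K X \<sigma> 0 w" and dz: "aug z = 0"
    \<comment> \<open>In degree 0 the homotopy ends at the base point, counted with the sum of the
      coefficients of \<open>z\<close>; this term disappears when the augmentation of
      \<open>z\<close> is 0.\<close>
    have "frag_extend bd (frag_extend S z) = z - frag_map (\<lambda>_. pt w) (aug z)"
      using z by (rule ind) (auto simp: S0 frag_linear)
    with S[OF z] show "\<exists>y\<in>free_chains K X \<sigma> (Suc 0) w. frag_extend bd y = z"
      by (auto simp: dz)
  next
    fix w assume "w \<in> Obj K"
    then show "\<exists>z\<in>free_chains K X \<sigma> 0 w. aug z = frag_of ()"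
      by (intro bexI[OF _ pt]) auto
  qed (use \<sigma>_Obj bd_zero bd_closed bd_bd bd_aug bd_right_mult in blast)+
qed

section \<open>The bar resolution\<close>

definition tuple_end :: "('o, 'm) cat \<Rightarrow> 'o \<Rightarrow> 'm list \<Rightarrow> 'o" where
  "tuple_end K v ms = (if ms = [] then v else src K (last ms))"

lemma composable_end: "composable K v ms w \<Longrightarrow> w = tuple_end K v ms"
  by (induction K v ms w rule: composable.induct) (auto simp: tuple_end_def)

context small_category
begin

lemma composable_append:
  assumes "v \<in> Obj K"
  shows "composable K v (ms @ ms') w \<longleftrightarrow> (\<exists>u. composable K v ms u \<and> composable K u ms' w)"
  using assms
proof (induction ms arbitrary: v)
  case (Cons m ms)
  then show ?case using src_Obj[of m] by auto
qed simp

definition cat_tuples :: "nat \<Rightarrow> ('o \<times> 'm list) set" where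
  "cat_tuples n = {(v, ms). length ms = n \<and> (\<exists>w. composable K v ms w)}"

definition bar_res :: "('o \<times> 'm list) \<times> 'm \<Rightarrow> (('o \<times> 'm list) \<times> 'm \<Rightarrow>\<^sub>0 int)" where
  "bar_res = (\<lambda>((v, ms), k). frag_map (\<lambda>(v, ms, k). ((v, ms), k)) (bar K (\<lambda>_. src K) (cmp K) (v, ms, k)))"

text \<open>The right set is the terminal one. Its only element over \<open>v\<close> is written as
  \<open>v\<close> itself, so that the first component stays the codomain of the tuple, as in
  \<open>cat_chains\<close>.\<close>

lemma bar_two_sided:
  "two_sided K {k \<in> Arr K. src K k = w} (rng K) (cmp K) {(v, v) |v. v \<in> Obj K} (\<lambda>_. src K)"
  by unfold_locales (auto simp: cmp_Arr rng_cmp src_cmp cmp_assoc src_Obj)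

lemma bar_res_tuples:
  "(v, ms) \<in> cat_tuples n \<and> k \<in> Arr K \<and> rng K k = tuple_end K v ms \<and> src K k = w \<longleftrightarrow>
    (v, ms, k) \<in> two_sided.bar_tuples K {k \<in> Arr K. src K k = w} (rng K) {(v, v) |v. v \<in> Obj K} \<and> length ms = n"
proof -
  interpret B: two_sided K "{k \<in> Arr K. src K k = w}" "rng K" "cmp K" "{(v, v) |v. v \<in> Obj K}" "\<lambda>_. src K"
    by (rule bar_two_sided)
  show ?thesis
    using composable_end[of K v ms] composable_Obj[of v ms]
    by (auto simp: cat_tuples_def B.bar_tuples_def)
qed

theorem bar_resolution: "free_resolution K cat_tuples (\<lambda>(v, ms). tuple_end K v ms) bar_res"
proof -
  let ?B = "\<lambda>w. two_sided.bar_tuples K {k \<in> Arr K. src K k = w} (rng K) {(v, v) |v. v \<in> Obj K}"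
  let ?re = "\<lambda>(v, ms, k). ((v, ms), k)"
  let ?bar = "bar K (\<lambda>_. src K) (cmp K)" and ?\<sigma> = "\<lambda>(v, ms). tuple_end K v ms"
  \<comment> \<open>Every \<open>k\<close> is \<open>k\<close> acting on an identity, naturally
    under left multiplication; the resulting homotopy appends \<open>k\<close> to the tuple.\<close>
  let ?s = "bar_split (\<lambda>k. k) (\<lambda>k. ident K (src K k))"
  define S where "S = (\<lambda>((v :: 'o, ms :: 'm list), k :: 'm). frag_map (\<lambda>(ms, k). ((v, ms), k)) (?s (ms, k)))"
  have reext: "frag_extend bar_res (frag_map ?re z) = frag_map ?re (frag_extend ?bar z)" for z
    unfolding frag_extend_map frag_map_extend
    by (rule frag_extend_eq) (auto simp: bar_res_def)
  \<comment> \<open>For \<open>n = 0\<close> the degree \<open>n - 1\<close> is truncated to 0,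
    which does no harm because the boundary is zero there. The last clause contains both forms of
    the homotopy formula.\<close>
  have gen: "bar_res ((v, ms), k) \<in> free_chains K cat_tuples ?\<sigma> (n - 1) (src K k) \<and>
      frag_extend bar_res (bar_res ((v, ms), k)) = 0 \<and>
      (\<forall>h\<in>Arr K. src K k = rng K h \<longrightarrow>
         bar_res ((v, ms), cmp K k h) = right_mult K h (bar_res ((v, ms), k))) \<and>
      S ((v, ms), k) \<in> free_chains K cat_tuples ?\<sigma> (Suc n) (src K k) \<and>
      frag_extend bar_res (S ((v, ms), k)) + frag_extend S (bar_res ((v, ms), k)) =
        frag_of ((v, ms), k) - (if n = 0 then frag_of ((src K k, []), ident K (src K k)) else 0)"
    if x: "(v, ms) \<in> cat_tuples n" "k \<in> Arr K" "rng K k = tuple_end K v ms" for v ms k n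
  proof -
    define w where "w = src K k"
    interpret B: two_sided K "{k \<in> Arr K. src K k = w}" "rng K" "cmp K" "{(v, v) |v. v \<in> Obj K}" "\<lambda>_. src K"
      by (rule bar_two_sided)
    have tup: "(v, ms, k) \<in> ?B w" "length ms = n"
      using bar_res_tuples[of v ms n k w] x by (auto simp: w_def)
    then have comp: "composable K v ms (rng K k)" and k: "k \<in> {k \<in> Arr K. src K k = w}"
      by (auto simp: B.bar_tuples_def)
    have "bar_res ((v, ms), k) \<in> free_chains K cat_tuples ?\<sigma> (n - 1) (src K k)"
      unfolding free_chains_def
    proof safe
      fix v' ms' k' assume "((v', ms'), k') \<in> Poly_Mapping.keys (bar_res ((v, ms), k))"
      then have "(v', ms', k') \<in> Poly_Mapping.keys (?bar (v, ms, k))"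
        by (auto simp: bar_res_def dest!: keys_frag_mapD)
      from B.bar_keys[OF tup(1) this] tup(2)
      have "(v', ms') \<in> cat_tuples (n - 1) \<and> k' \<in> Arr K \<and> rng K k' = tuple_end K v' ms' \<and> src K k' = w"
        unfolding bar_res_tuples by auto
      then show "(v', ms') \<in> cat_tuples (n - 1)" "k' \<in> Arr K" "rng K k' = tuple_end K v' ms'" "src K k' = src K k"
        by (auto simp: w_def)
    qed
    moreover have "frag_extend bar_res (bar_res ((v, ms), k)) = 0"
      using B.bar_bar[OF tup(1)] reext[of "?bar (v, ms, k)"] by (simp add: bar_res_def)
    moreover have "bar_res ((v, ms), cmp K k h) = right_mult K h (bar_res ((v, ms), k))"
      if "h \<in> Arr K" "src K k = rng K h" for h
    proof -
      have "?bar (v, ms, cmp K k h) = frag_map (\<lambda>(a, ms, y). (a, ms, cmp K y h)) (?bar (v, ms, k))"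
        by (rule bar_natural_map[OF B.left_action_axioms comp k, symmetric])
          (use that in \<open>auto simp: cmp_assoc w_def\<close>)
      then show ?thesis
        by (simp add: bar_res_def right_mult_def frag_map_map case_prod_unfold)
    qed
    moreover have "S ((v, ms), k) \<in> free_chains K cat_tuples ?\<sigma> (Suc n) (src K k)"
    proof -
      have "(v, ms @ [k], ident K w) \<in> ?B w \<and> length (ms @ [k]) = Suc n"
        using comp x(2) composable_Obj[OF comp] tup(2)
        by (simp add: B.bar_tuples_def composable_append src_Obj[of k] ident_Arr rng_ident src_ident flip: w_def)
          (use src_Obj[OF x(2)] in \<open>auto simp: w_def ident_Arr rng_ident src_ident\<close>)
      from this[folded bar_res_tuples] show ?thesis
        by (auto simp: free_chains_def S_def bar_split_def frag_linear w_def)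
    qed
    moreover have "frag_extend bar_res (S ((v, ms), k)) + frag_extend S (bar_res ((v, ms), k)) =
        frag_of ((v, ms), k) - (if n = 0 then frag_of ((src K k, []), ident K (src K k)) else 0)"
    proof -
      have 1: "frag_extend ?bar (frag_map (Pair v) (?s (ms, k))) +
          frag_extend (\<lambda>(v, x). frag_map (Pair v) (?s x)) (?bar (v, ms, k)) =
          frag_of (v, ms, k) - (if ms = [] then frag_of (src K k, [], ident K (src K k)) else 0)"
        by (rule B.bar_split_homotopy[OF _ _ _ comp k])
          (auto simp: cmp_ident_right src_cmp)
      have 2: "S ((v, ms), k) = frag_map ?re (frag_map (Pair v) (?s (ms, k)))"
        by (simp add: S_def frag_map_map case_prod_unfold)
      have 3: "frag_extend S (bar_res ((v, ms), k)) =
          frag_map ?re (frag_extend (\<lambda>(v, x). frag_map (Pair v) (?s x)) (?bar (v, ms, k)))"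
        by (simp add: bar_res_def S_def frag_extend_map frag_map_extend frag_map_map case_prod_unfold)
      show ?thesis
        unfolding 3 unfolding 2 reext frag_map_add[symmetric] 1
        using tup(2) by (auto simp: frag_linear)
    qed
    ultimately show ?thesis by blast
  qed
  show ?thesis
  proof (rule free_resolutionI[where pt = "\<lambda>w. ((w, []), ident K w)" and S = S])
    show "small_category K" by unfold_locales
    show "(case x of (v, ms) \<Rightarrow> tuple_end K v ms) \<in> Obj K" if "x \<in> cat_tuples n" for x n
    proof -
      from that obtain v ms w where x: "x = (v, ms)" "composable K v ms w"
        by (auto simp: cat_tuples_def)
      interpret B: two_sided K "{k \<in> Arr K. src K k = w}" "rng K" "cmp K" "{(v, v) |v. v \<in> Obj K}" "\<lambda>_. src K"
        by (rule bar_two_sided)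
      from composable_end[OF x(2)] composable_Obj[OF x(2)] x(1) show ?thesis by auto
    qed
    show "bar_res (x, k) = 0" if "x \<in> cat_tuples 0" for x k
      using that by (auto simp: cat_tuples_def bar_res_def)
    show "aug (bar_res (x, k)) = 0" if "x \<in> cat_tuples (Suc 0)" for x k
      using that by (auto simp: cat_tuples_def bar_res_def bar_Cons frag_linear length_Suc_conv)
    show "frag_of ((w, []), ident K w) \<in> free_chains K cat_tuples ?\<sigma> 0 w" if "w \<in> Obj K" for w
      using that by (auto simp: free_chains_def cat_tuples_def tuple_end_def ident_Arr rng_ident src_ident)
  next
    fix x k n assume x: "x \<in> cat_tuples (Suc n)" "k \<in> Arr K" "rng K k = ?\<sigma> x"
    obtain v ms where vms: "x = (v, ms)" by fastforce
    show "bar_res (x, k) \<in> free_chains K cat_tuples ?\<sigma> n (src K k)"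
      "frag_extend bar_res (S (x, k)) + frag_extend S (bar_res (x, k)) = frag_of (x, k)"
      using gen[of v ms "Suc n" k] x by (auto simp: vms)
  next
    fix x k n assume x: "x \<in> cat_tuples n" "k \<in> Arr K" "rng K k = ?\<sigma> x"
    obtain v ms where vms: "x = (v, ms)" by fastforce
    show "frag_extend bar_res (bar_res (x, k)) = 0" "S (x, k) \<in> free_chains K cat_tuples ?\<sigma> (Suc n) (src K k)"
      using gen[of v ms n k] x by (auto simp: vms)
    show "bar_res (x, cmp K k h) = right_mult K h (bar_res (x, k))" if "h \<in> Arr K" "src K k = rng K h" for h
      using gen[of v ms n k] x that by (auto simp: vms)
  next
    fix x k assume x: "x \<in> cat_tuples 0" "k \<in> Arr K" "rng K k = ?\<sigma> x"
    obtain v ms where vms: "x = (v, ms)" by fastforce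
    then have "bar_res (x, k) = 0" using x by (auto simp: cat_tuples_def bar_res_def)
    then show "frag_extend bar_res (S (x, k)) = frag_of (x, k) - frag_of ((src K k, []), ident K (src K k))"
      using gen[of v ms 0 k] x by (auto simp: vms)
  qed
qed

end

section \<open>The actions on tuples\<close>

context matched_pair
begin

sublocale C: small_category C by (rule small_C)
sublocale D: small_category D by (rule small_D)

lemma Obj_simps:
  "c \<in> Arr C \<Longrightarrow> rng C c \<in> Obj D" "c \<in> Arr C \<Longrightarrow> src C c \<in> Obj D"
  "d \<in> Arr D \<Longrightarrow> rng D d \<in> Obj D" "d \<in> Arr D \<Longrightarrow> src D d \<in> Obj D"
  "v \<in> Obj D \<Longrightarrow> ident C v \<in> Arr C" "v \<in> Obj D \<Longrightarrow> rng C (ident C v) = v" "v \<in> Obj D \<Longrightarrow> src C (ident C v) = v"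
  "v \<in> Obj D \<Longrightarrow> ident D v \<in> Arr D" "v \<in> Obj D \<Longrightarrow> rng D (ident D v) = v" "v \<in> Obj D \<Longrightarrow> src D (ident D v) = v"
  using same_Obj by (auto intro: C.rng_Obj C.src_Obj D.rng_Obj D.src_Obj C.ident_Arr D.ident_Arr
      C.rng_ident C.src_ident D.rng_ident D.src_ident)

lemma zs_simps [simp]:
  "Obj (zs_product M) = Obj C"
  "(d, c) \<in> Arr (zs_product M) \<longleftrightarrow> d \<in> Arr D \<and> c \<in> Arr C \<and> src D d = rng C c"
  "rng (zs_product M) (d, c) = rng D d"
  "src (zs_product M) (d, c) = src C c"
  "ident (zs_product M) v = (ident D v, ident C v)"
  "cmp (zs_product M) (d, c) (d', c') = (cmp D d (c \<triangleright> d'), cmp C (c \<triangleleft> d') c')"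
  by (simp_all add: zs_product_def C_def D_def l_def r_def)

lemma small_zs: "small_category (zs_product M)"
proof
  fix a b c
  assume "a \<in> Arr (zs_product M)" "b \<in> Arr (zs_product M)" "c \<in> Arr (zs_product M)"
    "src (zs_product M) a = rng (zs_product M) b" "src (zs_product M) b = rng (zs_product M) c"
  then show "cmp (zs_product M) (cmp (zs_product M) a b) c = cmp (zs_product M) a (cmp (zs_product M) b c)"
    by (cases a; cases b; cases c)
      (simp add: lact_Arr ract_Arr rng_lact src_lact_rng_ract src_ract D.cmp_assoc C.cmp_assoc
        cmp_lact cmp_ract lact_cmp ract_cmp D.cmp_Arr C.cmp_Arr D.rng_cmp D.src_cmp C.rng_cmp C.src_cmp)
next
  fix a assume a: "a \<in> Arr (zs_product M)"
  obtain d c where dc: "a = (d, c)" by fastforce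
  with a have "ident C (rng D d) \<triangleright> d = d" "ident C (rng D d) \<triangleleft> d = ident C (src D d)"
    "c \<triangleright> ident D (src C c) = ident D (rng C c)" "c \<triangleleft> ident D (src C c) = c"
    using ident_ract[of d] by (auto intro: ident_lact lact_ident ract_ident)
  with a dc show "cmp (zs_product M) (ident (zs_product M) (rng (zs_product M) a)) a = a"
    "cmp (zs_product M) a (ident (zs_product M) (src (zs_product M) a)) = a"
    using D.cmp_ident_right[of d] C.cmp_ident_left[of c]
    by (auto simp: D.cmp_ident_left C.cmp_ident_right)
qed (auto simp: Obj_simps same_Obj lact_Arr ract_Arr rng_lact src_lact_rng_ract src_ract
    D.cmp_Arr C.cmp_Arr D.rng_cmp D.src_cmp C.rng_cmp C.src_cmp)

sublocale K: small_category "zs_product M" by (rule small_zs)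

text \<open>Recursive forms of the tuple actions, suited to induction. On composable tuples
  \<open>lact_tuple_eq\<close> and \<open>ract_tuple_eq\<close> identify them with the definitions
  through composites of segments.\<close>

fun ltup :: "'c \<Rightarrow> 'd list \<Rightarrow> 'd list" where
  "ltup c [] = []"
| "ltup c (d # ds) = (c \<triangleright> d) # ltup (c \<triangleleft> d) ds"

fun rtup :: "'c list \<Rightarrow> 'd \<Rightarrow> 'c list" where
  "rtup [] d = []"
| "rtup (c # cs) d = (c \<triangleleft> foldr (\<triangleright>) cs d) # rtup cs d"

text \<open>What \<open>c\<close> has turned into after moving past all of \<open>ds\<close>, which
  meanwhile has become \<open>ltup c ds\<close>.\<close>

abbreviation rfold :: "'c \<Rightarrow> 'd list \<Rightarrow> 'c" where
  "rfold \<equiv> foldl (\<triangleleft>)"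

lemma length_ltup [simp]: "length (ltup c ds) = length ds"
  by (induction c ds rule: ltup.induct) auto

lemma length_rtup [simp]: "length (rtup cs d) = length cs"
  by (induction cs) auto

lemma rfold_closed:
  assumes "composable D v ds u" "c \<in> Arr C" "src C c = v"
  shows "rfold c ds \<in> Arr C \<and> src C (rfold c ds) = u \<and>
    composable D (rng C c) (ltup c ds) (rng C (rfold c ds))"
  using assms
proof (induction ds arbitrary: c v)
  case Nil
  then show ?case using C.rng_Obj same_Obj by auto
next
  case (Cons d ds)
  then show ?case
    using Cons.IH[of "src D d" "c \<triangleleft> d"]
    by (auto simp: ract_Arr src_ract lact_Arr rng_lact src_lact_rng_ract)
qed

lemma ltup_cmp:
  assumes "composable D v ds u" "c \<in> Arr C" "c' \<in> Arr C" "src C c = rng C c'" "src C c' = v"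
  shows "ltup (cmp C c c') ds = ltup c (ltup c' ds) \<and>
    rfold (cmp C c c') ds = cmp C (rfold c (ltup c' ds)) (rfold c' ds)"
  using assms
proof (induction ds arbitrary: c c' v)
  case (Cons d ds)
  have "composable D (src D d) ds u" "c \<triangleleft> (c' \<triangleright> d) \<in> Arr C" "c' \<triangleleft> d \<in> Arr C"
    "src C (c \<triangleleft> (c' \<triangleright> d)) = rng C (c' \<triangleleft> d)" "src C (c' \<triangleleft> d) = src D d"
    using Cons.prems by (auto simp: ract_Arr lact_Arr rng_lact src_ract src_lact_rng_ract)
  from Cons.IH[OF this] Cons.prems show ?case
    by (auto simp: cmp_lact cmp_ract)
qed simp

lemma ltup_append: "ltup c (ds @ ds') = ltup c ds @ ltup (rfold c ds) ds'"
  by (induction c ds rule: ltup.induct) auto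

lemma rtup_closed:
  assumes "composable C u cs v" "d \<in> Arr D" "rng D d = v"
  shows "foldr (\<triangleright>) cs d \<in> Arr D \<and> rng D (foldr (\<triangleright>) cs d) = u \<and>
    composable C (src D (foldr (\<triangleright>) cs d)) (rtup cs d) (src D d)"
  using assms
proof (induction cs arbitrary: u)
  case Nil
  then show ?case using D.src_Obj same_Obj by auto
next
  case (Cons c cs)
  then show ?case
    using Cons.IH[of "src C c"]
    by (auto simp: ract_Arr src_ract lact_Arr rng_lact src_lact_rng_ract)
qed

lemma rtup_cmp:
  assumes "composable C u cs v" "d \<in> Arr D" "rng D d = v" "d' \<in> Arr D" "src D d = rng D d'"
  shows "rtup cs (cmp D d d') = rtup (rtup cs d) d' \<and>
    foldr (\<triangleright>) cs (cmp D d d') = cmp D (foldr (\<triangleright>) cs d) (foldr (\<triangleright>) (rtup cs d) d')"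
  using assms
proof (induction cs arbitrary: u)
  case (Cons c cs)
  from Cons.prems have cs: "composable C (src C c) cs v" by simp
  have "rng D (foldr (\<triangleright>) (rtup cs d) d') = src D (foldr (\<triangleright>) cs d)"
    "foldr (\<triangleright>) (rtup cs d) d' \<in> Arr D"
    using rtup_closed[OF conjunct2[OF conjunct2[OF rtup_closed[OF cs Cons.prems(2,3)]]] Cons.prems(4)]
      Cons.prems(5) by auto
  then show ?case
    using Cons.IH[OF cs] Cons.prems rtup_closed[OF cs Cons.prems(2,3)]
    by (auto simp: ract_cmp lact_cmp)
qed simp

lemma composite_closed:
  assumes "composable D v ds u"
  shows "composite D v ds \<in> Arr D \<and> rng D (composite D v ds) = v \<and> src D (composite D v ds) = u"
  using assms
  by (induction ds arbitrary: v)
    (auto simp: D.ident_Arr D.rng_ident D.src_ident D.cmp_Arr D.rng_cmp D.src_cmp)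

lemma composite_closed_C:
  assumes "composable C v cs u"
  shows "composite C v cs \<in> Arr C \<and> rng C (composite C v cs) = v \<and> src C (composite C v cs) = u"
  using assms
  by (induction cs arbitrary: v)
    (auto simp: C.ident_Arr C.rng_ident C.src_ident C.cmp_Arr C.rng_cmp C.src_cmp)

lemma composable_take: "composable D v ds u \<Longrightarrow> \<exists>w. composable D v (take k ds) w"
  by (metis D.composable_append append_take_drop_id composable.simps(1) D.rng_Obj composable.elims(2))

lemma lact_tuple_eq:
  assumes "composable D v ds u" "c \<in> Arr C" "src C c = v"
  shows "lact_tuple M c ds = ltup c ds"
  using assms
proof (induction ds arbitrary: c v)
  case Nil
  then show ?case by (simp add: lact_tuple_def)
next
  case (Cons d ds)
  have c: "c \<triangleleft> d \<in> Arr C" "src C (c \<triangleleft> d) = src D d" "c \<triangleleft> ident D (src C c) = c"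
    using Cons.prems by (auto simp: ract_Arr src_ract ract_ident)
  \<comment> \<open>\<open>lact_tuple\<close> moves \<open>c\<close> past a composite of an initial
    segment; splitting off its first factor \<open>d\<close> leaves the same formula for
    \<open>c \<triangleleft> d\<close> and the remaining entries.\<close>
  have "c \<triangleleft> cmp D d (composite D (src D d) (take k ds)) = c \<triangleleft> d \<triangleleft> composite D (src D d) (take k ds)" for k
    using Cons.prems composable_take[of "src D d" ds u k] composite_closed
    by (intro ract_cmp) auto
  then have "lact_tuple M c (d # ds) = (c \<triangleright> d) # lact_tuple M (c \<triangleleft> d) ds"
    unfolding lact_tuple_def
    using c by (auto simp: C_def[symmetric] D_def[symmetric] l_def[symmetric] r_def[symmetric]
        upt_conv_Cons map_Suc_upt[symmetric] simp del: upt_Suc)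
  then show ?case
    using Cons.IH[of "src D d" "c \<triangleleft> d"] Cons.prems c by simp
qed

lemma composite_lact:
  assumes "composable C u cs v" "d \<in> Arr D" "rng D d = v"
  shows "composite C u cs \<triangleright> d = foldr (\<triangleright>) cs d"
  using assms
proof (induction cs arbitrary: u)
  case Nil
  then show ?case using ident_lact[of d] by auto
next
  case (Cons c cs)
  then show ?case using composite_closed_C[of "src C c" cs v] cmp_lact by auto
qed

lemma ract_tuple_eq:
  assumes "composable C u cs v" "d \<in> Arr D" "rng D d = v"
  shows "ract_tuple M cs d = rtup cs d"
  using assms
proof (induction cs arbitrary: u)
  case Nil
  then show ?case by (simp add: ract_tuple_def)
next
  case (Cons c cs)
  have "ract_tuple M (c # cs) d = (c \<triangleleft> (composite C (src C c) cs \<triangleright> d)) # ract_tuple M cs d"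
    unfolding ract_tuple_def
    by (auto simp: C_def[symmetric] D_def[symmetric] l_def[symmetric] r_def[symmetric]
        upt_conv_Cons map_Suc_upt[symmetric] simp del: upt_Suc)
  then show ?case
    using Cons.IH[of "src C c"] Cons.prems composite_lact[of "src C c" cs v d] by simp
qed

section \<open>Rows and columns of the resolution of the matched complex\<close>

text \<open>
  The resolution is free on the matched tuples: \<open>((cs, v, ds), k)\<close> is the tuple \<open>(cs, v, ds)\<close>
  multiplied by a morphism \<open>k\<close> of the Zappa--Szep product. A morphism of the left category acts on
  \<open>(ds, k)\<close> by moving past all of \<open>ds\<close> before it is absorbed by \<open>k\<close>, and the last face of a column
  absorbs the last entry of \<open>ds\<close> into \<open>k\<close>.
\<close>

fun lk :: "'c \<Rightarrow> 'd \<times> 'c \<Rightarrow> 'd \<times> 'c" where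
  "lk c (d, e) = (c \<triangleright> d, cmp C (c \<triangleleft> d) e)"

fun dk :: "'d \<Rightarrow> 'd \<times> 'c \<Rightarrow> 'd \<times> 'c" where
  "dk d (d', e) = (cmp D d d', e)"

definition actC :: "'c \<Rightarrow> 'o \<times> 'd list \<times> 'd \<times> 'c \<Rightarrow> 'o \<times> 'd list \<times> 'd \<times> 'c" where
  "actC c = (\<lambda>(v, ds, k). (rng C c, ltup c ds, lk (rfold c ds) k))"

text \<open>The parameter \<open>w\<close> is the object at which the resolution is evaluated. It is
  the domain of \<open>k\<close>, which no face changes.\<close>

definition YC :: "'o \<Rightarrow> ('o \<times> 'd list \<times> 'd \<times> 'c) set" where
  "YC w = {(v, ds, k). k \<in> Arr (zs_product M) \<and> src (zs_product M) k = w \<and>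
     composable D v ds (rng (zs_product M) k)}"

definition YD :: "'o \<Rightarrow> ('d \<times> 'c) set" where
  "YD w = {k \<in> Arr (zs_product M). src (zs_product M) k = w}"

text \<open>In a column the left tuple is a mere element of a right set for the other category. It
  is stored with its domain \<open>v\<close>, which an empty \<open>cs\<close> would not determine;
  the second \<open>v\<close> is the object over which it lies.\<close>

definition AD :: "(('c list \<times> 'o) \<times> 'o) set" where
  "AD = {((cs, v), v) |cs v. \<exists>u. composable C u cs v}"

definition ractD :: "'c list \<times> 'o \<Rightarrow> 'd \<Rightarrow> 'c list \<times> 'o" where
  "ractD = (\<lambda>(cs, v) d. (rtup cs d, src D d))"

lemma lk_closed:
  assumes "c \<in> Arr C" "k \<in> Arr (zs_product M)" "src C c = rng (zs_product M) k"
  shows "lk c k \<in> Arr (zs_product M) \<and> rng (zs_product M) (lk c k) = rng C c \<and>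
    src (zs_product M) (lk c k) = src (zs_product M) k"
  using assms by (cases k) (auto simp: lact_Arr ract_Arr C.cmp_Arr rng_lact src_ract
      src_lact_rng_ract C.rng_cmp C.src_cmp)

lemma lk_cmp:
  assumes "c \<in> Arr C" "c' \<in> Arr C" "k \<in> Arr (zs_product M)" "src C c = rng C c'"
    "src C c' = rng (zs_product M) k"
  shows "lk (cmp C c c') k = lk c (lk c' k)"
  using assms by (cases k) (auto simp: cmp_lact cmp_ract lact_Arr ract_Arr rng_lact src_ract
      src_lact_rng_ract intro!: C.cmp_assoc)

lemma lk_dk:
  assumes "c \<in> Arr C" "d \<in> Arr D" "k \<in> Arr (zs_product M)" "src C c = rng D d"
    "src D d = rng (zs_product M) k"
  shows "lk c (dk d k) = dk (c \<triangleright> d) (lk (c \<triangleleft> d) k)"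
  using assms by (cases k) (auto simp: lact_cmp ract_cmp)

lemma left_action_C: "left_action C (YC w) fst actC"
proof
  fix c y assume "c \<in> Arr C" "y \<in> YC w" "src C c = fst y"
  then show "actC c y \<in> YC w" "fst (actC c y) = rng C c"
    using rfold_closed[of "fst y" "fst (snd y)" "rng (zs_product M) (snd (snd y))" c]
      lk_closed[of "rfold c (fst (snd y))" "snd (snd y)"]
    by (auto simp: actC_def YC_def)
next
  fix c c' y
  assume "c \<in> Arr C" "c' \<in> Arr C" "y \<in> YC w" "src C c = rng C c'" "src C c' = fst y"
  then show "actC (cmp C c c') y = actC c (actC c' y)"
    using ltup_cmp[of "fst y" "fst (snd y)" "rng (zs_product M) (snd (snd y))" c c']
      rfold_closed[of "fst y" "fst (snd y)" "rng (zs_product M) (snd (snd y))" c']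
      rfold_closed[of "rng C c'" "ltup c' (fst (snd y))" "rng C (rfold c' (fst (snd y)))" c]
      lk_cmp[of "rfold c (ltup c' (fst (snd y)))" "rfold c' (fst (snd y))" "snd (snd y)"]
    by (auto simp: actC_def YC_def C.rng_cmp)
qed

lemma rows: "two_sided C (YC w) fst actC UNIV (\<lambda>_ _. ())"
  by (intro two_sided.intro left_action_C two_sided_axioms.intro) auto

lemma columns: "two_sided D (YD w) (rng (zs_product M)) dk AD ractD"
proof
  fix d a assume "d \<in> Arr D" "(a, rng D d) \<in> AD"
  then show "(ractD a d, src D d) \<in> AD"
    using rtup_closed by (fastforce simp: AD_def ractD_def)
next
  fix d d' a assume "d \<in> Arr D" "d' \<in> Arr D" "(a, rng D d) \<in> AD" "src D d = rng D d'"
  then show "ractD a (cmp D d d') = ractD (ractD a d) d'"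
    using rtup_cmp by (fastforce simp: AD_def ractD_def D.src_cmp)
next
  fix d y assume "d \<in> Arr D" "y \<in> YD w" "src D d = rng (zs_product M) y"
  then show "dk d y \<in> YD w" "rng (zs_product M) (dk d y) = rng D d"
    by (cases y; auto simp: YD_def D.cmp_Arr D.src_cmp D.rng_cmp)+
next
  fix d d' y assume "d \<in> Arr D" "d' \<in> Arr D" "y \<in> YD w" "src D d = rng D d'" "src D d' = rng (zs_product M) y"
  then show "dk (cmp D d d') y = dk d (dk d' y)"
    by (cases y) (auto simp: YD_def D.cmp_assoc)
qed

text \<open>Moving \<open>c\<close> past \<open>ds\<close> respects products of neighbours by the
  distributive laws \<open>lact_cmp\<close> and \<open>ract_cmp\<close>, and the absorption of the
  last entry into \<open>k\<close> by \<open>lk_dk\<close>.\<close>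

lemma bar_inner_actC:
  assumes "composable D v ds (rng (zs_product M) k)" "k \<in> Arr (zs_product M)" "c \<in> Arr C" "src C c = v"
  shows "bar_inner D dk (ltup c ds) (lk (rfold c ds) k) =
    frag_map (\<lambda>(ds, k). (ltup c ds, lk (rfold c ds) k)) (bar_inner D dk ds k)"
  using assms(1,3,4)
proof (induction ds arbitrary: c v)
  case (Cons d ds)
  show ?case
  proof (cases ds)
    case Nil
    then show ?thesis using Cons.prems assms(2) by (auto simp: frag_linear lk_dk)
  next
    case ds: (Cons d' ds')
    have c: "c \<triangleleft> d \<in> Arr C" "src C (c \<triangleleft> d) = src D d" "composable D (src D d) ds (rng (zs_product M) k)"
      using Cons.prems by (auto simp: ract_Arr src_ract)
    have 1: "bar_inner D dk (ltup (c \<triangleleft> d) ds) (lk (rfold (c \<triangleleft> d) ds) k) =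
      frag_map (\<lambda>(ds, k). (ltup (c \<triangleleft> d) ds, lk (rfold (c \<triangleleft> d) ds) k)) (bar_inner D dk ds k)"
      by (rule Cons.IH[OF c(3,1,2)])
    have 2: "c \<triangleleft> cmp D d d' = c \<triangleleft> d \<triangleleft> d'" "c \<triangleright> cmp D d d' = cmp D (c \<triangleright> d) ((c \<triangleleft> d) \<triangleright> d')"
      using Cons.prems ds by (auto simp: ract_cmp lact_cmp)
    have "bar_inner D dk (ltup c (d # ds)) (lk (rfold c (d # ds)) k) =
      - frag_of (cmp D (c \<triangleright> d) ((c \<triangleleft> d) \<triangleright> d') # ltup (c \<triangleleft> d \<triangleleft> d') ds', lk (rfold c (d # ds)) k)
      - frag_map (apfst ((#) (c \<triangleright> d))) (bar_inner D dk (ltup (c \<triangleleft> d) ds) (lk (rfold (c \<triangleleft> d) ds) k))"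
      by (simp add: ds)
    then show ?thesis
      unfolding 1 by (simp add: ds 2 frag_linear frag_map_map apfst_def map_prod_def case_prod_unfold)
  qed
qed simp

text \<open>
  The first vertical face is not induced by a map of the coefficients of a row, since it moves \<open>d\<close>
  past all of \<open>cs\<close>; it commutes with the horizontal boundary because the horizontal faces do not
  change the resulting element \<open>cs \<triangleright> d\<close>.
\<close>

definition first_face :: "'c list \<times> 'o \<times> 'd list \<times> 'd \<times> 'c \<Rightarrow> 'c list \<times> 'o \<times> 'd list \<times> 'd \<times> 'c" where
  "first_face = (\<lambda>(cs, v, ds, k). (rtup cs (hd ds), src D (hd ds), tl ds, k))"

text \<open>Reads off, from the invariant of \<open>bar_inner_keys\<close>, the element by which the
  first vertical face acts on an entry placed in front of \<open>cs\<close>.\<close>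

lemma foldr_actC:
  "ds \<noteq> [] \<Longrightarrow> hd (fst (snd (foldr actC cs (v, ds, k)))) = foldr (\<triangleright>) cs (hd ds) \<and>
     fst (snd (foldr actC cs (v, ds, k))) \<noteq> []"
  by (induction cs) (auto simp: actC_def case_prod_unfold neq_Nil_conv)

lemma length_foldr_actC: "length (fst (snd (foldr actC cs y))) = length (fst (snd y))"
  by (induction cs) (auto simp: actC_def case_prod_unfold)

lemma bar_inner_first_face:
  assumes "composable C u cs v" "(v, d # ds, k) \<in> YC w"
  shows "frag_map first_face (bar_inner C actC cs (v, d # ds, k)) =
    bar_inner C actC (rtup cs d) (src D d, ds, k)"
  using assms(1)
proof (induction cs arbitrary: u)
  case (Cons c cs)
  interpret R: left_action C "YC w" fst actC by (rule left_action_C)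
  have d: "d \<in> Arr D" "rng D d = v" using assms(2) by (auto simp: YC_def)
  show ?case
  proof (cases cs)
    case Nil
    then show ?thesis using Cons.prems d
      by (simp add: frag_linear actC_def first_face_def src_lact_rng_ract)
  next
    case cs: (Cons c' cs')
    let ?y = "(v, d # ds, k)"
    have comp: "composable C (src C c) cs v" using Cons.prems by simp
    have "frag_map first_face (frag_map (apfst ((#) c)) (bar_inner C actC cs ?y)) =
      frag_map (apfst ((#) (c \<triangleleft> foldr (\<triangleright>) cs d))) (frag_map first_face (bar_inner C actC cs ?y))"
      unfolding frag_map_map
    proof (rule frag_map_cong, safe)
      fix cs1 v1 ds1 d1 e1
      assume "(cs1, v1, ds1, d1, e1) \<in> Poly_Mapping.keys (bar_inner C actC cs ?y)"
      \<comment> \<open>All faces of the rest have the same total action, so \<open>c\<close> in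
        front of them is acted on by the same element each time.\<close>
      then have eq: "foldr actC cs1 (v1, ds1, d1, e1) = foldr actC cs ?y"
        using R.bar_inner_keys[of "src C c" cs ?y cs1 "(v1, ds1, d1, e1)"] comp assms(2) by simp
      have ne: "ds1 \<noteq> []"
        using length_foldr_actC[of cs1 "(v1, ds1, d1, e1)"] length_foldr_actC[of cs ?y] unfolding eq by auto
      have "foldr (\<triangleright>) cs1 (hd ds1) = foldr (\<triangleright>) cs d"
        using foldr_actC[of ds1 cs1 v1 "(d1, e1)"] foldr_actC[of "d # ds" cs v k] ne unfolding eq by auto
      then show "first_face (apfst ((#) c) (cs1, v1, ds1, d1, e1)) =
          apfst ((#) (c \<triangleleft> foldr (\<triangleright>) cs d)) (first_face (cs1, v1, ds1, d1, e1))"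
        by (simp add: first_face_def)
    qed
    also have "\<dots> = frag_map (apfst ((#) (c \<triangleleft> foldr (\<triangleright>) cs d))) (bar_inner C actC (rtup cs d) (src D d, ds, k))"
      using Cons.IH[OF comp] by simp
    finally have 1: "frag_map first_face (frag_map (apfst ((#) c)) (bar_inner C actC cs ?y)) =
      frag_map (apfst ((#) (c \<triangleleft> foldr (\<triangleright>) cs d))) (bar_inner C actC (rtup cs d) (src D d, ds, k))" .
    have "cmp C c c' \<triangleleft> foldr (\<triangleright>) cs' d = cmp C (c \<triangleleft> foldr (\<triangleright>) cs d) (c' \<triangleleft> foldr (\<triangleright>) cs' d)"
      using Cons.prems rtup_closed[of "src C c'" cs' v d] d by (auto simp: cs intro!: cmp_ract)
    with 1 show ?thesis
      by (simp add: cs frag_linear first_face_def)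
  qed
qed simp

section \<open>The resolution of the total complex\<close>

abbreviation rowt :: "unit \<times> 'c list \<times> 'o \<times> 'd list \<times> 'd \<times> 'c \<Rightarrow> ('o, 'c, 'd) bitup \<times> 'd \<times> 'c" where
  "rowt \<equiv> \<lambda>(_, cs, v, ds, k). ((cs, v, ds), k)"

abbreviation colt :: "('c list \<times> 'o) \<times> 'd list \<times> 'd \<times> 'c \<Rightarrow> ('o, 'c, 'd) bitup \<times> 'd \<times> 'c" where
  "colt \<equiv> \<lambda>((cs, v), ds, k). ((cs, v, ds), k)"

definition hP :: "('o, 'c, 'd) bitup \<times> 'd \<times> 'c \<Rightarrow> (('o, 'c, 'd) bitup \<times> 'd \<times> 'c \<Rightarrow>\<^sub>0 int)" where
  "hP = (\<lambda>((cs, v, ds), k). frag_map rowt (bar C (\<lambda>_ _. ()) actC ((), cs, v, ds, k)))"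

text \<open>Kept without the sign: \<open>vP0\<close> commutes with \<open>hP\<close>, which is what
  naturality delivers, and the factor \<open>(-1) ^ p\<close> in \<open>vP\<close> then turns this
  into anticommutation.\<close>

definition vP0 :: "('o, 'c, 'd) bitup \<times> 'd \<times> 'c \<Rightarrow> (('o, 'c, 'd) bitup \<times> 'd \<times> 'c \<Rightarrow>\<^sub>0 int)" where
  "vP0 = (\<lambda>((cs, v, ds), k). frag_map colt (bar D ractD dk ((cs, v), ds, k)))"

definition vP :: "('o, 'c, 'd) bitup \<times> 'd \<times> 'c \<Rightarrow> (('o, 'c, 'd) bitup \<times> 'd \<times> 'c \<Rightarrow>\<^sub>0 int)" where
  "vP = (\<lambda>((cs, v, ds), k). frag_cmul ((-1) ^ length cs) (vP0 ((cs, v, ds), k)))"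

definition gens :: "'o \<Rightarrow> nat \<Rightarrow> nat \<Rightarrow> (('o, 'c, 'd) bitup \<times> 'd \<times> 'c) set" where
  "gens w p q = {((cs, v, ds), k). length cs = p \<and> length ds = q \<and> (\<exists>u. composable C u cs v) \<and> (v, ds, k) \<in> YC w}"

lemma gens_rows:
  "((cs, v, ds), k) \<in> gens w p q \<longleftrightarrow>
    ((), cs, v, ds, k) \<in> two_sided.bar_tuples C (YC w) fst (UNIV :: (unit \<times> 'o) set) \<and> length cs = p \<and> length ds = q"
proof -
  interpret B: two_sided C "YC w" fst actC "UNIV :: (unit \<times> 'o) set" "\<lambda>_ _. ()" by (rule rows)
  show ?thesis by (auto simp: gens_def B.bar_tuples_def)
qed

lemma gens_columns:
  "((cs, v, ds), k) \<in> gens w p q \<longleftrightarrow>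
    ((cs, v), ds, k) \<in> two_sided.bar_tuples D (YD w) (rng (zs_product M)) AD \<and> length cs = p \<and> length ds = q"
proof -
  interpret B: two_sided D "YD w" "rng (zs_product M)" dk AD ractD by (rule columns)
  show ?thesis unfolding gens_def B.bar_tuples_def by (auto simp: AD_def YC_def YD_def)
qed

lemma hP_keys:
  assumes "x \<in> gens w p q" "y \<in> Poly_Mapping.keys (hP x)"
  shows "p \<noteq> 0 \<and> y \<in> gens w (p - 1) q"
proof -
  interpret B: two_sided C "YC w" fst actC "UNIV :: (unit \<times> 'o) set" "\<lambda>_ _. ()" by (rule rows)
  obtain cs v ds k where x: "x = ((cs, v, ds), k)" by (metis prod.exhaust)
  from assms(1) have t: "((), cs, v, ds, k) \<in> B.bar_tuples" "length cs = p" "length ds = q"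
    unfolding x gens_rows by auto
  from assms(2) obtain a cs' v' ds' k' where y: "y = ((cs', v', ds'), k')"
    "(a, cs', v', ds', k') \<in> Poly_Mapping.keys (bar C (\<lambda>_ _. ()) actC ((), cs, v, ds, k))"
    by (auto simp: x hP_def dest!: keys_frag_mapD)
  have "length ds' = length ds"
  proof -
    \<comment> \<open>\<open>bar_keys\<close> controls only the length of \<open>cs\<close>. Since
      \<open>actC\<close> preserves the length of \<open>ds\<close>, the tuples of a given length
      form an invariant subset of \<open>YC w\<close>, and the bar construction over this subset
      supplies the missing equality.\<close>
    have "left_action C {y \<in> YC w. length (fst (snd y)) = length ds} fst actC"
      by (rule left_action.intro[OF C.small_category_axioms]) 
        (unfold_locales, auto simp: B.act_closed B.t_act B.act_cmp, auto simp: actC_def)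
    then interpret B': two_sided C "{y \<in> YC w. length (fst (snd y)) = length ds}" fst actC "UNIV :: (unit \<times> 'o) set" "\<lambda>_ _. ()"
      by (intro two_sided.intro two_sided_axioms.intro) auto
    have "((), cs, v, ds, k) \<in> B'.bar_tuples"
      using t by (auto simp: B.bar_tuples_def B'.bar_tuples_def)
    from B'.bar_keys[OF this y(2)] show ?thesis by (auto simp: B'.bar_tuples_def)
  qed
  with B.bar_keys[OF t(1) y(2)] t show ?thesis
    unfolding y(1) gens_rows by auto
qed

lemma bar_columns_length:
  assumes "((cs', v'), ds', k') \<in> Poly_Mapping.keys (bar D ractD dk ((cs, v), ds, k))"
  shows "length cs' = length cs"
  using assms by (auto simp: bar_def ractD_def split: if_splits dest!: keys_frag_mapD set_mp[OF keys_add])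

lemma vP0_keys:
  assumes "x \<in> gens w p q" "y \<in> Poly_Mapping.keys (vP0 x)"
  shows "q \<noteq> 0 \<and> y \<in> gens w p (q - 1)"
proof -
  interpret B: two_sided D "YD w" "rng (zs_product M)" dk AD ractD by (rule columns)
  obtain cs v ds k where x: "x = ((cs, v, ds), k)" by (metis prod.exhaust)
  from assms(1) have t: "((cs, v), ds, k) \<in> B.bar_tuples" "length cs = p" "length ds = q"
    unfolding x gens_columns by auto
  from assms(2) obtain cs' v' ds' k' where y: "y = ((cs', v', ds'), k')"
    "((cs', v'), ds', k') \<in> Poly_Mapping.keys (bar D ractD dk ((cs, v), ds, k))"
    by (auto simp: x vP0_def dest!: keys_frag_mapD)
  with B.bar_keys[OF t(1) y(2)] t bar_columns_length[OF y(2)] show ?thesis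
    unfolding y(1) gens_columns by auto
qed

lemma vP_eq: "x \<in> gens w p q \<Longrightarrow> vP x = frag_cmul ((-1) ^ p) (vP0 x)"
  by (auto simp: vP_def gens_def)

lemma vP_keys: "x \<in> gens w p q \<Longrightarrow> y \<in> Poly_Mapping.keys (vP x) \<Longrightarrow> q \<noteq> 0 \<and> y \<in> gens w p (q - 1)"
  using vP0_keys by (auto simp: vP_eq)

lemma vP_ext: "Poly_Mapping.keys z \<subseteq> gens w p q \<Longrightarrow>
    frag_extend vP z = frag_cmul ((-1) ^ p) (frag_extend vP0 z)"
  unfolding frag_extend_cmul_fun[symmetric] by (rule frag_extend_eq) (auto intro!: vP_eq)

lemma hP_zero: "x \<in> gens w 0 q \<Longrightarrow> hP x = 0"
  by (auto simp: gens_def hP_def)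

lemma vP0_zero: "x \<in> gens w p 0 \<Longrightarrow> vP0 x = 0"
  by (auto simp: gens_def vP0_def)

lemma hP_rowt: "frag_extend hP (frag_map rowt z) = frag_map rowt (frag_extend (bar C (\<lambda>_ _. ()) actC) z)"
  unfolding frag_extend_map frag_map_extend
  by (rule frag_extend_eq) (auto simp: hP_def)

lemma vP0_colt: "frag_extend vP0 (frag_map colt z) = frag_map colt (frag_extend (bar D ractD dk) z)"
  unfolding frag_extend_map frag_map_extend
  by (rule frag_extend_eq) (auto simp: vP0_def)

lemma hP_hP: "x \<in> gens w p q \<Longrightarrow> frag_extend hP (hP x) = 0"
proof -
  assume x: "x \<in> gens w p q"
  interpret B: two_sided C "YC w" fst actC "UNIV :: (unit \<times> 'o) set" "\<lambda>_ _. ()" by (rule rows)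
  obtain cs v ds k where xe: "x = ((cs, v, ds), k)" by (metis prod.exhaust)
  with x have "((), cs, v, ds, k) \<in> B.bar_tuples" by (simp add: gens_rows)
  then show ?thesis
    using hP_rowt[of "bar C (\<lambda>_ _. ()) actC ((), cs, v, ds, k)"] B.bar_bar by (simp add: xe hP_def)
qed

lemma vP0_vP0: "x \<in> gens w p q \<Longrightarrow> frag_extend vP0 (vP0 x) = 0"
proof -
  assume x: "x \<in> gens w p q"
  interpret B: two_sided D "YD w" "rng (zs_product M)" dk AD ractD by (rule columns)
  obtain cs v ds k where xe: "x = ((cs, v, ds), k)" by (metis prod.exhaust)
  with x have "((cs, v), ds, k) \<in> B.bar_tuples" by (simp add: gens_columns)
  then show ?thesis
    using vP0_colt[of "bar D ractD dk ((cs, v), ds, k)"] B.bar_bar by (simp add: xe vP0_def)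
qed

lemma vP_vP:
  assumes "x \<in> gens w p q" shows "frag_extend vP (vP x) = 0"
proof -
  have "Poly_Mapping.keys (vP0 x) \<subseteq> gens w p (q - 1)"
    using vP0_keys[OF assms] by auto
  then show ?thesis
    using vP0_vP0[OF assms] vP_ext[of "vP0 x" w p "q - 1"] by (simp add: vP_eq[OF assms] frag_linear)
qed

text \<open>An operator on the coefficients of a row that respects the action of the left category
  commutes with \<open>hP\<close>. It serves for the vertical faces other than the first and for the
  homotopy \<open>sP0\<close>.\<close>

lemma rows_natural:
  assumes x: "((cs, v, ds), k) \<in> gens w p q"
    and nat: "\<And>c y. \<lbrakk>c \<in> Arr C; y \<in> YC w; src C c = fst y\<rbrakk> \<Longrightarrow> \<Omega> (actC c y) = frag_map (actC c) (\<Omega> y)"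
  shows "frag_extend (\<lambda>((cs, v, ds), k). frag_map (\<lambda>(v, ds, k). ((cs, v, ds), k)) (\<Omega> (v, ds, k))) (hP ((cs, v, ds), k)) =
    frag_extend hP (frag_map (\<lambda>(v, ds, k). ((cs, v, ds), k)) (\<Omega> (v, ds, k)))"
proof -
  obtain u where u: "composable C u cs (fst (v, ds, k))" "(v, ds, k) \<in> YC w"
    using x by (auto simp: gens_def)
  have "frag_extend (\<lambda>(a, cs, y). frag_map (\<lambda>y. (a, cs, y)) (\<Omega> y)) (bar C (\<lambda>_ _. ()) actC ((), cs, v, ds, k)) =
    frag_extend (bar C (\<lambda>_ _. ()) actC) (frag_map (\<lambda>y. ((), cs, y)) (\<Omega> (v, ds, k)))"
    by (rule bar_natural[OF left_action_C u nat])
  from arg_cong[OF this, of "frag_map rowt"] show ?thesis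
    unfolding hP_rowt[symmetric] unfolding hP_def
    by (simp add: frag_map_extend frag_extend_map frag_map_map case_prod_unfold)
qed

lemma YC_ltup:
  assumes "c \<in> Arr C" "(v, ds, k) \<in> YC w" "src C c = v"
  shows "rfold c ds \<in> Arr C" "src C (rfold c ds) = rng (zs_product M) k"
  using rfold_closed assms by (auto simp: YC_def)

lemma hP_vP0:
  assumes "x \<in> gens w p q"
  shows "frag_extend hP (vP0 x) = frag_extend vP0 (hP x)"
proof (cases q)
  case 0
  have "frag_extend vP0 (hP x) = 0"
    using hP_keys[OF assms] vP0_zero unfolding 0 by (blast intro: frag_extend_eq_0)
  then show ?thesis using vP0_zero assms by (simp add: 0)
next
  case (Suc q')
  obtain cs v ds k where xe: "x = ((cs, v, ds), k)" by (metis prod.exhaust)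
  with assms Suc obtain d ds' u where ds: "ds = d # ds'" "length ds' = q'" "composable C u cs v" "(v, ds, k) \<in> YC w"
    by (auto simp: gens_def length_Suc_conv)
  \<comment> \<open>\<open>F\<close> is the first vertical face and \<open>R\<close> collects the
    others. \<open>R\<close> commutes with \<open>hP\<close> by naturality, \<open>F\<close> by
    \<open>bar_inner_first_face\<close>.\<close>
  define F where "F = (\<lambda>((cs, v :: 'o, ds), k). ((rtup cs (hd ds), src D (hd ds), tl ds), k) :: ('o, 'c, 'd) bitup \<times> 'd \<times> 'c)"
  define \<Omega> where "\<Omega> = (\<lambda>(v :: 'o, ds, k). frag_map (Pair v) (bar_inner D dk ds k))"
  define R where "R = (\<lambda>((cs, v, ds), k). frag_map (\<lambda>(v, ds, k). ((cs, v, ds), k) :: ('o, 'c, 'd) bitup \<times> 'd \<times> 'c) (\<Omega> (v, ds, k)))"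
  have V: "vP0 y = frag_of (F y) + R y" if "y \<in> gens w p' (Suc q'')" for y p' q''
    using that by (auto simp: gens_def vP0_def bar_def F_def R_def \<Omega>_def ractD_def frag_linear frag_map_map case_prod_unfold)
  have nat: "\<Omega> (actC c y) = frag_map (actC c) (\<Omega> y)" if "c \<in> Arr C" "y \<in> YC w" "src C c = fst y" for c y
  proof -
    obtain v ds k where y: "y = (v, ds, k)" by (metis prod.exhaust)
    have "bar_inner D dk (ltup c ds) (lk (rfold c ds) k) =
      frag_map (\<lambda>(ds, k). (ltup c ds, lk (rfold c ds) k)) (bar_inner D dk ds k)"
      using that by (intro bar_inner_actC[of v]) (auto simp: y YC_def)
    then show ?thesis
      by (simp add: y \<Omega>_def actC_def frag_map_map case_prod_unfold)
  qed
  have keys: "\<exists>p'. y \<in> gens w p' (Suc q')" if "y \<in> Poly_Mapping.keys (hP x)" for y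
    using hP_keys[OF assms that] Suc by auto
  have "frag_extend vP0 (hP x) = frag_extend (\<lambda>y. frag_of (F y) + R y) (hP x)"
    by (rule frag_extend_eq) (use keys V in blast)
  also have "\<dots> = frag_map F (hP x) + frag_extend R (hP x)"
    by (simp add: frag_extend_plus_fun frag_map_def)
  also have "frag_extend R (hP x) = frag_extend hP (R x)"
    unfolding R_def xe prod.case
    by (rule rows_natural[where \<Omega> = \<Omega>, OF assms[unfolded xe]]) (rule nat)
  also have "frag_map F (hP x) = hP (F x)"
  proof (cases cs)
    case Nil
    then show ?thesis by (simp add: xe hP_def F_def)
  next
    case (Cons c cs')
    have "frag_map F (frag_map rowt (frag_map (Pair ()) (bar_inner C actC cs (v, ds, k)))) =
      frag_map rowt (frag_map (Pair ()) (frag_map first_face (bar_inner C actC cs (v, ds, k))))"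
      by (simp add: frag_map_map F_def first_face_def case_prod_unfold)
    also have "frag_map first_face (bar_inner C actC cs (v, ds, k)) =
      bar_inner C actC (rtup cs d) (src D d, ds', k)"
      using bar_inner_first_face ds by (simp add: ds(1))
    finally show ?thesis
      by (simp add: xe hP_def F_def Cons bar_Cons frag_linear ds(1) del: bar_inner.simps)
  qed
  finally show ?thesis
    using V[of x p q'] assms by (simp add: Suc frag_linear)
qed

lemma hP_vP:
  assumes "x \<in> gens w p q"
  shows "frag_extend hP (vP x) + frag_extend vP (hP x) = 0"
proof (cases p)
  case 0
  have "frag_extend hP (vP x) = 0"
    using vP_keys[OF assms] hP_zero unfolding 0 by (blast intro: frag_extend_eq_0)
  then show ?thesis using hP_zero assms by (simp add: 0)
next
  case (Suc p')
  have "Poly_Mapping.keys (hP x) \<subseteq> gens w p' q"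
    using hP_keys[OF assms] Suc by auto
  then show ?thesis
    using hP_vP0[OF assms] vP_ext[of "hP x" w p' q]
    by (simp add: vP_eq[OF assms] frag_linear Suc flip: frag_cmul_distrib)
qed

section \<open>The total differential of the resolution\<close>

definition dP :: "('o, 'c, 'd) bitup \<times> 'd \<times> 'c \<Rightarrow> (('o, 'c, 'd) bitup \<times> 'd \<times> 'c \<Rightarrow>\<^sub>0 int)" where
  "dP x = hP x + vP x"

lemma dP_ext: "frag_extend dP z = frag_extend hP z + frag_extend vP z"
  unfolding dP_def by (rule frag_extend_plus_fun)

lemma dP_dP: "x \<in> gens w p q \<Longrightarrow> frag_extend dP (dP x) = 0"
  using hP_hP[of x w p q] vP_vP[of x w p q] hP_vP[of x w p q]
  by (simp add: dP_ext) (simp add: dP_def frag_linear add.commute)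

definition tot_gens :: "'o \<Rightarrow> nat \<Rightarrow> (('o, 'c, 'd) bitup \<times> 'd \<times> 'c) set" where
  "tot_gens w n = {x. \<exists>p q. p + q = n \<and> x \<in> gens w p q}"

lemma gens_tot: "x \<in> gens w p q \<Longrightarrow> p + q = n \<Longrightarrow> x \<in> tot_gens w n"
  by (auto simp: tot_gens_def)

lemma tot_gensE:
  assumes "x \<in> tot_gens w n"
  obtains p q where "x \<in> gens w p q" "p + q = n"
  using assms by (auto simp: tot_gens_def)

lemma dP_keys:
  assumes "x \<in> tot_gens w n" "y \<in> Poly_Mapping.keys (dP x)"
  shows "n \<noteq> 0 \<and> y \<in> tot_gens w (n - 1)"
proof -
  from assms(1) obtain p q where x: "x \<in> gens w p q" "p + q = n" by (rule tot_gensE)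
  from assms(2) have "y \<in> Poly_Mapping.keys (hP x) \<or> y \<in> Poly_Mapping.keys (vP x)"
    by (auto simp: dP_def dest: set_mp[OF keys_add])
  then show ?thesis
    using hP_keys[OF x(1), of y] vP_keys[OF x(1), of y] x(2)
      gens_tot[of y w "p - 1" q "n - 1"] gens_tot[of y w p "q - 1" "n - 1"] by auto
qed

section \<open>The contraction\<close>

text \<open>
  With \<open>k = (d, e)\<close>, the homotopy \<open>sP\<close> moves \<open>d\<close> to the end of \<open>ds\<close>. It contracts the columns
  onto the tuples with \<open>ds = []\<close> and \<open>d\<close> an identity, along \<open>piP\<close>, and it anticommutes with
  \<open>hP\<close>; the homotopy \<open>tP\<close> then moves \<open>e\<close> to the end of \<open>cs\<close>.
\<close>

definition sP0 :: "('o, 'c, 'd) bitup \<times> 'd \<times> 'c \<Rightarrow> (('o, 'c, 'd) bitup \<times> 'd \<times> 'c \<Rightarrow>\<^sub>0 int)" where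
  "sP0 = (\<lambda>((cs, v, ds), k). frag_map (\<lambda>(ds, k). ((cs, v, ds), k))
     (bar_split fst (\<lambda>(d, e). (ident D (src D d), e)) (ds, k)))"

definition sP :: "('o, 'c, 'd) bitup \<times> 'd \<times> 'c \<Rightarrow> (('o, 'c, 'd) bitup \<times> 'd \<times> 'c \<Rightarrow>\<^sub>0 int)" where
  "sP = (\<lambda>((cs, v, ds), k). frag_cmul ((-1) ^ length cs) (sP0 ((cs, v, ds), k)))"

definition piP :: "('o, 'c, 'd) bitup \<times> 'd \<times> 'c \<Rightarrow> (('o, 'c, 'd) bitup \<times> 'd \<times> 'c \<Rightarrow>\<^sub>0 int)" where
  "piP = (\<lambda>((cs, v, ds), d, e). if ds = [] then
     frag_of ((rtup cs d, src D d, []), ident D (src D d), e) else 0)"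

definition tP :: "('o, 'c, 'd) bitup \<times> 'd \<times> 'c \<Rightarrow> (('o, 'c, 'd) bitup \<times> 'd \<times> 'c \<Rightarrow>\<^sub>0 int)" where
  "tP = (\<lambda>((cs, v, ds), k). frag_map (\<lambda>(cs, v, ds, k). ((cs, v, ds), k))
     (bar_split (\<lambda>(v, ds, d, e). e) (\<lambda>(v, ds, d, e). (src C e, [], ident D (src C e), ident C (src C e)))
       (cs, v, ds, k)))"

lemma sP0_keys:
  assumes "x \<in> gens w p q" "y \<in> Poly_Mapping.keys (sP0 x)"
  shows "y \<in> gens w p (Suc q)"
proof -
  obtain cs v ds d e where x: "x = ((cs, v, ds), d, e)" by (metis prod.exhaust)
  have y: "y = ((cs, v, ds @ [d]), ident D (src D d), e)"
    using assms(2) by (auto simp: x sP0_def bar_split_def frag_linear)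
  from assms(1) have g: "length cs = p" "length ds = q" "composable D v ds (rng D d)" "d \<in> Arr D" "e \<in> Arr C"
    "src D d = rng C e" "src C e = w" "\<exists>u. composable C u cs v" "v \<in> Obj D"
    unfolding x gens_def YC_def by (auto elim: composable.elims intro: Obj_simps)
  then show ?thesis
    by (auto simp: y gens_def YC_def D.composable_append Obj_simps)
qed

lemma sP_keys:
  assumes "x \<in> gens w p q" "y \<in> Poly_Mapping.keys (sP x)"
  shows "y \<in> gens w p (Suc q)"
  using assms sP0_keys[OF assms(1), of y] by (cases x) (auto simp: sP_def)

lemma sP_eq: "x \<in> gens w p q \<Longrightarrow> sP x = frag_cmul ((-1) ^ p) (sP0 x)"
  by (auto simp: sP_def gens_def)

lemma sP_ext: "Poly_Mapping.keys z \<subseteq> gens w p q \<Longrightarrow>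
    frag_extend sP z = frag_cmul ((-1) ^ p) (frag_extend sP0 z)"
  unfolding frag_extend_cmul_fun[symmetric] by (rule frag_extend_eq) (auto intro!: sP_eq)

lemma D_cmp_ident: "d \<in> Arr D \<Longrightarrow> src D d = v \<Longrightarrow> cmp D d (ident D v) = d"
  using D.cmp_ident_right by auto

lemma C_cmp_ident: "c \<in> Arr C \<Longrightarrow> src C c = v \<Longrightarrow> cmp C c (ident C v) = c"
  using C.cmp_ident_right by auto

text \<open>The pair \<open>(d, e)\<close> is \<open>d\<close> acting on an identity paired with
  \<open>e\<close>, which is the factorisation required by \<open>bar_split\<close>; the exceptional
  term for empty \<open>ds\<close> becomes \<open>piP\<close>.\<close>

lemma vP0_sP0:
  assumes "x \<in> gens w p q"
  shows "frag_extend vP0 (sP0 x) + frag_extend sP0 (vP0 x) = frag_of x - piP x"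
proof -
  interpret B: two_sided D "YD w" "rng (zs_product M)" dk AD ractD by (rule columns)
  obtain cs v ds d e where x: "x = ((cs, v, ds), d, e)" by (metis prod.exhaust)
  from assms have t: "((cs, v), ds, d, e) \<in> B.bar_tuples"
    unfolding x gens_columns by auto
  let ?s = "bar_split fst (\<lambda>(d, e). (ident D (src D d), e))"
  have comp: "composable D v ds (rng (zs_product M) (d, e))" "(d, e) \<in> YD w"
    using t unfolding B.bar_tuples_def by (auto simp: AD_def)
  have 1: "frag_extend (bar D ractD dk) (frag_map (Pair (cs, v)) (?s (ds, d, e)))
      + frag_extend (\<lambda>(a, x). frag_map (Pair a) (?s x)) (bar D ractD dk ((cs, v), ds, d, e))
    = frag_of ((cs, v), ds, d, e) - (if ds = [] then frag_of (ractD (cs, v) (fst (d, e)), [], (\<lambda>(d, e). (ident D (src D d), e)) (d, e)) else 0)"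
    by (rule B.bar_split_homotopy[OF _ _ _ comp])
      (auto simp: YD_def D_cmp_ident D.src_cmp)
  have 2: "sP0 x = frag_map colt (frag_map (Pair (cs, v)) (?s (ds, d, e)))"
    by (simp add: x sP0_def frag_map_map case_prod_unfold)
  have 3: "frag_extend sP0 (frag_map colt z) = frag_map colt (frag_extend (\<lambda>(a, x). frag_map (Pair a) (?s x)) z)" for z
    unfolding frag_extend_map frag_map_extend
    by (rule frag_extend_eq) (auto simp: sP0_def frag_map_map case_prod_unfold)
  have 4: "vP0 x = frag_map colt (bar D ractD dk ((cs, v), ds, d, e))"
    by (simp add: x vP0_def)
  show ?thesis
    unfolding 4 3 unfolding 2 vP0_colt frag_map_add[symmetric] 1
    by (auto simp: x piP_def ractD_def frag_linear)
qed

lemma hP_sP0: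
  assumes "x \<in> gens w p q"
  shows "frag_extend hP (sP0 x) = frag_extend sP0 (hP x)"
proof -
  obtain cs v ds k where xe: "x = ((cs, v, ds), k)" by (metis prod.exhaust)
  define \<Omega> where "\<Omega> = (\<lambda>(v :: 'o, ds, k). frag_map (Pair v) (bar_split fst (\<lambda>(d, e). (ident D (src D d), e :: 'c)) (ds, k)))"
  have nat: "\<Omega> (actC c y) = frag_map (actC c) (\<Omega> y)" if "c \<in> Arr C" "y \<in> YC w" "src C c = fst y" for c y
  proof -
    obtain v ds d e where y: "y = (v, ds, d, e)" by (metis prod.exhaust)
    let ?c = "rfold c ds"
    have c: "?c \<in> Arr C" "src C ?c = rng D d" and de: "d \<in> Arr D" "e \<in> Arr C" "src D d = rng C e"
      using YC_ltup[of c v ds "(d, e)" w] that by (auto simp: y YC_def)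
    \<comment> \<open>After the splitting \<open>c\<close> has to pass \<open>ds\<close>, then
      \<open>d\<close>, then an identity. The last passage changes nothing, so the splitting
      respects the action.\<close>
    have "(?c \<triangleleft> d) \<triangleright> ident D (src D d) = ident D (src D (?c \<triangleright> d))" "?c \<triangleleft> d \<triangleleft> ident D (src D d) = ?c \<triangleleft> d"
      using lact_ident[of "?c \<triangleleft> d"] ract_ident[of "?c \<triangleleft> d"] c de
      by (auto simp: ract_Arr src_ract src_lact_rng_ract)
    then show ?thesis
      by (simp add: y \<Omega>_def bar_split_def actC_def frag_linear ltup_append)
  qed
  have sP0: "sP0 = (\<lambda>((cs, v, ds), k). frag_map (\<lambda>(v, ds, k). ((cs, v, ds), k)) (\<Omega> (v, ds, k)))"
    by (simp add: sP0_def \<Omega>_def frag_map_map case_prod_unfold fun_eq_iff)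
  show ?thesis
    unfolding sP0 xe prod.case
    by (rule rows_natural[where \<Omega> = \<Omega>, OF assms[unfolded xe], symmetric]) (rule nat)
qed

lemma dP_sP:
  assumes "x \<in> gens w p q"
  shows "frag_extend dP (sP x) + frag_extend sP (dP x) = frag_of x - piP x"
proof -
  have "frag_extend vP (sP x) + frag_extend sP (vP x) = frag_of x - piP x"
  proof -
    have "Poly_Mapping.keys (sP0 x) \<subseteq> gens w p (Suc q)" "Poly_Mapping.keys (vP0 x) \<subseteq> gens w p (q - 1)"
      using sP0_keys[OF assms] vP0_keys[OF assms] by auto
    then show ?thesis
      using vP0_sP0[OF assms] vP_ext[of "sP0 x" w p "Suc q"] sP_ext[of "vP0 x" w p "q - 1"]
      by (simp add: vP_eq[OF assms] sP_eq[OF assms] frag_linear)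
  qed
  moreover have "frag_extend hP (sP x) + frag_extend sP (hP x) = 0"
  proof (cases p)
    case 0
    have "frag_extend hP (sP x) = 0"
      using sP_keys[OF assms] hP_zero unfolding 0 by (blast intro: frag_extend_eq_0)
    then show ?thesis using hP_zero assms by (simp add: 0)
  next
    case (Suc p')
    have "Poly_Mapping.keys (hP x) \<subseteq> gens w p' q"
      using hP_keys[OF assms] Suc by auto
    then show ?thesis
      using hP_sP0[OF assms] sP_ext[of "hP x" w p' q]
      by (simp add: sP_eq[OF assms] frag_linear Suc flip: frag_cmul_distrib)
  qed
  moreover have "frag_extend dP (sP x) + frag_extend sP (dP x) =
      (frag_extend vP (sP x) + frag_extend sP (vP x)) + (frag_extend hP (sP x) + frag_extend sP (hP x))"
    by (simp add: dP_ext) (simp add: dP_def frag_linear algebra_simps)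
  ultimately show ?thesis by simp
qed

text \<open>The coefficients of a row that remain after \<open>piP\<close>: the representable left
  set of morphisms \<open>e\<close> with domain \<open>w\<close>, on which \<open>actC\<close>
  becomes composition by \<open>actC_YT\<close>.\<close>

definition YT :: "'o \<Rightarrow> ('o \<times> 'd list \<times> 'd \<times> 'c) set" where
  "YT w = {(v, [], ident D v, e) |v e. e \<in> Arr C \<and> rng C e = v \<and> src C e = w}"

lemma actC_YT:
  assumes "c \<in> Arr C" "e \<in> Arr C" "src C c = rng C e"
  shows "actC c (rng C e, [], ident D (rng C e), e) = (rng C c, [], ident D (rng C c), cmp C c e)"
  using assms lact_ident[of c] ract_ident[of c] by (simp add: actC_def)

lemma left_action_T: "left_action C (YT w) fst actC"
proof
  fix c y assume "c \<in> Arr C" "y \<in> YT w" "src C c = fst y"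
  then show "actC c y \<in> YT w" "fst (actC c y) = rng C c"
    using actC_YT[of c] by (auto simp: YT_def C.cmp_Arr C.rng_cmp C.src_cmp)
next
  fix c c' y
  assume "c \<in> Arr C" "c' \<in> Arr C" "y \<in> YT w" "src C c = rng C c'" "src C c' = fst y"
  moreover from this obtain e where "y = (rng C e, [], ident D (rng C e), e)" "e \<in> Arr C"
    by (auto simp: YT_def)
  ultimately show "actC (cmp C c c') y = actC c (actC c' y)"
    using actC_YT[of "cmp C c c'" e] actC_YT[of c' e] actC_YT[of c "cmp C c' e"]
    by (simp add: C.cmp_Arr C.rng_cmp C.src_cmp C.cmp_assoc)
qed

definition pi_gens :: "'o \<Rightarrow> nat \<Rightarrow> (('o, 'c, 'd) bitup \<times> 'd \<times> 'c) set" where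
  "pi_gens w n = {((cs, v, []), ident D v, e) |cs v e. length cs = n \<and> (\<exists>u. composable C u cs v) \<and>
     e \<in> Arr C \<and> rng C e = v \<and> src C e = w}"

definition ptP :: "'o \<Rightarrow> ('o, 'c, 'd) bitup \<times> 'd \<times> 'c" where
  "ptP w = (([], w, []), ident D w, ident C w)"

lemma pi_gens_gens: "pi_gens w n \<subseteq> gens w n 0"
  by (auto simp: pi_gens_def gens_def YC_def Obj_simps)

lemma piP_keys:
  assumes "x \<in> gens w p q" "y \<in> Poly_Mapping.keys (piP x)"
  shows "q = 0 \<and> y \<in> pi_gens w p"
proof -
  obtain cs v ds d e where x: "x = ((cs, v, ds), d, e)" by (metis prod.exhaust)
  from assms(2) have y: "ds = []" "y = ((rtup cs d, src D d, []), ident D (src D d), e)"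
    by (auto simp: x piP_def split: if_splits)
  from assms(1) have g: "length cs = p" "length ds = q" "d \<in> Arr D" "rng D d = v" "e \<in> Arr C"
    "src D d = rng C e" "src C e = w" and "\<exists>u. composable C u cs v"
    using y(1) unfolding x gens_def YC_def by auto
  then obtain u where "composable C u cs v" by blast
  from rtup_closed[OF this g(3,4)] g y show ?thesis
    by (auto simp: pi_gens_def)
qed

lemma tP_keys:
  assumes "x \<in> pi_gens w n" "y \<in> Poly_Mapping.keys (tP x)"
  shows "y \<in> gens w (Suc n) 0"
  using assms
  by (force simp: pi_gens_def tP_def bar_split_def frag_linear gens_def YC_def C.composable_append Obj_simps same_Obj
      dest: C.rng_Obj elim: composable.elims)

text \<open>On the image of \<open>piP\<close> only the row with empty \<open>ds\<close> is left. It
  is a bar resolution of the left category, contracted by appending \<open>e\<close>; the vertical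
  differential vanishes on it and on the image of \<open>tP\<close>.\<close>

lemma dP_tP:
  assumes "x \<in> pi_gens w n"
  shows "frag_extend dP (tP x) + frag_extend tP (dP x) = frag_of x - (if n = 0 then frag_of (ptP w) else 0)"
proof -
  interpret B: left_action C "YT w" fst actC by (rule left_action_T)
  obtain cs v e u where x: "x = ((cs, v, []), ident D v, e)" "length cs = n" "composable C u cs v"
    "e \<in> Arr C" "rng C e = v" "src C e = w"
    using assms by (auto simp: pi_gens_def)
  let ?lam = "\<lambda>(v, ds, d, e). e" and ?rho = "\<lambda>(v, ds, d, e). (src C e, [], ident D (src C e), ident C (src C e))"
  let ?s = "bar_split ?lam ?rho" and ?y = "(v, [] :: 'd list, ident D v, e)"
  let ?bar = "bar C (\<lambda>_ _. ()) actC"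
  have 1: "frag_extend ?bar (frag_map (Pair ()) (?s (cs, ?y)))
      + frag_extend (\<lambda>(a, x). frag_map (Pair a) (?s x)) (?bar ((), cs, ?y))
    = frag_of ((), cs, ?y) - (if cs = [] then frag_of ((), [], ?rho ?y) else 0)"
  proof (rule B.bar_split_homotopy)
    show "composable C u cs (fst ?y)" "?y \<in> YT w" using x by (auto simp: YT_def)
  next
    fix y assume "y \<in> YT w"
    then show "actC (?lam y) (?rho y) = y"
      using actC_YT[of "snd (snd (snd y))" "ident C w"] by (auto simp: YT_def Obj_simps C_cmp_ident)
  next
    fix m y assume "m \<in> Arr C" "y \<in> YT w" "src C m = fst y"
    then show "?lam (actC m y) = cmp C m (?lam y)" "?rho (actC m y) = ?rho y"
      using actC_YT[of m] by (auto simp: YT_def C.src_cmp)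
  qed
  have g: "x \<in> gens w n 0" using assms pi_gens_gens by blast
  have "vP x = 0"
    using vP_eq[OF g] vP0_zero[OF g] by simp
  moreover have "frag_extend vP (tP x) = 0"
    using tP_keys[OF assms] vP_eq vP0_zero by (intro frag_extend_eq_0) (metis frag_cmul_zero2)
  moreover have "frag_extend hP (tP x) + frag_extend tP (hP x) = frag_of x - (if n = 0 then frag_of (ptP w) else 0)"
  proof -
    have 2: "tP x = frag_map rowt (frag_map (Pair ()) (?s (cs, ?y)))"
      by (simp add: x(1) tP_def frag_map_map case_prod_unfold)
    have 3: "frag_extend tP (frag_map rowt z) = frag_map rowt (frag_extend (\<lambda>(a, x). frag_map (Pair a) (?s x)) z)" for z
      unfolding frag_extend_map frag_map_extend
      by (rule frag_extend_eq) (auto simp: tP_def frag_map_map case_prod_unfold)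
    have 4: "hP x = frag_map rowt (?bar ((), cs, ?y))"
      by (simp add: x(1) hP_def)
    show ?thesis
      unfolding 4 3 unfolding 2 hP_rowt frag_map_add[symmetric] 1
      using x by (auto simp: frag_linear ptP_def)
  qed
  ultimately show ?thesis
    by (simp add: dP_ext) (simp add: dP_def)
qed

text \<open>Two deformations in succession: \<open>sP\<close> takes the identity to
  \<open>piP\<close>, and \<open>tP\<close> takes the image of \<open>piP\<close> to the point
  \<open>ptP\<close>.\<close>

definition SP :: "('o, 'c, 'd) bitup \<times> 'd \<times> 'c \<Rightarrow> (('o, 'c, 'd) bitup \<times> 'd \<times> 'c \<Rightarrow>\<^sub>0 int)" where
  "SP x = sP x + frag_extend tP (piP x)"

lemma tot_dP_sP:
  assumes "Poly_Mapping.keys z \<subseteq> tot_gens w n"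
  shows "frag_extend dP (frag_extend sP z) + frag_extend sP (frag_extend dP z) = z - frag_extend piP z"
  using assms
proof (induction rule: frag_induction)
  case (one x)
  then obtain p q where "x \<in> gens w p q" by (auto elim: tot_gensE)
  from dP_sP[OF this] show ?case by simp
next
  case (diff a b)
  from arg_cong2[OF diff, of "(-)"] show ?case by (simp add: frag_linear algebra_simps)
qed auto

lemma tot_dP_dP:
  assumes "Poly_Mapping.keys z \<subseteq> tot_gens w n"
  shows "frag_extend dP (frag_extend dP z) = 0"
  using assms
proof (induction rule: frag_induction)
  case (one x)
  then obtain p q where "x \<in> gens w p q" by (auto elim: tot_gensE)
  from dP_dP[OF this] show ?case by simp
qed (auto simp: frag_linear)

lemma sP_tot: "x \<in> tot_gens w n \<Longrightarrow> Poly_Mapping.keys (sP x) \<subseteq> tot_gens w (Suc n)"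
  by (auto elim!: tot_gensE dest: sP_keys intro: gens_tot)

lemma piP_tot: "x \<in> tot_gens w n \<Longrightarrow> Poly_Mapping.keys (piP x) \<subseteq> pi_gens w n"
  by (auto elim!: tot_gensE dest: piP_keys)

lemma SP_tot:
  assumes "x \<in> tot_gens w n"
  shows "Poly_Mapping.keys (SP x) \<subseteq> tot_gens w (Suc n)"
proof -
  have "Poly_Mapping.keys (frag_extend tP (piP x)) \<subseteq> tot_gens w (Suc n)"
    using tP_keys piP_tot[OF assms] gens_tot by (intro keys_frag_extend_subset) fastforce
  then show ?thesis
    unfolding SP_def using sP_tot[OF assms] by (rule keys_add_subset[rotated])
qed

lemma dP_SP:
  assumes "x \<in> tot_gens w n"
  shows "frag_extend dP (SP x) + frag_extend SP (dP x) = frag_of x - (if n = 0 then frag_of (ptP w) else 0)"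
proof -
  have k: "Poly_Mapping.keys (frag_of x) \<subseteq> tot_gens w n" "Poly_Mapping.keys (dP x) \<subseteq> tot_gens w (n - 1)"
    "Poly_Mapping.keys (piP x) \<subseteq> pi_gens w n"
    using assms dP_keys[OF assms] piP_tot[OF assms] by auto
  have dd: "frag_extend dP (dP x) = 0"
    using tot_dP_dP[OF k(1)] by simp
  have s: "frag_extend dP (sP x) + frag_extend sP (dP x) = frag_of x - piP x"
    using tot_dP_sP[OF k(1)] by simp
  have ss: "Poly_Mapping.keys (sP x) \<subseteq> tot_gens w (Suc n)"
    by (rule sP_tot[OF assms])
  have "frag_extend dP (frag_extend sP (dP x)) = dP x - frag_extend piP (dP x)"
    using tot_dP_sP[OF k(2)] dd by simp
  moreover have "frag_extend dP (frag_extend sP (dP x)) = dP x - frag_extend dP (piP x)"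
    using arg_cong[OF s, of "frag_extend dP"] tot_dP_dP[OF ss] by (simp add: frag_linear)
  \<comment> \<open>\<open>piP\<close> is a chain map because \<open>dP sP + sP dP = 1 - piP\<close>.\<close>
  ultimately have pi: "frag_extend piP (dP x) = frag_extend dP (piP x)" by simp
  have t: "frag_extend dP (frag_extend tP z) + frag_extend tP (frag_extend dP z) =
      z - (if n = 0 then frag_map (\<lambda>_. ptP w) z else 0)" if "Poly_Mapping.keys z \<subseteq> pi_gens w n" for z
    using that
  proof (induction rule: frag_induction)
    case (one x)
    from dP_tP[OF this] show ?case by simp
  next
    case (diff a b)
    from arg_cong2[OF diff, of "(-)"] show ?case by (auto simp: frag_linear algebra_simps)
  qed auto
  have pt: "frag_map (\<lambda>_. ptP w) (piP x) = frag_of (ptP w)" if "n = 0"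
    using assms that by (auto elim!: tot_gensE simp: gens_def piP_def)
  have "frag_extend SP (dP x) = frag_extend sP (dP x) + frag_extend tP (frag_extend piP (dP x))"
    by (simp add: SP_def[abs_def] frag_extend_plus_fun frag_extend_extend)
  then have "frag_extend dP (SP x) + frag_extend SP (dP x) =
    (frag_extend dP (sP x) + frag_extend sP (dP x)) +
    (frag_extend dP (frag_extend tP (piP x)) + frag_extend tP (frag_extend dP (piP x)))"
    by (simp add: SP_def frag_linear pi algebra_simps)
  then show ?thesis
    unfolding s t[OF k(3)] using pt by (cases "n = 0") simp_all
qed

definition tot_tuples :: "nat \<Rightarrow> ('o, 'c, 'd) bitup set" where
  "tot_tuples n = {(cs, v, ds). length cs + length ds = n \<and>
     (\<exists>u. composable C u cs v) \<and> (\<exists>w. composable D v ds w)}"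

lemma tot_gens_iff:
  "(x, k) \<in> tot_gens w n \<longleftrightarrow> x \<in> tot_tuples n \<and> k \<in> Arr (zs_product M) \<and>
     rng (zs_product M) k = (case x of (cs, v, ds) \<Rightarrow> tuple_end D v ds) \<and> src (zs_product M) k = w"
  by (auto simp: tot_gens_def gens_def YC_def tot_tuples_def dest: composable_end)
    (metis composable_end)+

text \<open>\<open>lk c\<close> is left multiplication by the image of \<open>c\<close> in the
  product, so it commutes with right multiplication by \<open>h\<close>; naturality of the bar
  boundary carries this over to \<open>hP\<close>.\<close>

lemma right_mult_hP:
  assumes "(x, k) \<in> gens w p q" "h \<in> Arr (zs_product M)" "src (zs_product M) k = rng (zs_product M) h"
  shows "hP (x, cmp (zs_product M) k h) = right_mult (zs_product M) h (hP (x, k))"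
proof -
  obtain cs v ds where x: "x = (cs, v, ds)" by (metis prod.exhaust)
  obtain u where u: "composable C u cs (fst (v, ds, k))" "(v, ds, k) \<in> YC w"
    using assms by (auto simp: gens_def x)
  have "frag_map (\<lambda>(a, cs, y). (a, cs, (\<lambda>(v, ds, k). (v, ds, cmp (zs_product M) k h)) y)) (bar C (\<lambda>_ _. ()) actC ((), cs, v, ds, k)) =
    bar C (\<lambda>_ _. ()) actC ((), cs, (\<lambda>(v, ds, k). (v, ds, cmp (zs_product M) k h)) (v, ds, k))"
  proof (rule bar_natural_map[OF left_action_C u])
    fix c y assume c: "c \<in> Arr C" "y \<in> YC w" "src C c = fst y"
    obtain v ds d e where y: "y = (v, ds, d, e)" by (metis prod.exhaust)
    obtain d' e' where h: "h = (d', e')" by fastforce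
    let ?c = "rfold c ds"
    have rf: "?c \<in> Arr C" "src C ?c = rng D d"
      using YC_ltup[of c v ds "(d, e)" w] c by (auto simp: y)
    have "src C e = rng D d'" "src C e = w"
      using assms c by (auto simp: gens_def YC_def y h)
    then have "lk ?c (cmp (zs_product M) (d, e) h) = cmp (zs_product M) (lk ?c (d, e)) h"
      using assms c rf by (simp add: y h YC_def lact_cmp ract_cmp lact_Arr ract_Arr rng_lact src_ract
          src_lact_rng_ract C.cmp_assoc cmp_lact cmp_ract)
    then show "(\<lambda>(v, ds, k). (v, ds, cmp (zs_product M) k h)) (actC c y) =
      actC c ((\<lambda>(v, ds, k). (v, ds, cmp (zs_product M) k h)) y)"
      by (simp add: y actC_def del: zs_simps lk.simps)
  qed
  from arg_cong[OF this, of "frag_map rowt"] show ?thesis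
    by (simp add: x hP_def right_mult_def frag_map_map case_prod_unfold)
qed

lemma right_mult_vP:
  assumes "(x, k) \<in> gens w p q" "h \<in> Arr (zs_product M)" "src (zs_product M) k = rng (zs_product M) h"
  shows "vP (x, cmp (zs_product M) k h) = right_mult (zs_product M) h (vP (x, k))"
proof -
  interpret B: two_sided D "YD w" "rng (zs_product M)" dk AD ractD by (rule columns)
  obtain cs v ds where x: "x = (cs, v, ds)" by (metis prod.exhaust)
  from assms(1) have "((cs, v), ds, k) \<in> B.bar_tuples"
    unfolding x gens_columns by auto
  then have comp: "composable D v ds (rng (zs_product M) k)" "k \<in> YD w"
    unfolding B.bar_tuples_def by (auto simp: AD_def)
  have "frag_map (\<lambda>(a, ms, k). (a, ms, cmp (zs_product M) k h)) (bar D ractD dk ((cs, v), ds, k)) =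
     bar D ractD dk ((cs, v), ds, cmp (zs_product M) k h)"
  proof (rule bar_natural_map[OF B.left_action_axioms comp])
    fix d y assume d: "d \<in> Arr D" "y \<in> YD w" "src D d = rng (zs_product M) y"
    obtain d1 e where y: "y = (d1, e)" by fastforce
    obtain d' e' where h: "h = (d', e')" by fastforce
    have "src C e = rng D d'"
      using assms comp(2) d by (auto simp: YD_def y h)
    then show "cmp (zs_product M) (dk d y) h = dk d (cmp (zs_product M) y h)"
      using d assms(2) by (auto simp: YD_def y h D.cmp_assoc lact_Arr rng_lact)
  qed
  from arg_cong[OF this, of "frag_map colt"] show ?thesis
    by (simp add: x vP_def vP0_def right_mult_def frag_linear frag_map_map case_prod_unfold)
qed

theorem tot_resolution:
  "free_resolution (zs_product M) tot_tuples (\<lambda>(cs, v, ds). tuple_end D v ds) dP"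
proof (rule free_resolutionI[where pt = ptP and S = SP])
  let ?\<sigma> = "\<lambda>(cs, v, ds). tuple_end D v ds"
  have chains: "free_chains (zs_product M) tot_tuples ?\<sigma> n w = {z. Poly_Mapping.keys z \<subseteq> tot_gens w n}" for n w
    unfolding free_chains_def by (auto simp: tot_gens_iff)
  show "small_category (zs_product M)" by (rule small_zs)
  show "(case x of (cs, v, ds) \<Rightarrow> tuple_end D v ds) \<in> Obj (zs_product M)" if "x \<in> tot_tuples n" for x n
  proof -
    from that obtain cs v ds w where c: "x = (cs, v, ds)" "composable D v ds w"
      by (auto simp: tot_tuples_def)
    from D.composable_Obj[OF c(2)] composable_end[OF c(2)] same_Obj show ?thesis
      by (simp add: c(1))
  qed
  show "dP (x, k) = 0" if "x \<in> tot_tuples 0" for x k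
    using that by (auto simp: tot_tuples_def dP_def hP_def vP_def vP0_def)
  show "frag_of (ptP w) \<in> free_chains (zs_product M) tot_tuples ?\<sigma> 0 w" if "w \<in> Obj (zs_product M)" for w
    unfolding chains using that same_Obj
    by (auto simp: tot_gens_iff ptP_def tot_tuples_def tuple_end_def Obj_simps)
  show "aug (dP (x, k)) = 0" if "x \<in> tot_tuples (Suc 0)" for x k
  proof -
    from that consider c v where "x = ([c], v, [])" | d v where "x = ([], v, [d])"
      by (auto simp: tot_tuples_def add_is_1 length_Suc_conv)
    then show ?thesis
      by cases (auto simp: dP_def hP_def vP_def vP0_def bar_Cons frag_linear frag_map_map)
  qed
  fix x k n assume x: "x \<in> tot_tuples n" "k \<in> Arr (zs_product M)" "rng (zs_product M) k = ?\<sigma> x"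
  then have t: "(x, k) \<in> tot_gens (src (zs_product M) k) n" by (simp add: tot_gens_iff)
  show "frag_extend dP (dP (x, k)) = 0"
    using tot_dP_dP[of "frag_of (x, k)"] t by auto
  show "SP (x, k) \<in> free_chains (zs_product M) tot_tuples ?\<sigma> (Suc n) (src (zs_product M) k)"
    using SP_tot[OF t] by (simp add: chains)
  show "dP (x, cmp (zs_product M) k h) = right_mult (zs_product M) h (dP (x, k))"
    if "h \<in> Arr (zs_product M)" "src (zs_product M) k = rng (zs_product M) h" for h
    using t right_mult_hP right_mult_vP that
    by (elim tot_gensE) (simp add: dP_def right_mult_def frag_linear)
next
  let ?\<sigma> = "\<lambda>(cs, v, ds). tuple_end D v ds"
  fix x k n assume x: "x \<in> tot_tuples (Suc n)" "k \<in> Arr (zs_product M)" "rng (zs_product M) k = ?\<sigma> x"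
  then have t: "(x, k) \<in> tot_gens (src (zs_product M) k) (Suc n)" by (simp add: tot_gens_iff)
  show "dP (x, k) \<in> free_chains (zs_product M) tot_tuples ?\<sigma> n (src (zs_product M) k)"
    using dP_keys[OF t] unfolding free_chains_def by (auto simp: tot_gens_iff)
  show "frag_extend dP (SP (x, k)) + frag_extend SP (dP (x, k)) = frag_of (x, k)"
    using dP_SP[OF t] by simp
next
  let ?\<sigma> = "\<lambda>(cs, v, ds). tuple_end D v ds"
  fix x k assume x: "x \<in> tot_tuples 0" "k \<in> Arr (zs_product M)" "rng (zs_product M) k = ?\<sigma> x"
  then have t: "(x, k) \<in> tot_gens (src (zs_product M) k) 0" by (simp add: tot_gens_iff)
  have "dP (x, k) = 0"
    using x(1) by (auto simp: tot_tuples_def dP_def hP_def vP_def vP0_def)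
  then show "frag_extend dP (SP (x, k)) = frag_of (x, k) - frag_of (ptP (src (zs_product M) k))"
    using dP_SP[OF t] by simp
qed

end

section \<open>Comparison of the total complex with the categorical complex\<close>

context small_category
begin

text \<open>Forgetting \<open>k\<close> turns the multiplication of the last entry into
  \<open>k\<close> into the deletion of that entry; the other faces are already those of the
  categorical complex.\<close>

lemma cat_boundary_bar_res:
  "frag_map fst (bar_res ((v, ms), k)) = cat_boundary K (frag_of (v, ms))"
proof (cases "ms = []")
  case True
  then show ?thesis by (simp add: bar_res_def cat_boundary_def)
next
  case False
  have "frag_map fst (bar_res ((v, ms), k)) = frag_map (\<lambda>(v, ms, k). (v, ms)) (bar K (\<lambda>_. src K) (cmp K) (v, ms, k))"
    by (simp add: bar_res_def frag_map_map case_prod_unfold)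
  also have "\<dots> = frag_of (src K (hd ms), tl ms) +
      frag_map (\<lambda>x. (v, fst x)) (bar_inner K (cmp K) ms k)"
    using False by (simp add: bar_def frag_linear frag_map_map case_prod_unfold)
  also have "frag_map (\<lambda>x. (v, fst x)) (bar_inner K (cmp K) ms k) =
      (\<Sum>i\<in>{1..<length ms}. frag_cmul ((-1) ^ i) (frag_of (v, merge K i ms)))
      + frag_cmul ((-1) ^ length ms) (frag_of (v, butlast ms))"
    by (simp add: bar_inner_sum[OF False] frag_linear frag_map_def frag_extend_sum o_def)
  finally show ?thesis
    using False by (simp add: cat_boundary_def add.assoc)
qed

lemma cat_chains_tuples:
  "carrier (cat_chains K (int n)) = {z. Poly_Mapping.keys z \<subseteq> cat_tuples n}"
proof -
  have "{(v, ms). int (length ms) = int n \<and> (\<exists>w. composable K v ms w)} = cat_tuples n"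
    by (auto simp: cat_tuples_def)
  then show ?thesis by (auto simp: cat_chains_def)
qed

lemma cat_chains_neg: "n < 0 \<Longrightarrow> carrier (cat_chains K n) = {0}"
proof -
  assume "n < 0"
  then have e: "{(v, ms). int (length ms) = n \<and> (\<exists>w. composable K v ms w)} = {}" by auto
  show ?thesis unfolding cat_chains_def e by (auto simp: free_Abelian_group_def)
qed

lemma cat_boundary_zero [simp]: "cat_boundary K 0 = 0"
  by (simp add: cat_boundary_def)

text \<open>Inherited from the bar resolution by forgetting \<open>k\<close>. Negative degrees are
  treated apart, as the complex is indexed by integers and the resolution by natural
  numbers.\<close>

lemma cat_boundary_chain_complex:
  assumes "z \<in> carrier (cat_chains K n)"
  shows "cat_boundary K z \<in> carrier (cat_chains K (n - 1)) \<and> cat_boundary K (cat_boundary K z) = 0"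
proof (cases "n < 0")
  case True
  then show ?thesis using assms by (simp add: cat_chains_neg)
next
  case False
  interpret R: free_resolution K cat_tuples "\<lambda>(v, ms). tuple_end K v ms" bar_res by (rule bar_resolution)
  have q: "frag_extend R.qbd z = cat_boundary K z" for z
  proof -
    have "R.qbd = (\<lambda>x. cat_boundary K (frag_of x))"
      using cat_boundary_bar_res by (auto simp: R.qbd_def fun_eq_iff)
    then show ?thesis by (simp add: cat_boundary_def)
  qed
  obtain m where n: "n = int m" using False by (metis nonneg_int_cases not_less)
  have gen: "cat_boundary K (frag_of x) \<in> carrier (cat_chains K (n - 1)) \<and> cat_boundary K (cat_boundary K (frag_of x)) = 0"
    if x: "x \<in> cat_tuples m" for x
  proof (cases m)
    case 0
    then have "cat_boundary K (frag_of x) = 0" using x by (auto simp: cat_tuples_def cat_boundary_def)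
    then show ?thesis by (simp add: n 0 cat_chains_neg)
  next
    case (Suc k)
    let ?c = "frag_of (x, ident K (case x of (v, ms) \<Rightarrow> tuple_end K v ms))"
    have c: "?c \<in> R.res_chains m (case x of (v, ms) \<Rightarrow> tuple_end K v ms)" using R.gen_chains[OF x] .
    have b: "frag_extend bar_res ?c \<in> R.res_chains k (case x of (v, ms) \<Rightarrow> tuple_end K v ms)"
      using R.bd_chains c unfolding Suc by blast
    have e: "cat_boundary K (frag_of x) = frag_map fst (frag_extend bar_res ?c)"
      using R.fst_bd[OF c] q[of "frag_of x"] by simp
    have "frag_extend bar_res (frag_extend bar_res ?c) = 0"
      using R.bd_bd[OF x ident_Arr rng_ident] R.\<sigma>_Obj[OF x] by simp
    moreover have "cat_boundary K (frag_map fst (frag_extend bar_res ?c)) =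
        frag_map fst (frag_extend bar_res (frag_extend bar_res ?c))"
      using R.fst_bd[OF b] unfolding q by (rule sym)
    ultimately have "cat_boundary K (cat_boundary K (frag_of x)) = 0"
      unfolding e by simp
    moreover have "cat_boundary K (frag_of x) \<in> carrier (cat_chains K (n - 1))"
      using R.fst_chains[OF b] cat_chains_tuples[of k] unfolding e by (simp add: n Suc)
    ultimately show ?thesis by blast
  qed
  have lin: "cat_boundary K (a - b) = cat_boundary K a - cat_boundary K b" for a b
    by (simp add: cat_boundary_def frag_linear)
  have "Poly_Mapping.keys z \<subseteq> cat_tuples m" using assms cat_chains_tuples by (auto simp: n)
  then show ?thesis
  proof (induction rule: frag_induction)
    case (diff a b)
    then show ?case unfolding lin by (simp add: cat_chains_def keys_diff_subset)
  qed (use gen in \<open>auto simp: cat_chains_def\<close>)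
qed

lemmas cat_boundary_chains = conjunct1[OF cat_boundary_chain_complex]
lemmas cat_boundary_squared = conjunct2[OF cat_boundary_chain_complex]

end

context matched_pair
begin

section \<open>The matched complex as a quotient of the resolution\<close>

abbreviation actC0 :: "'c \<Rightarrow> 'o \<times> 'd list \<Rightarrow> 'o \<times> 'd list" where
  "actC0 \<equiv> \<lambda>c (v, ds). (rng C c, ltup c ds)"

lemma dh_hP:
  assumes "((cs, v, ds), k) \<in> gens w p q"
  shows "frag_map fst (hP ((cs, v, ds), k)) = dh M (frag_of (cs, v, ds))"
proof (cases "cs = []")
  case True
  then show ?thesis by (simp add: hP_def dh_def)
next
  case False
  obtain u where u: "composable C u cs (fst (v, ds, k))" "(v, ds, k) \<in> YC w"
    using assms by (auto simp: gens_def)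
  have last: "last cs \<in> Arr C \<and> src C (last cs) = v"
    using u(1) False by (induction cs arbitrary: u) (auto split: if_splits)
  have "frag_map (\<lambda>(a, cs, y). (a, cs, (\<lambda>(v, ds, k). (v, ds)) y)) (bar C (\<lambda>_ _. ()) actC ((), cs, v, ds, k)) =
    bar C (\<lambda>_ _. ()) actC0 ((), cs, (\<lambda>(v, ds, k). (v, ds)) (v, ds, k))"
    by (rule bar_natural_map[OF left_action_C u]) (auto simp: actC_def)
  from arg_cong[OF this, of "frag_map (\<lambda>(_, cs, v, ds). (cs, v, ds))"]
  have "frag_map fst (hP ((cs, v, ds), k)) =
    frag_map (\<lambda>(_, cs, v, ds). (cs, v, ds)) (bar C (\<lambda>_ _. ()) actC0 ((), cs, v, ds))"
    by (simp add: hP_def frag_map_map case_prod_unfold)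
  also have "\<dots> = frag_of (tl cs, v, ds) + frag_map (\<lambda>(cs, v, ds). (cs, v, ds)) (bar_inner C actC0 cs (v, ds))"
    using False by (simp add: bar_def frag_linear frag_map_map case_prod_unfold)
  also have "bar_inner C actC0 cs (v, ds) =
      (\<Sum>i\<in>{1..<length cs}. frag_cmul ((-1) ^ i) (frag_of (merge C i cs, v, ds)))
      + frag_cmul ((-1) ^ length cs) (frag_of (butlast cs, rng C (last cs), lact_tuple M (last cs) ds))"
    using lact_tuple_eq[of v ds "rng (zs_product M) k" "last cs"] last u(2)
    by (simp add: bar_inner_sum[OF False] YC_def case_prod_unfold)
  finally show ?thesis
    using False by (simp add: dh_def C_def add.assoc frag_linear)
qed

text \<open>The column boundary with trivial coefficients and without the sign
  \<open>(-1) ^ p\<close>: the unit in place of \<open>k\<close> makes the absorption of the last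
  entry a deletion.\<close>

definition colb :: "('c list \<times> 'o) \<times> 'd list \<times> unit \<Rightarrow> (('c list \<times> 'o) \<times> 'd list \<times> unit \<Rightarrow>\<^sub>0 int)" where
  "colb = bar D ractD (\<lambda>_ u. u)"

abbreviation colb_tup :: "('c list \<times> 'o) \<times> 'd list \<times> unit \<Rightarrow> ('o, 'c, 'd) bitup" where
  "colb_tup \<equiv> \<lambda>((cs, v), ds, _). (cs, v, ds)"

lemma dv_colb:
  assumes "composable C u cs v" "composable D v ds w"
  shows "dv M (frag_of (cs, v, ds)) =
    frag_cmul ((-1) ^ length cs) (frag_map colb_tup (colb ((cs, v), ds, ())))"
proof (cases "ds = []")
  case True
  then show ?thesis by (simp add: dv_def colb_def)
next
  case False
  have "frag_map colb_tup (colb ((cs, v), ds, ())) =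
     frag_of (rtup cs (hd ds), src D (hd ds), tl ds) + frag_map (\<lambda>x. (cs, v, fst x)) (bar_inner D (\<lambda>_ u. u) ds ())"
    using False by (simp add: colb_def bar_def ractD_def frag_linear frag_map_map case_prod_unfold)
  also have "rtup cs (hd ds) = ract_tuple M cs (hd ds)"
    using assms False by (cases ds) (auto simp: ract_tuple_eq)
  also have "frag_map (\<lambda>x. (cs, v, fst x)) (bar_inner D (\<lambda>_ u. u) ds ()) =
      (\<Sum>i\<in>{1..<length ds}. frag_cmul ((-1) ^ i) (frag_of (cs, v, merge D i ds)))
      + frag_cmul ((-1) ^ length ds) (frag_of (cs, v, butlast ds))"
    by (simp add: bar_inner_sum[OF False] frag_linear frag_map_def frag_extend_sum o_def)
  finally show ?thesis
    using False by (simp add: dv_def D_def add.assoc)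
qed

lemma dv_vP:
  assumes "((cs, v, ds), k) \<in> gens w p q"
  shows "frag_map fst (vP ((cs, v, ds), k)) = dv M (frag_of (cs, v, ds))"
proof -
  interpret B: two_sided D "YD w" "rng (zs_product M)" dk AD ractD by (rule columns)
  from assms have "((cs, v), ds, k) \<in> B.bar_tuples"
    unfolding gens_columns by auto
  then obtain u where comp: "composable D v ds (rng (zs_product M) k)" "k \<in> YD w" "composable C u cs v"
    unfolding B.bar_tuples_def by (auto simp: AD_def)
  have "frag_map (\<lambda>(a, ms, k). (a, ms, ())) (bar D ractD dk ((cs, v), ds, k)) = colb ((cs, v), ds, ())"
    unfolding colb_def by (rule bar_natural_map[OF B.left_action_axioms comp(1,2)]) simp
  from arg_cong[OF this, of "frag_map colb_tup"]
  have "frag_map fst (vP0 ((cs, v, ds), k)) = frag_map colb_tup (colb ((cs, v), ds, ()))"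
    by (simp add: vP0_def frag_map_map case_prod_unfold)
  then show ?thesis
    using dv_colb[OF comp(3,1)] by (simp add: vP_def frag_linear)
qed

lemma dh_ext: "dh M z = frag_extend (\<lambda>x. dh M (frag_of x)) z"
  and dv_ext: "dv M z = frag_extend (\<lambda>x. dv M (frag_of x)) z"
  unfolding dh_def dv_def by simp_all

lemma dh_linear [simp]: "dh M 0 = 0" "dh M (a + b) = dh M a + dh M b" "dh M (- a) = - dh M a"
    "dh M (a - b) = dh M a - dh M b" "dh M (frag_cmul c a) = frag_cmul c (dh M a)"
  and dv_linear [simp]: "dv M 0 = 0" "dv M (a + b) = dv M a + dv M b" "dv M (- a) = - dv M a"
    "dv M (a - b) = dv M a - dv M b" "dv M (frag_cmul c a) = frag_cmul c (dv M a)"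
  unfolding dh_def dv_def by (simp_all add: frag_linear)

lemma dh_fst:
  assumes "Poly_Mapping.keys z \<subseteq> gens w p q"
  shows "dh M (frag_map fst z) = frag_map fst (frag_extend hP z)"
  using assms
proof (induction rule: frag_induction)
  case (one x)
  then show ?case by (cases x) (auto simp: dh_hP)
qed (auto simp: frag_linear)

lemma dv_fst:
  assumes "Poly_Mapping.keys z \<subseteq> gens w p q"
  shows "dv M (frag_map fst z) = frag_map fst (frag_extend vP z)"
  using assms
proof (induction rule: frag_induction)
  case (one x)
  then show ?case by (cases x) (auto simp: dv_vP)
qed (auto simp: frag_linear)

lemma bituples_eq:
  "bituples M p q = {(cs, v, ds). int (length cs) = p \<and> int (length ds) = q \<and>
     (\<exists>u. composable C u cs v) \<and> (\<exists>w. composable D v ds w)}"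
  by (simp add: bituples_def C_def D_def)

text \<open>The lift uses the identity at the end of \<open>ds\<close> as coefficient. It allows
  facts about \<open>dh\<close> and \<open>dv\<close> to be proved in the resolution.\<close>

lemma bituples_gens:
  assumes "x \<in> bituples M p q"
  obtains w k where "(x, k) \<in> gens w (nat p) (nat q)"
proof -
  from assms obtain cs v ds w where x: "x = (cs, v, ds)" "int (length cs) = p" "int (length ds) = q"
    "\<exists>u. composable C u cs v" "composable D v ds w"
    unfolding bituples_eq by blast
  then have "w \<in> Obj D" using D.composable_Obj by blast
  with x have "(x, ident D w, ident C w) \<in> gens w (nat p) (nat q)"
    by (auto simp: gens_def YC_def Obj_simps)
  then show ?thesis by (rule that)
qed

lemma gens_bituples: "y \<in> gens w p q \<Longrightarrow> fst y \<in> bituples M (int p) (int q)"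
  by (auto simp: gens_def YC_def bituples_eq)

lemma bituples_nonneg: "x \<in> bituples M p q \<Longrightarrow> p \<ge> 0 \<and> q \<ge> 0"
  by (auto simp: bituples_def)

lemma dh_keys:
  assumes "x \<in> bituples M p q"
  shows "Poly_Mapping.keys (dh M (frag_of x)) \<subseteq> bituples M (p - 1) q"
proof -
  obtain w k where g: "(x, k) \<in> gens w (nat p) (nat q)" using bituples_gens[OF assms] by blast
  have "dh M (frag_of x) = frag_map fst (hP (x, k))"
    using g dh_hP by (cases x) auto
  then show ?thesis
    using hP_keys[OF g] gens_bituples bituples_nonneg[OF assms]
    by (fastforce dest!: keys_frag_mapD simp: of_nat_diff)
qed

lemma dv_keys:
  assumes "x \<in> bituples M p q"
  shows "Poly_Mapping.keys (dv M (frag_of x)) \<subseteq> bituples M p (q - 1)"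
proof -
  obtain w k where g: "(x, k) \<in> gens w (nat p) (nat q)" using bituples_gens[OF assms] by blast
  have "dv M (frag_of x) = frag_map fst (vP (x, k))"
    using g dv_vP by (cases x) auto
  then show ?thesis
    using vP_keys[OF g] gens_bituples bituples_nonneg[OF assms]
    by (fastforce dest!: keys_frag_mapD simp: of_nat_diff)
qed

lemma dh_Cpq: "z \<in> carrier (Cpq M p q) \<Longrightarrow> dh M z \<in> carrier (Cpq M (p - 1) q)"
  unfolding Cpq_def carrier_free_Abelian_group_iff dh_ext[of z]
  by (intro keys_frag_extend_subset dh_keys) auto

lemma dv_Cpq: "z \<in> carrier (Cpq M p q) \<Longrightarrow> dv M z \<in> carrier (Cpq M p (q - 1))"
  unfolding Cpq_def carrier_free_Abelian_group_iff dv_ext[of z]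
  by (intro keys_frag_extend_subset dv_keys) auto

text \<open>The identities hold for a lift to the resolution and survive forgetting
  \<open>k\<close>, so the faces with the tuple actions are not computed again.\<close>

lemma double_complex_gen:
  assumes "x \<in> bituples M p q"
  shows "dh M (dh M (frag_of x)) = 0" "dv M (dv M (frag_of x)) = 0"
    "dh M (dv M (frag_of x)) + dv M (dh M (frag_of x)) = 0"
proof -
  obtain w k where g: "(x, k) \<in> gens w (nat p) (nat q)" using bituples_gens[OF assms] by blast
  have x: "dh M (frag_of x) = frag_map fst (hP (x, k))" "dv M (frag_of x) = frag_map fst (vP (x, k))"
    using g dh_hP dv_vP by (cases x; auto)+
  have k: "Poly_Mapping.keys (hP (x, k)) \<subseteq> gens w (nat p - 1) (nat q)"
    "Poly_Mapping.keys (vP (x, k)) \<subseteq> gens w (nat p) (nat q - 1)"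
    using hP_keys[OF g] vP_keys[OF g] by auto
  show "dh M (dh M (frag_of x)) = 0"
    unfolding x dh_fst[OF k(1)] hP_hP[OF g] by simp
  show "dv M (dv M (frag_of x)) = 0"
    unfolding x dv_fst[OF k(2)] vP_vP[OF g] by simp
  show "dh M (dv M (frag_of x)) + dv M (dh M (frag_of x)) = 0"
    unfolding x dv_fst[OF k(1)] dh_fst[OF k(2)] using hP_vP[OF g] by (simp flip: frag_map_add)
qed

section \<open>The total complex and its homology\<close>

definition total_bituples :: "int \<Rightarrow> ('o, 'c, 'd) bitup set" where
  "total_bituples n = {(cs, v, ds). int (length cs) + int (length ds) = n \<and>
     (\<exists>u. composable C u cs v) \<and> (\<exists>w. composable D v ds w)}"

lemma total_bituples_Un: "total_bituples n = (\<Union>p. bituples M p (n - p))"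
  by (auto simp: total_bituples_def bituples_eq)

lemma double_complex:
  assumes "Poly_Mapping.keys z \<subseteq> total_bituples n"
  shows "dh M (dh M z) = 0" "dv M (dv M z) = 0" "dh M (dv M z) = - dv M (dh M z)"
proof -
  have "dh M (dh M z) = 0 \<and> dv M (dv M z) = 0 \<and> dh M (dv M z) = - dv M (dh M z)"
    using assms
  proof (induction rule: frag_induction)
    case (one x)
    then obtain p where "x \<in> bituples M p (n - p)" by (auto simp: total_bituples_Un)
    from double_complex_gen[OF this] show ?case by (simp add: eq_neg_iff_add_eq_0)
  qed auto
  then show "dh M (dh M z) = 0" "dv M (dv M z) = 0" "dh M (dv M z) = - dv M (dh M z)" by auto
qed

definition tot_cycles :: "int \<Rightarrow> (('o, 'c, 'd) bitup \<Rightarrow>\<^sub>0 int) set" where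
  "tot_cycles n = {z. Poly_Mapping.keys z \<subseteq> total_bituples n \<and> dh M z + dv M z = 0}"

definition tot_boundaries :: "int \<Rightarrow> (('o, 'c, 'd) bitup \<Rightarrow>\<^sub>0 int) set" where
  "tot_boundaries n = (\<lambda>z. dh M z + dv M z) ` {z. Poly_Mapping.keys z \<subseteq> total_bituples (n + 1)}"

definition zs_cycles :: "int \<Rightarrow> ('o \<times> ('d \<times> 'c) list \<Rightarrow>\<^sub>0 int) set" where
  "zs_cycles n = {z \<in> carrier (cat_chains (zs_product M) n). cat_boundary (zs_product M) z = 0}"

definition zs_boundaries :: "int \<Rightarrow> ('o \<times> ('d \<times> 'c) list \<Rightarrow>\<^sub>0 int) set" where
  "zs_boundaries n = cat_boundary (zs_product M) ` carrier (cat_chains (zs_product M) (n + 1))"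

theorem total_quasi_isomorphism:
  "\<exists>\<Phi>. (\<forall>n z z'. \<Phi> n (z + z') = \<Phi> n z + \<Phi> n z') \<and>
     (\<forall>n. \<forall>z\<in>tot_cycles n. \<Phi> n z \<in> zs_cycles n \<and> (\<Phi> n z \<in> zs_boundaries n \<longleftrightarrow> z \<in> tot_boundaries n)) \<and>
     (\<forall>n. \<forall>y\<in>zs_cycles n. \<exists>z\<in>tot_cycles n. y - \<Phi> n z \<in> zs_boundaries n)"
proof -
  interpret Q: resolution_triple "zs_product M" tot_tuples "\<lambda>(cs, v, ds). tuple_end D v ds" dP
    K.cat_tuples "\<lambda>(v, ms). tuple_end (zs_product M) v ms" K.bar_res
    by (intro resolution_triple.intro resolution_pair.intro tot_resolution K.bar_resolution)
  have T: "total_bituples (int n) = tot_tuples n" "total_bituples (int n + 1) = tot_tuples (Suc n)" for n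
    by (auto simp: total_bituples_def tot_tuples_def)
  have K: "carrier (cat_chains (zs_product M) (int n)) = {z. Poly_Mapping.keys z \<subseteq> K.cat_tuples n}"
      "carrier (cat_chains (zs_product M) (int n + 1)) = {z. Poly_Mapping.keys z \<subseteq> K.cat_tuples (Suc n)}" for n
    using K.cat_chains_tuples[of n] K.cat_chains_tuples[of "Suc n"] by (simp_all add: add.commute)
  have qR: "frag_extend Q.RS.R.qbd z = dh M z + dv M z" if "Poly_Mapping.keys z \<subseteq> tot_tuples n" for z n
  proof -
    have "Q.RS.R.qbd x = dh M (frag_of x) + dv M (frag_of x)" if x: "x \<in> tot_tuples n" for x
    proof -
      obtain cs v ds where xe: "x = (cs, v, ds)" by (metis prod.exhaust)
      let ?w = "tuple_end D v ds"
      have "?w \<in> Obj D"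
        using x composable_end[of D v ds] D.composable_Obj[of v ds] by (auto simp: xe tot_tuples_def)
      then have "(x, ident (zs_product M) ?w) \<in> tot_gens ?w n"
        using x by (simp add: tot_gens_iff xe Obj_simps same_Obj)
      then obtain p q where g: "(x, ident (zs_product M) ?w) \<in> gens ?w p q" by (rule tot_gensE)
      show ?thesis
        using dh_hP[OF g[unfolded xe]] dv_vP[OF g[unfolded xe]]
        by (simp add: Q.RS.R.qbd_def dP_def frag_linear xe del: zs_simps)
    qed
    then have "frag_extend Q.RS.R.qbd z = frag_extend (\<lambda>x. dh M (frag_of x) + dv M (frag_of x)) z"
      using that by (intro frag_extend_eq) auto
    then show ?thesis
      by (simp add: frag_extend_plus_fun dh_ext[of z] dv_ext[of z])
  qed
  have qS: "frag_extend Q.RS.S.qbd z = cat_boundary (zs_product M) z" for z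
  proof -
    have "Q.RS.S.qbd = (\<lambda>x. cat_boundary (zs_product M) (frag_of x))"
      using K.cat_boundary_bar_res by (auto simp: Q.RS.S.qbd_def fun_eq_iff)
    then show ?thesis
      by (simp add: cat_boundary_def)
  qed
  have RZ: "tot_cycles (int n) = Q.RS.R.qcycles n" "tot_boundaries (int n) = Q.RS.R.qboundaries n" for n
    by (auto simp: tot_cycles_def tot_boundaries_def Q.RS.R.qcycles_def Q.RS.R.qboundaries_def T qR image_def)
  have SZ: "zs_cycles (int n) = Q.RS.S.qcycles n" "zs_boundaries (int n) = Q.RS.S.qboundaries n" for n
    unfolding zs_cycles_def zs_boundaries_def Q.RS.S.qcycles_def Q.RS.S.qboundaries_def K qS by auto
  obtain \<Phi> where \<Phi>: "\<And>n z z'. \<Phi> n (z + z') = \<Phi> n z + \<Phi> n z'"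
     "\<And>n z. z \<in> Q.RS.R.qcycles n \<Longrightarrow> \<Phi> n z \<in> Q.RS.S.qcycles n \<and> (\<Phi> n z \<in> Q.RS.S.qboundaries n \<longleftrightarrow> z \<in> Q.RS.R.qboundaries n)"
     "\<And>n y. y \<in> Q.RS.S.qcycles n \<Longrightarrow> \<exists>z\<in>Q.RS.R.qcycles n. y - \<Phi> n z \<in> Q.RS.S.qboundaries n"
    using Q.quasi_isomorphism by blast
  \<comment> \<open>The resolutions are indexed by natural numbers. For negative \<open>n\<close>
    the comparison map at \<open>nat n = 0\<close> is used, but only at the zero chain.\<close>
  have neg: "tot_cycles n = {0}" "zs_cycles n = {0}" "0 \<in> zs_boundaries n" "0 \<in> tot_boundaries n" if "n < 0" for n
  proof -
    have "total_bituples n = {}"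
      using that by (auto simp: total_bituples_def)
    then show "tot_cycles n = {0}"
      by (auto simp: tot_cycles_def)
    show "zs_cycles n = {0}"
      unfolding zs_cycles_def K.cat_chains_neg[OF that] using K.cat_boundary_zero by blast
    show "0 \<in> zs_boundaries n" "0 \<in> tot_boundaries n"
      unfolding zs_boundaries_def tot_boundaries_def
      by (rule image_eqI[of _ _ 0]; simp add: cat_boundary_def cat_chains_def)+
  qed
  have \<Phi>0: "\<Phi> n 0 = 0" for n using \<Phi>(1)[of n 0 0] by simp
  show ?thesis
  proof (intro exI[of _ "\<lambda>n. \<Phi> (nat n)"] conjI allI ballI)
    fix n z z' show "\<Phi> (nat n) (z + z') = \<Phi> (nat n) z + \<Phi> (nat n) z'" by (rule \<Phi>(1))
  next
    fix n z assume z: "z \<in> tot_cycles n"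
    show "\<Phi> (nat n) z \<in> zs_cycles n" "\<Phi> (nat n) z \<in> zs_boundaries n \<longleftrightarrow> z \<in> tot_boundaries n"
      using z \<Phi>(2)[of z "nat n"] neg[of n] \<Phi>0 RZ[of "nat n"] SZ[of "nat n"] by (cases "n < 0"; auto)+
  next
    fix n y assume y: "y \<in> zs_cycles n"
    show "\<exists>z\<in>tot_cycles n. y - \<Phi> (nat n) z \<in> zs_boundaries n"
      using y \<Phi>(3)[of y "nat n"] neg[of n] \<Phi>0 RZ[of "nat n"] SZ[of "nat n"] by (cases "n < 0") auto
  qed
qed

end

section \<open>Contracting the columns for path categories\<close>

locale path_matched_pair = matched_pair M
  for M :: "('v, 'c, ('v, 'e) path) matched_data" +
  fixes E :: "('v, 'e) pre_digraph"
  assumes rcat_path: "rcat M = path_category E"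
begin

lemma path_simps [simp]:
  "Obj D = verts E" "(v, es) \<in> Arr D \<longleftrightarrow> is_path E v es" "rng D \<alpha> = fst \<alpha>"
  "ident D v = (v, [])" "cmp D \<alpha> \<beta> = (fst \<alpha>, snd \<alpha> @ snd \<beta>)"
  "src D (v, es) = (if es = [] then v else tail E (last es))"
  by (simp_all add: D_def rcat_path path_category_def path_vertex_def path_length_def last_conv_nth)

lemma is_path_verts: "is_path E v es \<Longrightarrow> v \<in> verts E"
proof -
  assume "is_path E v es"
  then have "rng D (v, es) \<in> Obj D" by (intro D.rng_Obj) simp
  then show ?thesis by simp
qed

lemma rtup_ident: "composable C u cs v \<Longrightarrow> rtup cs (v, []) = cs \<and> foldr (\<triangleright>) cs (v, []) = (u, [])"
proof (induction cs arbitrary: u)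
  case (Cons c cs)
  then have "composable C (src C c) cs v" "c \<in> Arr C" "rng C c = u" by auto
  with Cons.IH[of "src C c"] show ?case
    using ract_ident[of c] lact_ident[of c] by simp
qed simp

lemma ractD_ident: "(a, v) \<in> AD \<Longrightarrow> ractD a (v, []) = a"
  using rtup_ident by (auto simp: AD_def ractD_def)

lemma ractD_AD: "(a, v) \<in> AD \<Longrightarrow> is_path E v es \<Longrightarrow> (ractD a (v, es), src D (v, es)) \<in> AD"
  using two_sided.ract_closed[OF columns, of "(v, es)" a] by simp

lemma ractD_append:
  assumes "(a, v) \<in> AD" "is_path E v es" "is_path E (src D (v, es)) es'"
  shows "ractD a (v, es @ es') = ractD (ractD a (v, es)) (src D (v, es), es')"
  using two_sided.ract_cmp[OF columns, of "(v, es)" "(src D (v, es), es')" a] assms by simp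

lemma ractD_Cons:
  assumes "(a, v) \<in> AD" "is_path E v (e # es)"
  shows "ractD a (v, e # es) = ractD (ractD a (v, [e])) (tail E e, es)"
  using ractD_append[of a v "[e]" es] assms is_path_verts[of "tail E e" es] by simp

lemma ractD_edge:
  assumes "(a, v) \<in> AD" "is_path E v (e # es)"
  shows "(ractD a (v, [e]), tail E e) \<in> AD"
  using ractD_AD[of a v "[e]"] assms is_path_verts[of "tail E e" es] by simp

text \<open>
  The sum of \<open>f (a \<triangleleft> \<alpha>') e \<alpha>''\<close> over all factorisations \<open>\<alpha>' e \<alpha>''\<close> of a path with \<open>e\<close> an edge,
  where the last one, with \<open>\<alpha>''\<close> of length 0, is left out unless \<open>b\<close> holds.
\<close>

fun split_sum :: "bool \<Rightarrow> ('c list \<times> 'v \<Rightarrow> ('v, 'e) path \<Rightarrow> ('v, 'e) path \<Rightarrow> ('z \<Rightarrow>\<^sub>0 int)) \<Rightarrow>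
    'c list \<times> 'v \<Rightarrow> 'v \<Rightarrow> 'e list \<Rightarrow> ('z \<Rightarrow>\<^sub>0 int)" where
  "split_sum b f a v [] = 0"
| "split_sum b f a v (e # es) = (if es = [] \<and> \<not> b then 0 else f a (v, [e]) (tail E e, es))
     + split_sum b f (ractD a (v, [e])) (tail E e) es"

text \<open>The summand by which the two versions of \<open>split_sum\<close> differ: the last edge,
  with the terminal vertex as remainder.\<close>

fun last_split :: "('c list \<times> 'v \<Rightarrow> ('v, 'e) path \<Rightarrow> ('v, 'e) path \<Rightarrow> ('z \<Rightarrow>\<^sub>0 int)) \<Rightarrow>
    'c list \<times> 'v \<Rightarrow> 'v \<Rightarrow> 'e list \<Rightarrow> ('z \<Rightarrow>\<^sub>0 int)" where
  "last_split f a v [] = 0"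
| "last_split f a v (e # es) = (if es = [] then f a (v, [e]) (tail E e, [])
     else last_split f (ractD a (v, [e])) (tail E e) es)"

lemma split_sum_last: "split_sum True f a v es = split_sum False f a v es + last_split f a v es"
  by (induction f a v es rule: last_split.induct) (auto simp: add.assoc)

lemma frag_extend_split_sum:
  "frag_extend g (split_sum b f a v es) = split_sum b (\<lambda>a e \<gamma>. frag_extend g (f a e \<gamma>)) a v es"
  by (induction es arbitrary: a v) (auto simp: frag_linear)

lemma split_sum_plus:
  "split_sum b (\<lambda>a e \<gamma>. f a e \<gamma> + g a e \<gamma>) a v es = split_sum b f a v es + split_sum b g a v es"
  by (induction es arbitrary: a v) (auto simp: algebra_simps)

lemma split_sum_minus: "split_sum b (\<lambda>a e \<gamma>. - f a e \<gamma>) a v es = - split_sum b f a v es"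
  by (induction es arbitrary: a v) auto

text \<open>The product rule of the Fox derivative: an edge lies in the first path, its remainder
  prolonged by the second, or in the second path, after \<open>a\<close> has been moved past the
  first. For \<open>b\<close> false and \<open>es'\<close> empty the last edge of \<open>es\<close>
  would be missing on the left only.\<close>

lemma split_sum_append:
  assumes "(a, v) \<in> AD" "is_path E v es" "b \<or> es' \<noteq> []"
  shows "split_sum b f a v (es @ es') =
    split_sum True (\<lambda>a e \<gamma>. f a e (fst \<gamma>, snd \<gamma> @ es')) a v es
    + split_sum b f (ractD a (v, es)) (src D (v, es)) es'"
  using assms
proof (induction es arbitrary: a v)
  case Nil
  then show ?case by (simp add: ractD_ident)
next
  case (Cons e es)
  have ae: "(ractD a (v, [e]), tail E e) \<in> AD" "is_path E (tail E e) es"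
    using ractD_edge[OF Cons.prems(1,2)] Cons.prems(2) by auto
  show ?case
    using Cons.IH[OF ae Cons.prems(3)] Cons.prems ractD_Cons[of a v e es]
    by (auto simp: algebra_simps)
qed

text \<open>The fundamental formula of the Fox calculus. The remainder after an edge is the next
  edge followed by its own remainder, so the positive term of each summand cancels the negative term
  of the next.\<close>

lemma split_sum_telescope:
  assumes "(a, v) \<in> AD" "is_path E v es"
  shows "split_sum True (\<lambda>a e \<gamma>. frag_of (ractD a e, \<gamma> # rest, ()) - frag_of (a, cmp D e \<gamma> # rest, ())) a v es =
    frag_of (ractD a (v, es), (src D (v, es), []) # rest, ()) - frag_of (a, (v, es) # rest, ())"
  using assms
proof (induction es arbitrary: a v)
  case Nil
  then show ?case by (simp add: ractD_ident)
next
  case (Cons e es)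
  have ae: "(ractD a (v, [e]), tail E e) \<in> AD" "is_path E (tail E e) es"
    using ractD_edge[OF Cons.prems(1,2)] Cons.prems(2) by auto
  show ?case
    using Cons.IH[OF ae] Cons.prems ractD_Cons[of a v e es] by simp
qed

lemma last_split_telescope:
  assumes "es \<noteq> []"
  shows "last_split (\<lambda>a e \<gamma>. frag_of (ractD a e, \<gamma> # rest, ()) - frag_of (a, cmp D e \<gamma> # rest, ())) a v es =
    last_split (\<lambda>a e \<gamma>. frag_of (ractD a e, \<gamma> # rest, ())) a v es
    - last_split (\<lambda>a e \<gamma>. frag_of (a, e # rest, ())) a v es"
  using assms by (induction es arbitrary: a v) auto

lemma last_split_end:
  assumes "(a, v) \<in> AD" "is_path E v es" "es \<noteq> []"
  shows "last_split (\<lambda>a e \<gamma>. frag_of (ractD a e, \<gamma> # rest, ())) a v es =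
    frag_of (ractD a (v, es), (src D (v, es), []) # rest, ())"
  using assms
proof (induction es arbitrary: a v)
  case (Cons e es)
  then show ?case
    using ractD_edge[of a v e es] ractD_Cons[of a v e es] by (cases "es = []") auto
qed simp

type_synonym ('w, 'b, 'f) col = "('b list \<times> 'w) \<times> ('w, 'f) path list \<times> unit"

definition splitT :: "bool \<Rightarrow> ('v, 'c, 'e) col \<Rightarrow> (('v, 'c, 'e) col \<Rightarrow>\<^sub>0 int)" where
  "splitT b = (\<lambda>(a, ds, _). if ds = [] then 0 else
     split_sum b (\<lambda>a e \<gamma>. frag_of (a, e # \<gamma> # tl ds, ())) a (fst (hd ds)) (snd (hd ds)))"

abbreviation bndD :: "('v, 'e) path list \<Rightarrow> (('v, 'e) path list \<times> unit \<Rightarrow>\<^sub>0 int)" where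
  "bndD ds \<equiv> bar_inner D (\<lambda>_ u. u) ds ()"

lemma colb_Cons: "colb (a, d # ds, ()) = frag_of (ractD a d, ds, ()) + frag_map (Pair a) (bndD (d # ds))"
  by (simp add: colb_def bar_Cons)

text \<open>Sorts the faces of the split tuples: \<open>t\<close> holds the first face and the
  product that undoes the splitting, \<open>f\<close> the product of the remainder with
  \<open>\<delta>\<close>, and \<open>g\<close> the faces further to the right.\<close>

lemma colb_splitT:
  fixes b \<delta> rest
  assumes "(a, v) \<in> AD" "is_path E v es"
  defines "f \<equiv> \<lambda>a e \<gamma>. frag_of (a, e # (fst \<gamma>, snd \<gamma> @ snd \<delta>) # rest, ())"
    and "g \<equiv> \<lambda>a e \<gamma>. frag_map (\<lambda>(x, u). (a, e # \<gamma> # x, u)) (bndD (\<delta> # rest))"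
    and "t \<equiv> \<lambda>a e \<gamma>. frag_of (ractD a e, \<gamma> # \<delta> # rest, ()) - frag_of (a, cmp D e \<gamma> # \<delta> # rest, ())"
  shows "frag_extend colb (splitT b (a, (v, es) # \<delta> # rest, ())) =
    split_sum b t a v es + split_sum b f a v es + split_sum b g a v es"
proof -
  have "frag_extend colb (splitT b (a, (v, es) # \<delta> # rest, ())) =
    split_sum b (\<lambda>a e \<gamma>. t a e \<gamma> + f a e \<gamma> + g a e \<gamma>) a v es"
    by (simp add: splitT_def frag_extend_split_sum colb_Cons f_def g_def t_def frag_linear frag_map_map
        apfst_def map_prod_def case_prod_unfold algebra_simps)
  then show ?thesis by (simp add: split_sum_plus)
qed

lemma splitT_map:
  "frag_extend (splitT b) (frag_map (\<lambda>(x, u). (a, (v, es) # x, u)) z) =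
    split_sum b (\<lambda>a e \<gamma>. frag_map (\<lambda>(x, u). (a, e # \<gamma> # x, u)) z) a v es"
  using subset_UNIV[of "Poly_Mapping.keys z"]
proof (induction rule: frag_induction)
  case zero
  have "split_sum b (\<lambda>a e \<gamma>. 0 :: ('v, 'c, 'e) col \<Rightarrow>\<^sub>0 int) a v es = 0"
    by (induction es arbitrary: a v) auto
  then show ?case by simp
next
  case (one x)
  then show ?case by (cases x) (simp add: splitT_def)
next
  case (diff y z)
  have "split_sum b (\<lambda>a e \<gamma>. f a e \<gamma> - g a e \<gamma>) a v es = split_sum b f a v es - split_sum b g a v es"
    for f g :: "'c list \<times> 'v \<Rightarrow> ('v, 'e) path \<Rightarrow> ('v, 'e) path \<Rightarrow> (('v, 'c, 'e) col \<Rightarrow>\<^sub>0 int)"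
    using split_sum_plus[of b f "\<lambda>a e \<gamma>. - g a e \<gamma>" a v es] by (simp add: split_sum_minus)
  with diff show ?case by (simp add: frag_linear)
qed

text \<open>By the product rule the part of the derivative of \<open>es @ snd \<delta>\<close> that
  belongs to \<open>\<delta>\<close> cancels the first face. The sum over \<open>f\<close> is
  complete even for \<open>b\<close> false, because the last edge of \<open>es\<close> is still
  followed by \<open>snd \<delta>\<close>.\<close>

lemma splitT_colb:
  fixes rest
  assumes "(a, v) \<in> AD" "is_path E v es" "fst \<delta> = src D (v, es)" "b \<or> snd \<delta> \<noteq> []"
  defines "f \<equiv> \<lambda>a e \<gamma>. frag_of (a, e # (fst \<gamma>, snd \<gamma> @ snd \<delta>) # rest, ())"
    and "g \<equiv> \<lambda>a e \<gamma>. frag_map (\<lambda>(x, u). (a, e # \<gamma> # x, u)) (bndD (\<delta> # rest))"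
  shows "frag_extend (splitT b) (colb (a, (v, es) # \<delta> # rest, ())) =
    - split_sum True f a v es - split_sum b g a v es"
proof -
  have "frag_extend (splitT b) (colb (a, (v, es) # \<delta> # rest, ())) =
    splitT b (ractD a (v, es), \<delta> # rest, ()) - splitT b (a, (v, es @ snd \<delta>) # rest, ())
    - frag_extend (splitT b) (frag_map (\<lambda>(x, u). (a, (v, es) # x, u)) (bndD (\<delta> # rest)))"
    by (simp add: colb_Cons frag_linear frag_map_map apfst_def map_prod_def case_prod_unfold)
  also have "frag_extend (splitT b) (frag_map (\<lambda>(x, u). (a, (v, es) # x, u)) (bndD (\<delta> # rest))) =
      split_sum b g a v es"
    unfolding g_def by (rule splitT_map)
  also have "splitT b (a, (v, es @ snd \<delta>) # rest, ()) =
      split_sum True f a v es + splitT b (ractD a (v, es), \<delta> # rest, ())"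
    using split_sum_append[OF assms(1,2,4), of "\<lambda>a e \<gamma>. frag_of (a, e # \<gamma> # rest, ())"]
    by (simp add: splitT_def f_def assms(3) del: path_simps(6))
  finally show ?thesis by simp
qed

text \<open>The sums over \<open>f\<close> and \<open>g\<close> cancel and the telescope leaves its
  two ends. The end that starts with an identity is the defect to be removed by
  \<open>identU\<close>.\<close>

lemma splitT_homotopy_full:
  assumes "(a, v) \<in> AD" "is_path E v es" "fst \<delta> = src D (v, es)"
  shows "frag_extend colb (splitT True (a, (v, es) # \<delta> # rest, ()))
      + frag_extend (splitT True) (colb (a, (v, es) # \<delta> # rest, ())) =
    frag_of (ractD a (v, es), (src D (v, es), []) # \<delta> # rest, ()) - frag_of (a, (v, es) # \<delta> # rest, ())"
  using colb_splitT[OF assms(1,2)] splitT_colb[OF assms] split_sum_telescope[OF assms(1,2), of "\<delta> # rest"]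
  by simp

text \<open>Leaving out the last splitting makes two sums incomplete, the telescope and the one over
  \<open>f\<close> from the boundary of the split tuples. The missing terms with
  \<open>e # \<delta> # rest\<close> compensate, and the other missing term of the telescope is its
  end that starts with an identity.\<close>

lemma splitT_homotopy:
  assumes "(a, v) \<in> AD" "is_path E v es" "fst \<delta> = src D (v, es)" "es \<noteq> []" "snd \<delta> \<noteq> []"
  shows "frag_extend colb (splitT False (a, (v, es) # \<delta> # rest, ()))
      + frag_extend (splitT False) (colb (a, (v, es) # \<delta> # rest, ())) =
    - frag_of (a, (v, es) # \<delta> # rest, ())"
proof -
  let ?f = "\<lambda>a e \<gamma>. frag_of (a, e # (fst \<gamma>, snd \<gamma> @ snd \<delta>) # rest, ())"
  let ?t = "\<lambda>a e \<gamma>. frag_of (ractD a e, \<gamma> # \<delta> # rest, ()) - frag_of (a, cmp D e \<gamma> # \<delta> # rest, ())"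
  have "last_split ?f a v es = last_split (\<lambda>a e \<gamma>. frag_of (a, e # \<delta> # rest, ())) a v es"
    using assms(2-4)
  proof (induction es arbitrary: a v)
    case (Cons e es)
    show ?case
    proof (cases "es = []")
      case True
      with Cons.prems have "(tail E e, snd \<delta>) = \<delta>" by (cases \<delta>) auto
      with True show ?thesis by simp
    next
      case False
      with Cons show ?thesis by simp
    qed
  qed simp
  moreover have "split_sum False ?t a v es = split_sum True ?t a v es - last_split ?t a v es"
    unfolding split_sum_last[of ?t] by simp
  ultimately have "split_sum False ?t a v es - last_split ?f a v es = - frag_of (a, (v, es) # \<delta> # rest, ())"
    unfolding split_sum_telescope[OF assms(1,2), of "\<delta> # rest"]
      last_split_telescope[OF assms(4), of "\<delta> # rest" a v] last_split_end[OF assms(1,2,4), of "\<delta> # rest"]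
    by simp
  then show ?thesis
    unfolding colb_splitT[OF assms(1,2), of False \<delta> rest]
      splitT_colb[OF assms(1-3) disjI2[OF assms(5)], where rest = rest] split_sum_last[of ?f]
    by (simp add: algebra_simps)
qed

section \<open>Removing the tuples that start with an identity\<close>

definition identU :: "('v, 'c, 'e) col \<Rightarrow> (('v, 'c, 'e) col \<Rightarrow>\<^sub>0 int)" where
  "identU = (\<lambda>(a, ds, _). if ds = [] then 0 else
     frag_of (ractD a (hd ds), ident D (src D (hd ds)) # ident D (src D (hd ds)) # tl ds, ()))"

text \<open>Behind two identities, the first face and the two following products all give the
  right-hand side, with signs 1, -1, 1. In the other composite the first face and the first product
  cancel, since both move \<open>a\<close> past the same path; the faces of the rest cancel between
  the composites.\<close>

lemma identU_homotopy:
  assumes "(a, v) \<in> AD" "is_path E v es" "fst \<delta> = src D (v, es)" "\<delta> \<in> Arr D"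
  shows "frag_extend colb (identU (a, (v, es) # \<delta> # rest, ()))
      + frag_extend identU (colb (a, (v, es) # \<delta> # rest, ())) =
    frag_of (ractD a (v, es), (src D (v, es), []) # \<delta> # rest, ())"
proof -
  let ?w = "src D (v, es)"
  obtain es' where \<delta>: "\<delta> = (?w, es')" using assms(3) by (cases \<delta>) simp
  have aw: "(ractD a (v, es), ?w) \<in> AD" by (rule ractD_AD[OF assms(1,2)])
  have "ractD (ractD a (v, es)) \<delta> = ractD a (v, es @ es')"
    using ractD_append[OF assms(1,2), of es'] assms(4) by (simp add: \<delta>)
  moreover have "src D (v, es @ es') = src D \<delta>" by (simp add: \<delta>)
  moreover have "frag_extend identU (frag_map (\<lambda>(x, u). (a, (v, es) # x, u)) z) =
      frag_map (\<lambda>(x, u). (ractD a (v, es), (?w, []) # (?w, []) # x, u)) z" for z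
    unfolding frag_extend_map unfolding frag_map_def
    by (rule frag_extend_eq) (auto simp: identU_def)
  ultimately have "frag_extend identU (colb (a, (v, es) # \<delta> # rest, ())) =
    - frag_map (\<lambda>(x, u). (ractD a (v, es), (?w, []) # (?w, []) # x, u)) (bndD (\<delta> # rest))"
    by (simp add: colb_Cons frag_linear frag_map_map apfst_def map_prod_def case_prod_unfold identU_def \<delta>
        del: path_simps(6) bar_inner.simps(2)) 
  moreover have "frag_extend colb (identU (a, (v, es) # \<delta> # rest, ())) =
    frag_of (ractD a (v, es), (?w, []) # \<delta> # rest, ())
    + frag_map (\<lambda>(x, u). (ractD a (v, es), (?w, []) # (?w, []) # x, u)) (bndD (\<delta> # rest))"
    using ractD_ident[OF aw] assms(3)
    by (simp add: identU_def colb_Cons frag_linear frag_map_map apfst_def map_prod_def case_prod_unfold \<delta>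
        del: path_simps(6))
  ultimately show ?thesis by simp
qed

text \<open>\<open>identU\<close> and \<open>splitT True\<close> have the same defect, so their
  difference contracts the column in degrees at least 2.\<close>

definition contrS :: "('v, 'c, 'e) col \<Rightarrow> (('v, 'c, 'e) col \<Rightarrow>\<^sub>0 int)" where
  "contrS x = identU x - splitT True x"

lemma contrS_homotopy:
  assumes "(a, v) \<in> AD" "is_path E v es" "fst \<delta> = src D (v, es)" "\<delta> \<in> Arr D"
  shows "frag_extend colb (contrS (a, (v, es) # \<delta> # rest, ()))
      + frag_extend contrS (colb (a, (v, es) # \<delta> # rest, ())) = frag_of (a, (v, es) # \<delta> # rest, ())"
proof -
  have "frag_extend contrS z = frag_extend identU z - frag_extend (splitT True) z" for z
    by (simp add: contrS_def[abs_def] frag_extend_diff_fun)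
  then have "frag_extend colb (contrS (a, (v, es) # \<delta> # rest, ()))
      + frag_extend contrS (colb (a, (v, es) # \<delta> # rest, ())) =
    (frag_extend colb (identU (a, (v, es) # \<delta> # rest, ())) + frag_extend identU (colb (a, (v, es) # \<delta> # rest, ()))) -
    (frag_extend colb (splitT True (a, (v, es) # \<delta> # rest, ())) + frag_extend (splitT True) (colb (a, (v, es) # \<delta> # rest, ())))"
    by (simp add: contrS_def frag_linear algebra_simps)
  then show ?thesis
    unfolding identU_homotopy[OF assms] splitT_homotopy_full[OF assms(1-3)] by simp
qed

section \<open>Column operators on chains of the matched complex\<close>

definition col_lift :: "(('v, 'c, 'e) col \<Rightarrow> (('v, 'c, 'e) col \<Rightarrow>\<^sub>0 int)) \<Rightarrow>
    ('c list \<times> 'v \<times> ('v, 'e) path list \<Rightarrow>\<^sub>0 int) \<Rightarrow> ('c list \<times> 'v \<times> ('v, 'e) path list \<Rightarrow>\<^sub>0 int)" where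
  "col_lift G = frag_extend (\<lambda>(cs, v, ds). frag_map colb_tup (G ((cs, v), ds, ())))"

lemma col_lift_of [simp]: "col_lift G (frag_of (cs, v, ds)) = frag_map colb_tup (G ((cs, v), ds, ()))"
  by (simp add: col_lift_def)

lemma col_lift_map: "col_lift G (frag_map colb_tup z) = frag_map colb_tup (frag_extend G z)"
  unfolding col_lift_def frag_extend_map frag_map_extend
  by (rule frag_extend_eq) auto

lemma col_lift_linear:
  "col_lift G 0 = 0" "col_lift G (a + b) = col_lift G a + col_lift G b" "col_lift G (a - b) = col_lift G a - col_lift G b"
  "col_lift G (- a) = - col_lift G a" "col_lift G (frag_cmul c a) = frag_cmul c (col_lift G a)"
  by (simp_all add: col_lift_def frag_linear)

lemma bituples_col:
  assumes "(cs, v, ds) \<in> bituples M p q"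
  shows "((cs, v), v) \<in> AD" "\<exists>w. composable D v ds w" "int (length cs) = p" "int (length ds) = q"
  using assms by (auto simp: bituples_eq AD_def)

lemma col_bituples:
  assumes "((cs, v), v) \<in> AD" "composable D v ds w"
  shows "(cs, v, ds) \<in> bituples M (int (length cs)) (int (length ds))"
  using assms by (auto simp: bituples_eq AD_def)

lemma dv_col_lift:
  assumes "z \<in> carrier (Cpq M p q)"
  shows "dv M z = frag_cmul ((-1) ^ nat p) (col_lift colb z)"
proof -
  have "dv M (frag_of x) = frag_cmul ((-1) ^ nat p) (col_lift colb (frag_of x))" if "x \<in> bituples M p q" for x
    using that dv_colb by (cases x) (auto simp: bituples_eq)
  then have "dv M z = frag_extend (\<lambda>x. frag_cmul ((-1) ^ nat p) (col_lift colb (frag_of x))) z"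
    using assms unfolding dv_ext[of z] Cpq_def carrier_free_Abelian_group_iff by (intro frag_extend_eq) auto
  then show ?thesis
    by (simp add: frag_extend_cmul_fun col_lift_def)
qed

lemma split_sum_keys:
  assumes "(a, v) \<in> AD" "is_path E v es" "snd a = v"
    "y \<in> Poly_Mapping.keys (split_sum b (\<lambda>a e \<gamma>. frag_of (a, e # \<gamma> # rest, ())) a v es)"
  shows "\<exists>cs e \<gamma>. y = ((cs, fst e), e # \<gamma> # rest, ()) \<and> length cs = length (fst a) \<and> ((cs, fst e), fst e) \<in> AD \<and>
    e \<in> Arr D \<and> \<gamma> \<in> Arr D \<and> src D e = fst \<gamma> \<and> src D \<gamma> = src D (v, es) \<and> snd e \<noteq> [] \<and> (b \<or> snd \<gamma> \<noteq> [])"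
  using assms
proof (induction es arbitrary: a v)
  case (Cons e es)
  have ae: "(ractD a (v, [e]), tail E e) \<in> AD" "is_path E (tail E e) es" "tail E e \<in> verts E"
      "snd (ractD a (v, [e])) = tail E e" "length (fst (ractD a (v, [e]))) = length (fst a)"
    using ractD_edge[OF Cons.prems(1,2)] Cons.prems(2) is_path_verts[of "tail E e" es]
    by (auto simp: ractD_def case_prod_unfold)
  from Cons.prems(4) consider "y = (a, (v, [e]) # (tail E e, es) # rest, ())" "es = [] \<longrightarrow> b"
    | "y \<in> Poly_Mapping.keys (split_sum b (\<lambda>a e \<gamma>. frag_of (a, e # \<gamma> # rest, ())) (ractD a (v, [e])) (tail E e) es)"
    by (auto split: if_splits dest!: set_mp[OF keys_add])
  then show ?case
  proof cases
    case 1
    then show ?thesis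
      using Cons.prems ae by (intro exI[of _ "fst a"] exI[of _ "(v, [e])"] exI[of _ "(tail E e, es)"]) (cases a; auto)
  next
    case 2
    have "src D (tail E e, es) = src D (v, e # es)" by simp
    then show ?thesis
      using Cons.IH[OF ae(1,2,4) 2] ae(5) by simp
  qed
qed simp

definition nonident :: "('v, 'e) path list \<Rightarrow> bool" where
  "nonident ds \<longleftrightarrow> (\<forall>d\<in>set ds. snd d \<noteq> [])"

lemma composable_Arr: "composable D v ds w \<Longrightarrow> set ds \<subseteq> Arr D"
  by (induction ds arbitrary: v) auto

text \<open>The edge that is split off is never an identity, and without the last splitting neither
  is the remainder; this keeps \<open>sv\<close> inside the normalised chains.\<close>

lemma splitT_keys:
  assumes x: "(cs, v, ds) \<in> bituples M p q"
    and y: "y \<in> Poly_Mapping.keys (col_lift (splitT b) (frag_of (cs, v, ds)))"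
  shows "y \<in> bituples M p (q + 1) \<and> (\<not> b \<longrightarrow> nonident ds \<longrightarrow> nonident (snd (snd y)))"
proof -
  obtain w where w: "composable D v ds w" "((cs, v), v) \<in> AD" "int (length cs) = p" "int (length ds) = q"
    using bituples_col[OF x] by blast
  from y obtain y' where y': "y = colb_tup y'" "y' \<in> Poly_Mapping.keys (splitT b ((cs, v), ds, ()))"
    by (auto dest!: keys_frag_mapD)
  then obtain es rest where ds: "ds = (v, es) # rest"
    using w by (cases ds) (auto simp: splitT_def)
  have p: "is_path E v es" using w by (simp add: ds)
  have "y' \<in> Poly_Mapping.keys (split_sum b (\<lambda>a e \<gamma>. frag_of (a, e # \<gamma> # rest, ())) (cs, v) v es)"
    using y'(2) by (simp add: splitT_def ds)
  from split_sum_keys[OF w(2) p snd_conv this, unfolded fst_conv]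
  obtain cs' e \<gamma> where g: "y' = ((cs', fst e), e # \<gamma> # rest, ())" "length cs' = length cs" "((cs', fst e), fst e) \<in> AD"
    "e \<in> Arr D" "\<gamma> \<in> Arr D" "src D e = fst \<gamma>" "src D \<gamma> = src D (v, es)" "snd e \<noteq> []" "b \<or> snd \<gamma> \<noteq> []"
    by blast
  have "composable D (fst e) (e # \<gamma> # rest) w"
    using g w by (simp add: ds)
  from col_bituples[OF g(3) this] g w y'(1) show ?thesis
    by (auto simp: nonident_def ds)
qed

lemma identU_keys:
  assumes x: "(cs, v, ds) \<in> bituples M p q"
    and y: "y \<in> Poly_Mapping.keys (col_lift identU (frag_of (cs, v, ds)))"
  shows "y \<in> bituples M p (q + 1)"
proof -
  obtain w where w: "composable D v ds w" "((cs, v), v) \<in> AD" "int (length cs) = p" "int (length ds) = q"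
    using bituples_col[OF x] by blast
  from y obtain y' where y': "y = colb_tup y'" "y' \<in> Poly_Mapping.keys (identU ((cs, v), ds, ()))"
    by (auto dest!: keys_frag_mapD)
  then obtain es rest where ds: "ds = (v, es) # rest"
    using w by (cases ds) (auto simp: identU_def)
  have p: "is_path E v es" using w by (simp add: ds)
  let ?u = "src D (v, es)"
  have "composable D ?u rest w" using w(1) by (simp add: ds)
  moreover have u: "?u \<in> verts E" using D.src_Obj[of "(v, es)"] p by simp
  ultimately have "composable D ?u ((?u, []) # (?u, []) # rest) w"
    by (simp del: path_simps(6) add: path_simps(6)[of _ "[]"])
  moreover have "((rtup cs (v, es), ?u), ?u) \<in> AD"
    using ractD_AD[OF w(2) p] by (simp add: ractD_def)
  ultimately show ?thesis
    using col_bituples[of "rtup cs (v, es)" ?u "(?u, []) # (?u, []) # rest" w] y' w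
    by (auto simp: identU_def ds ractD_def add.commute simp del: path_simps(6) composable.simps)
qed

lemma col_lift_contrS: "col_lift contrS z = col_lift identU z - col_lift (splitT True) z"
  unfolding col_lift_def frag_extend_diff_fun[symmetric]
  by (rule frag_extend_eq) (auto simp: contrS_def frag_linear)

lemma col_lift_Cpq:
  assumes "\<And>x. x \<in> bituples M p q \<Longrightarrow> Poly_Mapping.keys (col_lift G (frag_of x)) \<subseteq> bituples M p q'"
    and "z \<in> carrier (Cpq M p q)"
  shows "col_lift G z \<in> carrier (Cpq M p q')"
  using assms(2) unfolding Cpq_def carrier_free_Abelian_group_iff
proof (induction rule: frag_induction)
  case (one x)
  then show ?case using assms(1) by blast
qed (auto simp: col_lift_linear keys_diff_subset)

lemma contrS_Cpq:
  assumes "z \<in> carrier (Cpq M p q)"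
  shows "col_lift contrS z \<in> carrier (Cpq M p (q + 1))"
proof -
  have "col_lift identU z \<in> carrier (Cpq M p (q + 1))"
    by (rule col_lift_Cpq[OF _ assms]) (use identU_keys in auto)
  moreover have "col_lift (splitT True) z \<in> carrier (Cpq M p (q + 1))"
    by (rule col_lift_Cpq[OF _ assms]) (use splitT_keys in auto)
  ultimately show ?thesis
    unfolding col_lift_contrS Cpq_def by (simp add: keys_diff_subset)
qed

lemma bituples_two:
  assumes "(cs, v, ds) \<in> bituples M p q" "q \<ge> 2"
  obtains es \<delta> rest where "ds = (v, es) # \<delta> # rest" "((cs, v), v) \<in> AD" "is_path E v es"
    "fst \<delta> = src D (v, es)" "\<delta> \<in> Arr D"
proof -
  obtain w where w: "composable D v ds w" "((cs, v), v) \<in> AD" "int (length ds) = q"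
    using bituples_col[OF assms(1)] by blast
  then obtain d \<delta> rest where "ds = d # \<delta> # rest"
    using assms(2) by (cases ds; cases "tl ds") auto
  with w show ?thesis by (cases d) (auto intro!: that)
qed

lemma contrS_Cpq_homotopy:
  assumes "z \<in> carrier (Cpq M p q)" "q \<ge> 2"
  shows "col_lift colb (col_lift contrS z) + col_lift contrS (col_lift colb z) = z"
  using assms(1) unfolding Cpq_def carrier_free_Abelian_group_iff
proof (induction rule: frag_induction)
  case (one x)
  obtain cs v ds where x: "x = (cs, v, ds)" by (metis prod.exhaust)
  show ?case
    using one assms(2) unfolding x
  proof (rule bituples_two)
    fix es \<delta> rest
    assume a: "ds = (v, es) # \<delta> # rest" "((cs, v), v) \<in> AD" "is_path E v es" "fst \<delta> = src D (v, es)" "\<delta> \<in> Arr D"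
    show "col_lift colb (col_lift contrS (frag_of (cs, v, ds))) + col_lift contrS (col_lift colb (frag_of (cs, v, ds))) =
        frag_of (cs, v, ds)"
      unfolding col_lift_of col_lift_map frag_map_add[symmetric] a(1) contrS_homotopy[OF a(2-5)] by simp
  qed
next
  case (diff a b)
  from arg_cong2[OF diff, of "(-)"] show ?case by (simp add: col_lift_linear algebra_simps)
qed (simp add: col_lift_linear)

theorem columns_exact:
  assumes z: "z \<in> carrier (Cpq M p q)" "q \<ge> 2" "dv M z = 0"
  shows "\<exists>y\<in>carrier (Cpq M p (q + 1)). dv M y = z"
proof -
  have "col_lift colb z = 0"
    using dv_col_lift[OF z(1)] z(3) by simp
  then have "col_lift colb (col_lift contrS z) = z"
    using contrS_Cpq_homotopy[OF z(1,2)] by (simp add: col_lift_linear)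
  \<comment> \<open>\<open>dv\<close> is \<open>(-1) ^ p\<close> times the column boundary; the same
    sign on the preimage compensates it.\<close>
  then have "dv M (frag_cmul ((-1) ^ nat p) (col_lift contrS z)) = z"
    using dv_col_lift[OF contrS_Cpq[OF z(1)]] by (simp flip: power_add)
  moreover have "frag_cmul ((-1) ^ nat p) (col_lift contrS z) \<in> carrier (Cpq M p (q + 1))"
    using contrS_Cpq[OF z(1)] keys_cmul by (force simp: Cpq_def)
  ultimately show ?thesis by blast
qed

section \<open>The normalised complex\<close>

lemma nonident_iff:
  assumes "(cs, v, ds) \<in> bituples M p q"
  shows "set ds \<inter> ident (rcat M) ` Obj (rcat M) = {} \<longleftrightarrow> nonident ds"
proof -
  have "set ds \<subseteq> Arr D" using bituples_col[OF assms] composable_Arr by blast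
  then have "(\<exists>u\<in>verts E. d = (u, [])) \<longleftrightarrow> snd d = []" if "d \<in> set ds" for d
    using that is_path_verts by (cases d) auto
  then show ?thesis
    unfolding nonident_def by (auto simp: D_def[symmetric])
qed

lemma Npq_iff: "z \<in> carrier (Npq M p q) \<longleftrightarrow>
    Poly_Mapping.keys z \<subseteq> {x \<in> bituples M p q. nonident (snd (snd x))}"
proof -
  have "{(cs, v, ds) \<in> bituples M p q. set ds \<inter> ident (rcat M) ` Obj (rcat M) = {}} =
    {x \<in> bituples M p q. nonident (snd (snd x))}"
  proof (rule Set.set_eqI)
    fix x :: "'c list \<times> 'v \<times> ('v, 'e) path list"
    obtain cs v ds where x: "x = (cs, v, ds)" by (metis prod.exhaust)
    show "x \<in> {(cs, v, ds) \<in> bituples M p q. set ds \<inter> ident (rcat M) ` Obj (rcat M) = {}} \<longleftrightarrow>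
      x \<in> {x \<in> bituples M p q. nonident (snd (snd x))}"
      unfolding x mem_Collect_eq prod.case snd_conv using nonident_iff[of cs v ds p q] by argo
  qed
  then show ?thesis unfolding Npq_def by simp
qed

lemma Npq_Cpq: "z \<in> carrier (Npq M p q) \<Longrightarrow> z \<in> carrier (Cpq M p q)"
  by (auto simp: Npq_iff Cpq_def)

text \<open>A concatenation of nonempty paths is nonempty, so no product face leaves the normalised
  chains; in a general category a composite of nonidentities may be an identity.\<close>

lemma bndD_nonident: "nonident ds \<Longrightarrow> x \<in> Poly_Mapping.keys (bndD ds) \<Longrightarrow> nonident (fst x)"
proof (induction ds arbitrary: x)
  case (Cons d ds)
  show ?case
  proof (cases ds)
    case Nil
    with Cons.prems show ?thesis by (simp add: nonident_def)
  next
    case ds: (Cons d' ds')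
    from Cons.prems(2) consider "fst x = (fst d, snd d @ snd d') # ds'"
      | x' where "fst x = d # fst x'" "x' \<in> Poly_Mapping.keys (bndD ds)"
      unfolding ds by (fastforce dest!: keys_frag_mapD set_mp[OF keys_diff])
    then show ?thesis
    proof cases
      case 1
      with Cons.prems(1) show ?thesis by (simp add: nonident_def ds)
    next
      case 2
      from Cons.prems(1) have "snd d \<noteq> []" "nonident ds" by (auto simp: nonident_def)
      with Cons.IH[OF this(2) 2(2)] 2(1) show ?thesis by (simp add: nonident_def)
    qed
  qed
qed simp

lemma dv_Npq:
  assumes "z \<in> carrier (Npq M p (q + 1))"
  shows "dv M z \<in> carrier (Npq M p q)"
  using assms unfolding Npq_iff
proof (induction rule: frag_induction)
  case (one x)
  obtain cs v ds where x: "x = (cs, v, ds)" by (metis prod.exhaust)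
  have "y \<in> bituples M p q" if "y \<in> Poly_Mapping.keys (dv M (frag_of x))" for y
    using dv_keys[of x p "q + 1"] one that by auto
  moreover have "nonident (snd (snd y))" if "y \<in> Poly_Mapping.keys (dv M (frag_of x))" for y
  proof -
    have xb: "x \<in> bituples M p (q + 1)" and n: "nonident ds" using one by (auto simp: x)
    have "y \<in> Poly_Mapping.keys (col_lift colb (frag_of x))"
      using that dv_col_lift[of "frag_of x" p "q + 1"] xb by (auto simp: Cpq_def)
    then obtain y' where y': "y = colb_tup y'" "y' \<in> Poly_Mapping.keys (colb ((cs, v), ds, ()))"
      by (auto simp: x dest!: keys_frag_mapD)
    have "nonident (fst (snd y'))"
    proof (cases ds)
      case Nil
      with y'(2) show ?thesis by (simp add: colb_def)
    next
      case (Cons d ds')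
      with y'(2) consider "y' = (ractD (cs, v) d, ds', ())"
        | x' where "y' = ((cs, v), x')" "x' \<in> Poly_Mapping.keys (bndD ds)"
        by (auto simp: colb_Cons simp del: bar_inner.simps dest!: keys_frag_mapD set_mp[OF keys_add])
      then show ?thesis
      proof cases
        case 1
        with n show ?thesis by (simp add: Cons nonident_def)
      next
        case 2
        with bndD_nonident[OF n 2(2)] show ?thesis by simp
      qed
    qed
    with y'(1) show ?thesis by (auto simp: case_prod_unfold)
  qed
  ultimately show ?case by blast
qed (auto simp: keys_diff_subset)

section \<open>The splitting sum in indexed form\<close>

lemma take_is_path: "is_path E v es \<Longrightarrow> is_path E v (take k es)"
proof (induction es arbitrary: v k)
  case (Cons e es)
  then show ?case using is_path_verts[of v "e # es"] by (cases k) auto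
qed simp

lemma path_vertex_Cons: "1 \<le> i \<Longrightarrow> path_vertex E (v, e # es) i = path_vertex E (tail E e, es) (i - 1)"
  by (cases i; cases "i - 1") (auto simp: path_vertex_def)

lemma src_take: "k \<le> length es \<Longrightarrow> src D (v, take k es) = path_vertex E (v, es) k"
  by (cases "k = 0") (auto simp: path_vertex_def last_conv_nth)

text \<open>The recursion strips the first edge: summand \<open>Suc i\<close> for
  \<open>e # es\<close> is summand \<open>i\<close> for \<open>es\<close>, with \<open>a\<close>
  already moved past \<open>e\<close>. The upper bound \<open>length es - 1\<close> omits the
  splitting whose remainder is a vertex.\<close>

lemma split_sum_eq:
  assumes "(a, v) \<in> AD" "is_path E v es"
  shows "split_sum False f a v es = (\<Sum>i\<in>{1..length es - 1}.
    f (ractD a (subpath E (v, es) 0 (i - 1))) (subpath E (v, es) (i - 1) i) (subpath E (v, es) i (length es)))"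
  using assms
proof (induction es arbitrary: a v)
  case (Cons e es)
  show ?case
  proof (cases es)
    case Nil
    then show ?thesis by simp
  next
    case es: (Cons e' es')
    let ?F = "\<lambda>i. f (ractD a (subpath E (v, e # es) 0 (i - 1))) (subpath E (v, e # es) (i - 1) i)
        (subpath E (v, e # es) i (length (e # es)))"
    let ?G = "\<lambda>i. f (ractD (ractD a (v, [e])) (subpath E (tail E e, es) 0 (i - 1))) (subpath E (tail E e, es) (i - 1) i)
        (subpath E (tail E e, es) i (length es))"
    have ae: "(ractD a (v, [e]), tail E e) \<in> AD" "is_path E (tail E e) es"
      using ractD_edge[OF Cons.prems] Cons.prems(2) by auto
    have "?F (Suc i) = ?G i" if i1: "1 \<le> i" for i
    proof -
      obtain k where i: "i = Suc k" using i1 by (cases i) auto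
      have "is_path E v (e # take k es)" using take_is_path[OF Cons.prems(2), of "Suc k"] by simp
      from ractD_Cons[OF Cons.prems(1) this] show ?thesis
        by (simp add: i subpath_def path_vertex_Cons path_vertex_def[of _ _ 0])
    qed
    then have "(\<Sum>i\<in>{1..length es - 1}. ?F (Suc i)) = (\<Sum>i\<in>{1..length es - 1}. ?G i)"
      by (intro sum.cong) auto
    moreover have "(\<Sum>i\<in>{1..length (e # es) - 1}. ?F i) = ?F 1 + (\<Sum>i\<in>{1..length es - 1}. ?F (Suc i))"
      by (simp add: es sum.atLeast_Suc_atMost sum.shift_bounds_cl_Suc_ivl del: sum.cl_ivl_Suc)
    moreover have "?F 1 = f a (v, [e]) (tail E e, es)"
      using ractD_ident[OF Cons.prems(1)] by (simp add: subpath_def path_vertex_def)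
    ultimately show ?thesis
      using Cons.IH[OF ae] by (simp add: es)
  qed
qed simp

lemma sv_eq:
  assumes "(cs, v, ds) \<in> bituples M p q"
  shows "sv E M (frag_of (cs, v, ds)) = - col_lift (splitT False) (frag_of (cs, v, ds))"
proof (cases ds)
  case Nil
  then show ?thesis by (simp add: sv_def splitT_def)
next
  case (Cons \<alpha> rest)
  obtain w u where w: "composable D v ds w" "((cs, v), v) \<in> AD" "composable C u cs v"
    using bituples_col[OF assms] assms by (auto simp: bituples_eq)
  obtain es where \<alpha>: "\<alpha> = (v, es)" "is_path E v es" using w(1) Cons by (cases \<alpha>) auto
  have "col_lift (splitT False) (frag_of (cs, v, ds)) =
    (\<Sum>i\<in>{1..length es - 1}. frag_of (colb_tup
      (ractD (cs, v) (subpath E \<alpha> 0 (i - 1)), subpath E \<alpha> (i - 1) i # subpath E \<alpha> i (length es) # rest, ())))"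
    using split_sum_eq[OF w(2) \<alpha>(2), of "\<lambda>a e \<gamma>. frag_of (a, e # \<gamma> # rest, ())"]
    by (simp add: splitT_def Cons \<alpha>(1) frag_map_def frag_extend_sum o_def)
  also have "\<dots> = (\<Sum>i\<in>{1..length es - 1}. frag_of (ract_tuple M cs (subpath E \<alpha> 0 (i - 1)), path_vertex E \<alpha> (i - 1),
      subpath E \<alpha> (i - 1) i # subpath E \<alpha> i (length es) # rest))"
  proof (rule sum.cong[OF refl])
    fix i assume "i \<in> {1..length es - 1}"
    then have i: "i - 1 \<le> length es" by auto
    have sp: "subpath E (v, es) 0 (i - 1) = (v, take (i - 1) es)"
      by (simp add: subpath_def path_vertex_def)
    have "ract_tuple M cs (v, take (i - 1) es) = rtup cs (v, take (i - 1) es)"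
      by (rule ract_tuple_eq[OF w(3)]) (use take_is_path[OF \<alpha>(2)] in auto)
    then show "frag_of (colb_tup (ractD (cs, v) (subpath E \<alpha> 0 (i - 1)), subpath E \<alpha> (i - 1) i # subpath E \<alpha> i (length es) # rest, ())) =
      frag_of (ract_tuple M cs (subpath E \<alpha> 0 (i - 1)), path_vertex E \<alpha> (i - 1),
      subpath E \<alpha> (i - 1) i # subpath E \<alpha> i (length es) # rest)"
      using src_take[OF i, of v] sp by (simp add: ractD_def \<alpha>(1) del: path_simps(6))
  qed
  finally show ?thesis
    by (simp add: sv_def Cons path_length_def \<alpha>(1) Let_def)
qed

lemma sv_col_lift:
  assumes "z \<in> carrier (Cpq M p q)"
  shows "sv E M z = - col_lift (splitT False) z"
proof -
  have "sv E M z = frag_extend (\<lambda>x. sv E M (frag_of x)) z"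
    unfolding sv_def by simp
  also have "\<dots> = frag_extend (\<lambda>x. - col_lift (splitT False) (frag_of x)) z"
    using assms sv_eq unfolding Cpq_def carrier_free_Abelian_group_iff by (intro frag_extend_eq) force
  finally show ?thesis
    by (simp add: frag_extend_minus_fun col_lift_def)
qed

lemma sv_Npq:
  assumes "z \<in> carrier (Npq M p q)"
  shows "sv E M z \<in> carrier (Npq M p (q + 1))"
  unfolding sv_col_lift[OF Npq_Cpq[OF assms]]
  using assms unfolding Npq_iff
proof (induction rule: frag_induction)
  case (one x)
  obtain cs v ds where x: "x = (cs, v, ds)" by (metis prod.exhaust)
  show ?case using one splitT_keys[of cs v ds p q _ False] by (auto simp: x)
qed (auto simp: col_lift_linear keys_diff_subset)

text \<open>Neither \<open>sv\<close> nor \<open>dv\<close> changes \<open>p\<close>, so the sign of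
  \<open>dv\<close> is the same in both composites and comes out as a factor.\<close>

lemma sv_homotopy:
  assumes "z \<in> carrier (Npq M p q)" "q \<ge> 2"
  shows "dv M (sv E M z) + sv E M (dv M z) = frag_cmul ((-1) ^ nat p) z"
proof -
  let ?T = "col_lift (splitT False)" and ?s = "(-1) ^ nat p :: int"
  have c: "z \<in> carrier (Cpq M p q)" "sv E M z \<in> carrier (Cpq M p (q + 1))" "dv M z \<in> carrier (Cpq M p (q - 1))"
    using Npq_Cpq[OF assms(1)] Npq_Cpq[OF sv_Npq[OF assms(1)]] dv_Cpq by auto
  have "col_lift colb (?T z) + ?T (col_lift colb z) = - z"
    using assms(1) unfolding Npq_iff
  proof (induction rule: frag_induction)
    case (one x)
    obtain cs v ds where x: "x = (cs, v, ds)" by (metis prod.exhaust)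
    have "(cs, v, ds) \<in> bituples M p q" "nonident ds" using one by (auto simp: x)
    then show ?case
      using assms(2) unfolding x
    proof (elim bituples_two)
      fix es \<delta> rest
      assume a: "ds = (v, es) # \<delta> # rest" "((cs, v), v) \<in> AD" "is_path E v es" "fst \<delta> = src D (v, es)" "nonident ds"
      then have "es \<noteq> []" "snd \<delta> \<noteq> []" by (auto simp: nonident_def)
      from splitT_homotopy[OF a(2-4) this, of rest]
      show "col_lift colb (?T (frag_of (cs, v, ds))) + ?T (col_lift colb (frag_of (cs, v, ds))) = - frag_of (cs, v, ds)"
        unfolding col_lift_of col_lift_map frag_map_add[symmetric] a(1) by (simp add: frag_map_minus)
    qed
  next
    case (diff a b)
    from arg_cong2[OF diff, of "(-)"] show ?case by (simp add: col_lift_linear algebra_simps)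
  qed (simp add: col_lift_linear)
  then have eq: "- (col_lift colb (?T z) + ?T (col_lift colb z)) = z" by simp
  have "dv M (sv E M z) + sv E M (dv M z) = frag_cmul ?s (- (col_lift colb (?T z) + ?T (col_lift colb z)))"
    unfolding sv_col_lift[OF c(3)] dv_col_lift[OF c(2)] unfolding sv_col_lift[OF c(1)] dv_col_lift[OF c(1)]
    by (simp add: col_lift_linear frag_cmul_diff frag_cmul_minus)
  then show ?thesis unfolding eq .
qed

lemma sv_add: "sv E M (x + y) = sv E M x + sv E M y"
  by (simp add: sv_def frag_linear)

lemma dv_hom_Npq: "dv M \<in> hom (Npq M p (q + 1)) (Npq M p q)"
  by (rule homI, rule dv_Npq, assumption) (simp add: Npq_def)

lemma sv_hom_Npq: "sv E M \<in> hom (Npq M p q) (Npq M p (q + 1))"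
  by (rule homI, rule sv_Npq, assumption) (simp add: Npq_def sv_add)

end

section \<open>Presentations of groups by chains\<close>

definition subgrp :: "'a :: ab_group_add set \<Rightarrow> bool" where
  "subgrp Z \<longleftrightarrow> 0 \<in> Z \<and> (\<forall>x\<in>Z. \<forall>y\<in>Z. x - y \<in> Z)"

lemma subgrpD:
  assumes "subgrp Z"
  shows "0 \<in> Z" "x \<in> Z \<Longrightarrow> y \<in> Z \<Longrightarrow> x - y \<in> Z" "x \<in> Z \<Longrightarrow> - x \<in> Z" "x \<in> Z \<Longrightarrow> y \<in> Z \<Longrightarrow> x + y \<in> Z"
proof -
  show z: "0 \<in> Z" and d: "\<And>x y. x \<in> Z \<Longrightarrow> y \<in> Z \<Longrightarrow> x - y \<in> Z"
    using assms by (auto simp: subgrp_def)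
  show m: "- x \<in> Z" if "x \<in> Z" for x using d[OF z that] by simp
  show "x \<in> Z \<Longrightarrow> y \<in> Z \<Longrightarrow> x + y \<in> Z" using d[OF _ m[of y], of x] by simp
qed

text \<open>\<open>cls\<close> identifies \<open>G\<close> with the quotient of \<open>Z\<close> by \<open>B\<close>; nothing is said about \<open>cls\<close> outside \<open>Z\<close>.\<close>

definition presents :: "'g monoid \<Rightarrow> ('a :: ab_group_add \<Rightarrow> 'g) \<Rightarrow> 'a set \<Rightarrow> 'a set \<Rightarrow> bool" where
  "presents G cls Z B \<longleftrightarrow> group G \<and> subgrp Z \<and> B \<subseteq> Z \<and> cls ` Z = carrier G \<and>
     (\<forall>x\<in>Z. \<forall>y\<in>Z. cls (x + y) = cls x \<otimes>\<^bsub>G\<^esub> cls y) \<and> (\<forall>x\<in>Z. cls x = \<one>\<^bsub>G\<^esub> \<longleftrightarrow> x \<in> B)"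

lemma presentsD:
  assumes "presents G cls Z B"
  shows "group G" "subgrp Z" "B \<subseteq> Z" "cls ` Z = carrier G" "x \<in> Z \<Longrightarrow> cls x \<in> carrier G"
    "x \<in> Z \<Longrightarrow> y \<in> Z \<Longrightarrow> cls (x + y) = cls x \<otimes>\<^bsub>G\<^esub> cls y" "x \<in> Z \<Longrightarrow> cls x = \<one>\<^bsub>G\<^esub> \<longleftrightarrow> x \<in> B"
  using assms by (auto simp: presents_def)

lemma presents_eq:
  assumes P: "presents G cls Z B" and "x \<in> Z" "y \<in> Z"
  shows "cls x = cls y \<longleftrightarrow> x - y \<in> B"
proof -
  interpret group G by (rule presentsD(1)[OF P])
  have xy: "x - y \<in> Z" using presentsD(2)[OF P] assms by (auto dest: subgrpD(2))
  have "cls x = cls (x - y) \<otimes>\<^bsub>G\<^esub> cls y"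
    using presentsD(6)[OF P xy assms(3)] by simp
  then show ?thesis
    using presentsD(5,7)[OF P xy] presentsD(5)[OF P assms(3)] by simp
qed

lemma presents_comm_group:
  assumes P: "presents G cls Z B"
  shows "comm_group G"
proof (rule group.group_comm_groupI[OF presentsD(1)[OF P]])
  fix a b assume "a \<in> carrier G" "b \<in> carrier G"
  then obtain x y where "x \<in> Z" "y \<in> Z" "a = cls x" "b = cls y"
    unfolding presentsD(4)[OF P, symmetric] by blast
  then show "a \<otimes>\<^bsub>G\<^esub> b = b \<otimes>\<^bsub>G\<^esub> a"
    using presentsD(6)[OF P] by (metis add.commute)
qed

lemma presents_boundaries:
  assumes P: "presents G cls Z B"
  shows "0 \<in> B" "x \<in> B \<Longrightarrow> y \<in> B \<Longrightarrow> x - y \<in> B" "x \<in> B \<Longrightarrow> - x \<in> B" "x \<in> B \<Longrightarrow> y \<in> B \<Longrightarrow> x + y \<in> B"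
proof -
  have s: "subgrp B"
    unfolding subgrp_def
  proof safe
    have z: "0 \<in> Z" using presentsD(2)[OF P] by (rule subgrpD(1))
    from presents_eq[OF P z z] show "0 \<in> B" by simp
    fix x y assume b: "x \<in> B" "y \<in> B"
    then have xy: "x \<in> Z" "y \<in> Z" using presentsD(3)[OF P] by auto
    have "cls x = cls y" using presentsD(7)[OF P xy(1)] presentsD(7)[OF P xy(2)] b by metis
    then show "x - y \<in> B" using presents_eq[OF P xy] by blast
  qed
  show "0 \<in> B" "x \<in> B \<Longrightarrow> y \<in> B \<Longrightarrow> x - y \<in> B" "x \<in> B \<Longrightarrow> - x \<in> B" "x \<in> B \<Longrightarrow> y \<in> B \<Longrightarrow> x + y \<in> B"
    by (rule subgrpD[OF s]; assumption)+
qed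

lemma presents_free: "presents (free_Abelian_group S) (\<lambda>x. x) (carrier (free_Abelian_group S)) {0}"
  by (auto simp: presents_def subgrp_def keys_diff_subset)

text \<open>\<open>\<Phi>\<close> need only be onto modulo boundaries and reflect them; it may be
  far from bijective on cycles.\<close>

lemma presents_transfer:
  assumes P: "presents G cls Z B" and Z': "subgrp Z'" and add: "\<And>x y. \<Phi> (x + y) = \<Phi> x + \<Phi> y"
    and iso: "\<And>x. x \<in> Z' \<Longrightarrow> \<Phi> x \<in> Z \<and> (\<Phi> x \<in> B \<longleftrightarrow> x \<in> B')" and B': "B' \<subseteq> Z'"
    and surj: "\<And>y. y \<in> Z \<Longrightarrow> \<exists>x\<in>Z'. y - \<Phi> x \<in> B"
  shows "presents G (\<lambda>x. cls (\<Phi> x)) Z' B'"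
  unfolding presents_def
proof (intro conjI ballI)
  show "(\<lambda>x. cls (\<Phi> x)) ` Z' = carrier G"
  proof
    show "(\<lambda>x. cls (\<Phi> x)) ` Z' \<subseteq> carrier G" using iso presentsD(5)[OF P] by auto
    show "carrier G \<subseteq> (\<lambda>x. cls (\<Phi> x)) ` Z'"
    proof
      fix a assume "a \<in> carrier G"
      then obtain y where y: "y \<in> Z" "a = cls y" unfolding presentsD(4)[OF P, symmetric] by blast
      from surj[OF y(1)] obtain x where x: "x \<in> Z'" "y - \<Phi> x \<in> B" by blast
      with presents_eq[OF P y(1)] iso have "a = cls (\<Phi> x)" by (auto simp: y(2))
      with x show "a \<in> (\<lambda>x. cls (\<Phi> x)) ` Z'" by blast
    qed
  qed
qed (use P Z' B' iso in \<open>auto simp: presents_def add\<close>)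

text \<open>Passing to homology shrinks the cycles and enlarges the boundaries, while the
  representatives stay in the same group of chains. Applied to vertical homology it presents
  \<open>E2\<close>, whose elements are cosets of cosets, by chains of the matched complex.\<close>

lemma presents_homology:
  assumes P1: "presents (G (n + 1)) c1 Z1 B1" and P0: "presents (G n) c0 Z0 B0"
    and Pm: "presents (G (n - 1)) cm Zm Bm"
    and d1: "\<And>x. x \<in> Z1 \<Longrightarrow> \<delta> x \<in> Z0 \<and> d (n + 1) (c1 x) = c0 (\<delta> x)"
    and d0: "\<And>x. x \<in> Z0 \<Longrightarrow> \<delta> x \<in> Zm \<and> d n (c0 x) = cm (\<delta> x)"
    and add: "\<And>x y. \<delta> (x + y) = \<delta> x + \<delta> y"
    and dd: "\<And>x. x \<in> Z1 \<Longrightarrow> \<delta> (\<delta> x) \<in> Bm"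
  shows "presents (homology G d n) (\<lambda>x. (d (n + 1) ` carrier (G (n + 1))) #>\<^bsub>G n\<^esub> c0 x)
    {x \<in> Z0. \<delta> x \<in> Bm} {x \<in> Z0. \<exists>y\<in>Z1. x - \<delta> y \<in> B0}"
proof -
  interpret G: comm_group "G n" by (rule presents_comm_group[OF P0])
  have \<delta>0: "\<delta> 0 = 0" using add[of 0 0] by simp
  have \<delta>m: "\<delta> (x - y) = \<delta> x - \<delta> y" for x y using add[of "x - y" y] by simp
  let ?I = "d (n + 1) ` carrier (G (n + 1))" and ?K = "kernel (G n) (G (n - 1)) (d n)"
  let ?Zc = "{x \<in> Z0. \<delta> x \<in> Bm}"
  have K: "?K = c0 ` ?Zc"
    unfolding kernel_def presentsD(4)[OF P0, symmetric] using d0 presentsD(7)[OF Pm] by auto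
  have I: "?I = c0 ` \<delta> ` Z1"
    unfolding presentsD(4)[OF P1, symmetric] image_image using d1 by (auto intro!: image_cong)
  have Zc: "subgrp ?Zc"
    using subgrpD[OF presentsD(2)[OF P0]] presents_boundaries[OF Pm] by (auto simp: subgrp_def \<delta>0 \<delta>m)
  have \<delta>Zc: "\<delta> y \<in> ?Zc" if "y \<in> Z1" for y using d1 dd that by auto
  have inv: "inv\<^bsub>G n\<^esub> (c0 x) = c0 (- x)" if "x \<in> Z0" for x
  proof (rule G.inv_equality)
    have m: "- x \<in> Z0" using subgrpD(3)[OF presentsD(2)[OF P0] that] .
    show "c0 (- x) \<otimes>\<^bsub>G n\<^esub> c0 x = \<one>\<^bsub>G n\<^esub>"
      using presentsD(6)[OF P0 m that] presentsD(7)[OF P0 subgrpD(1)[OF presentsD(2)[OF P0]]]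
        presents_boundaries(1)[OF P0] by simp
    show "c0 x \<in> carrier (G n)" "c0 (- x) \<in> carrier (G n)" using presentsD(5)[OF P0] that m by auto
  qed
  have one: "\<one>\<^bsub>G n\<^esub> = c0 0"
    using presentsD(7)[OF P0 subgrpD(1)[OF presentsD(2)[OF P0]]] presents_boundaries(1)[OF P0] by simp
  have sub: "subgroup (c0 ` S) (G n)" if S: "subgrp S" "S \<subseteq> Z0" for S
  proof
    show "c0 ` S \<subseteq> carrier (G n)" using that presentsD(5)[OF P0] by auto
    show "\<one>\<^bsub>G n\<^esub> \<in> c0 ` S" unfolding one using subgrpD(1)[OF S(1)] by auto
    fix x assume "x \<in> c0 ` S"
    then obtain s where s: "s \<in> S" "x = c0 s" by blast
    then have sZ: "s \<in> Z0" using S(2) by blast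
    show "inv\<^bsub>G n\<^esub> x \<in> c0 ` S" unfolding s(2) inv[OF sZ] using subgrpD(3)[OF S(1) s(1)] by auto
    fix y assume "y \<in> c0 ` S"
    then obtain t where t: "t \<in> S" "y = c0 t" by blast
    then have tZ: "t \<in> Z0" using S(2) by blast
    show "x \<otimes>\<^bsub>G n\<^esub> y \<in> c0 ` S"
      unfolding s(2) t(2) presentsD(6)[OF P0 sZ tZ, symmetric] using subgrpD(4)[OF S(1) s(1) t(1)] by auto
  qed
  have "subgrp (\<delta> ` Z1)"
    unfolding subgrp_def
  proof safe
    show "0 \<in> \<delta> ` Z1" using subgrpD(1)[OF presentsD(2)[OF P1]] by (intro image_eqI[of _ _ 0]) (auto simp: \<delta>0)
    fix x y assume "x \<in> Z1" "y \<in> Z1"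
    then show "\<delta> x - \<delta> y \<in> \<delta> ` Z1"
      using subgrpD(2)[OF presentsD(2)[OF P1]] by (intro image_eqI[of _ _ "x - y"]) (auto simp: \<delta>m)
  qed
  then have subI: "subgroup ?I (G n)" unfolding I using d1 by (intro sub) auto
  have subK: "subgroup ?K (G n)" unfolding K by (rule sub[OF Zc]) auto
  have IK: "?I \<subseteq> ?K" unfolding I K using \<delta>Zc by auto
  let ?H = "(G n)\<lparr>carrier := ?K\<rparr>"
  interpret H: comm_group ?H
    by (rule group.group_comm_groupI[OF subgroup.subgroup_is_group[OF subK G.group_axioms]])
      (use subgroup.subset[OF subK] G.m_comm in auto)
  have subIH: "subgroup ?I ?H"
    by (rule G.subgroup_incl[OF subI subK IK])
  interpret N: normal ?I ?H
    by (rule H.subgroup_imp_normal[OF subIH])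
  have coset: "?I #>\<^bsub>?H\<^esub> a = ?I #>\<^bsub>G n\<^esub> a" for a by (simp add: r_coset_def)
  have cK: "c0 x \<in> carrier ?H" if "x \<in> ?Zc" for x using that K by auto
  have hom: "homology G d n = ?H Mod ?I" by (simp add: homology_def)
  \<comment> \<open>\<open>d n\<close> is defined on classes, so \<open>\<delta>\<close> must
    respect the boundaries already divided out.\<close>
  have B0: "\<delta> x \<in> Bm" if "x \<in> B0" for x
  proof -
    have x: "x \<in> Z0" using that presentsD(3)[OF P0] by auto
    have "cm (\<delta> x) = cm (\<delta> 0)"
      using d0[OF x] d0[OF subgrpD(1)[OF presentsD(2)[OF P0]]] presentsD(7)[OF P0 x] that one by simp
    then show ?thesis
      using presents_eq[OF Pm, of "\<delta> x" "\<delta> 0"] d0[OF x] d0[OF subgrpD(1)[OF presentsD(2)[OF P0]]] by (simp add: \<delta>0)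
  qed
  show ?thesis
    unfolding presents_def hom
  proof (intro conjI ballI)
    show "group (?H Mod ?I)" by (rule N.factorgroup_is_group)
    show "subgrp ?Zc" by (rule Zc)
    show "{x \<in> Z0. \<exists>y\<in>Z1. x - \<delta> y \<in> B0} \<subseteq> ?Zc"
    proof safe
      fix x y assume x: "x \<in> Z0" "y \<in> Z1" "x - \<delta> y \<in> B0"
      from presents_boundaries(4)[OF Pm B0[OF x(3)] dd[OF x(2)]] show "\<delta> x \<in> Bm" by (simp add: \<delta>m)
    qed
    show "(\<lambda>x. ?I #>\<^bsub>G n\<^esub> c0 x) ` ?Zc = carrier (?H Mod ?I)"
    proof -
      have "carrier ?H = c0 ` ?Zc" unfolding K[symmetric] by simp
      then show ?thesis unfolding carrier_FactGroup image_image coset by (simp add: image_image)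
    qed
    fix x assume x: "x \<in> ?Zc"
    show "?I #>\<^bsub>G n\<^esub> c0 x = \<one>\<^bsub>?H Mod ?I\<^esub> \<longleftrightarrow> x \<in> {x \<in> Z0. \<exists>y\<in>Z1. x - \<delta> y \<in> B0}"
    proof -
      have "?I #>\<^bsub>?H\<^esub> c0 x = ?I \<longleftrightarrow> c0 x \<in> ?I"
        using H.coset_join1[OF _ cK[OF x] subIH] H.coset_join2[OF cK[OF x] subIH] N.subset by blast
      also have "\<dots> \<longleftrightarrow> (\<exists>y\<in>Z1. c0 x = c0 (\<delta> y))" unfolding I by auto
      also have "\<dots> \<longleftrightarrow> (\<exists>y\<in>Z1. x - \<delta> y \<in> B0)"
        using presents_eq[OF P0] x d1 by auto
      finally show ?thesis using x by (simp add: coset)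
    qed
    fix y assume y: "y \<in> ?Zc"
    show "?I #>\<^bsub>G n\<^esub> c0 (x + y) = (?I #>\<^bsub>G n\<^esub> c0 x) \<otimes>\<^bsub>?H Mod ?I\<^esub> (?I #>\<^bsub>G n\<^esub> c0 y)"
      using N.rcos_sum[OF cK[OF x] cK[OF y]] presentsD(6)[OF P0, of x y] x y by (simp add: coset)
  qed
qed

text \<open>Homomorphisms between presented groups are given by additive relations between representatives.\<close>

definition induced :: "('a \<Rightarrow> 'g) \<Rightarrow> ('b \<Rightarrow> 'h) \<Rightarrow> ('a \<times> 'b) set \<Rightarrow> 'g \<Rightarrow> 'h" where
  "induced c c' R X = (THE Y. \<exists>a b. (a, b) \<in> R \<and> X = c a \<and> Y = c' b)"

locale induced_hom =
  fixes G :: "'g monoid" and c :: "'a :: ab_group_add \<Rightarrow> 'g" and Z B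
    and H :: "'h monoid" and c' :: "'b :: ab_group_add \<Rightarrow> 'h" and Z' B' and R :: "('a \<times> 'b) set"
  assumes G: "presents G c Z B" and H: "presents H c' Z' B'"
    and R_sub: "R \<subseteq> Z \<times> Z'" and R_diff: "(a, b) \<in> R \<Longrightarrow> (a', b') \<in> R \<Longrightarrow> (a - a', b - b') \<in> R"
    and R_total: "a \<in> Z \<Longrightarrow> \<exists>b. (a, b) \<in> R"
    and R_boundary: "(a, b) \<in> R \<Longrightarrow> a \<in> B \<Longrightarrow> b \<in> B'"
begin

lemma induced_eq:
  assumes "(a, b) \<in> R"
  shows "induced c c' R (c a) = c' b"
  unfolding induced_def
proof (rule the_equality)
  show "\<exists>a' b'. (a', b') \<in> R \<and> c a = c a' \<and> c' b = c' b'" using assms by blast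
  fix Y assume "\<exists>a' b'. (a', b') \<in> R \<and> c a = c a' \<and> Y = c' b'"
  then obtain a' b' where ab: "(a', b') \<in> R" "c a = c a'" "Y = c' b'" by blast
  then have "a' - a \<in> B" using presents_eq[OF G, of a' a] assms R_sub by auto
  then have "b' - b \<in> B'" by (rule R_boundary[OF R_diff[OF ab(1) assms]])
  then show "Y = c' b" using presents_eq[OF H, of b' b] ab assms R_sub by auto
qed

lemma induced_group_hom: "group_hom G H (induced c c' R)"
proof (intro group_hom.intro group_hom_axioms.intro presentsD(1)[OF G] presentsD(1)[OF H] homI)
  fix x assume "x \<in> carrier G"
  then obtain a where a: "a \<in> Z" "x = c a" unfolding presentsD(4)[OF G, symmetric] by blast
  then obtain b where b: "(a, b) \<in> R" using R_total by blast
  then show "induced c c' R x \<in> carrier H"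
    using induced_eq[OF b] presentsD(5)[OF H] R_sub a by auto
  fix y assume "y \<in> carrier G"
  then obtain a' where a': "a' \<in> Z" "y = c a'" unfolding presentsD(4)[OF G, symmetric] by blast
  then obtain b' where b': "(a', b') \<in> R" using R_total by blast
  \<comment> \<open>Closure of \<open>R\<close> is assumed for differences only; the sum is the
    difference with a negative.\<close>
  have "(a - (0 - a'), b - (0 - b')) \<in> R"
    using R_diff[OF b R_diff[OF R_diff[OF b' b'] b']] by simp
  then have ab: "(a + a', b + b') \<in> R" by simp
  show "induced c c' R (x \<otimes>\<^bsub>G\<^esub> y) = induced c c' R x \<otimes>\<^bsub>H\<^esub> induced c c' R y"
    using induced_eq[OF b] induced_eq[OF b'] induced_eq[OF ab] presentsD(6)[OF G a(1) a'(1)]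
      presentsD(6)[OF H, of b b'] b b' R_sub a a' by auto
qed

end

text \<open>Exactness is tested on representatives. In \<open>ker\<close> a single boundary
  \<open>z\<close> related to \<open>b\<close> suffices, since every other choice lies in the same
  class.\<close>

lemma exact_at_induced:
  assumes R: "induced_hom G c Z B H c' Z' B' R" and S: "induced_hom H c' Z' B' L c'' Z'' B'' S"
    and ker: "\<And>a b. (a, b) \<in> R \<Longrightarrow> \<exists>z. (b, z) \<in> S \<and> z \<in> B''"
    and im: "\<And>b z. (b, z) \<in> S \<Longrightarrow> z \<in> B'' \<Longrightarrow> \<exists>a b'. (a, b') \<in> R \<and> b - b' \<in> B'"
  shows "exact_at G (induced c c' R) H (induced c' c'' S) L"
proof -
  interpret R: induced_hom G c Z B H c' Z' B' R by (rule R)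
  interpret S: induced_hom H c' Z' B' L c'' Z'' B'' S by (rule S)
  have "induced c c' R ` carrier G = kernel H L (induced c' c'' S)"
  proof safe
    fix x assume "x \<in> carrier G"
    then obtain a where a: "a \<in> Z" "x = c a" unfolding presentsD(4)[OF R.G, symmetric] by blast
    then obtain b where b: "(a, b) \<in> R" using R.R_total by blast
    obtain z where z: "(b, z) \<in> S" "z \<in> B''" using ker[OF b] by blast
    then show "induced c c' R x \<in> kernel H L (induced c' c'' S)"
      using R.induced_eq[OF b] S.induced_eq[OF z(1)] presentsD(7)[OF S.H, of z] presentsD(5)[OF S.G, of b]
        S.R_sub by (auto simp: kernel_def a)
  next
    fix y assume y: "y \<in> kernel H L (induced c' c'' S)"
    then have "y \<in> carrier H" by (simp add: kernel_def)
    then obtain b where b: "b \<in> Z'" "y = c' b" unfolding presentsD(4)[OF S.G, symmetric] by blast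
    obtain z where z: "(b, z) \<in> S" using S.R_total[OF b(1)] by blast
    then have "z \<in> B''"
      using y S.induced_eq[OF z] presentsD(7)[OF S.H, of z] S.R_sub by (auto simp: kernel_def b)
    then obtain a b' where ab: "(a, b') \<in> R" "b - b' \<in> B'" using im[OF z] by blast
    then have "y = c' b'" using presents_eq[OF R.H b(1), of b'] R.R_sub by (auto simp: b)
    then have "y = induced c c' R (c a)" using R.induced_eq[OF ab(1)] by simp
    then show "y \<in> induced c c' R ` carrier G"
      using presentsD(5)[OF R.G, of a] ab R.R_sub by auto
  qed
  then show ?thesis
    unfolding exact_at_def using R.induced_group_hom S.induced_group_hom by simp
qed

section \<open>The long exact sequence\<close>

text \<open>Exactness of the columns in degrees at least 2 is all that the long exact sequence takes
  from the path category.\<close>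

locale acyclic_columns = matched_pair M for M :: "('o, 'c, 'd) matched_data" +
  assumes columns_acyclic: "\<lbrakk>z \<in> carrier (Cpq M p q); q \<ge> 2; dv M z = 0\<rbrakk>
    \<Longrightarrow> \<exists>y\<in>carrier (Cpq M p (q + 1)). dv M y = z"
begin

section \<open>Chains of the total complex and their components\<close>

abbreviation CC :: "int \<Rightarrow> int \<Rightarrow> (('o, 'c, 'd) bitup \<Rightarrow>\<^sub>0 int) set" where
  "CC p q \<equiv> carrier (Cpq M p q)"

definition prj :: "int \<Rightarrow> (('o, 'c, 'd) bitup \<Rightarrow>\<^sub>0 int) \<Rightarrow> (('o, 'c, 'd) bitup \<Rightarrow>\<^sub>0 int)" where
  "prj p = frag_extend (\<lambda>x. if int (length (fst x)) = p then frag_of x else 0)"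

definition total_chains :: "int \<Rightarrow> (('o, 'c, 'd) bitup \<Rightarrow>\<^sub>0 int) set" where
  "total_chains n = {z. Poly_Mapping.keys z \<subseteq> total_bituples n}"

lemma CC_iff: "z \<in> CC p q \<longleftrightarrow> Poly_Mapping.keys z \<subseteq> bituples M p q"
  by (simp add: Cpq_def)

lemma subgrp_CC: "subgrp (CC p q)"
  by (auto simp: subgrp_def CC_iff keys_diff_subset)

lemma subgrp_total: "subgrp (total_chains n)"
  by (auto simp: subgrp_def total_chains_def keys_diff_subset)

lemmas CC_closed = subgrpD[OF subgrp_CC]
lemmas total_chains_closed = subgrpD[OF subgrp_total]

lemma CC_zero: "z \<in> CC p q \<Longrightarrow> p < 0 \<or> q < 0 \<Longrightarrow> z = 0"
proof -
  assume z: "z \<in> CC p q" "p < 0 \<or> q < 0"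
  then have "bituples M p q = {}" using bituples_nonneg by fastforce
  with z(1) show "z = 0" by (simp add: CC_iff)
qed

lemma CC_total: "z \<in> CC p q \<Longrightarrow> n = p + q \<Longrightarrow> z \<in> total_chains n"
proof -
  assume "z \<in> CC p q" "n = p + q"
  moreover from this have "bituples M p q \<subseteq> total_bituples n" by (auto simp: total_bituples_def bituples_eq)
  ultimately show "z \<in> total_chains n" by (auto simp: CC_iff total_chains_def)
qed

lemma prj_linear [simp]: "prj p 0 = 0" "prj p (a + b) = prj p a + prj p b" "prj p (a - b) = prj p a - prj p b"
  "prj p (- a) = - prj p a"
  by (simp_all add: prj_def frag_linear)

lemma total_chains_induct [consumes 1, case_names zero gen diff]:
  assumes "z \<in> total_chains n" "P 0" "\<And>p x. x \<in> bituples M p (n - p) \<Longrightarrow> P (frag_of x)" "\<And>a b. P a \<Longrightarrow> P b \<Longrightarrow> P (a - b)"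
  shows "P z"
  using assms(1) unfolding total_chains_def mem_Collect_eq
  by (rule frag_induction) (use assms in \<open>auto simp: total_bituples_Un\<close>)

lemma prj_CC: "z \<in> CC p q \<Longrightarrow> prj p' z = (if p' = p then z else 0)"
  unfolding CC_iff
proof (induction rule: frag_induction)
  case (one x)
  then show ?case by (auto simp: prj_def bituples_eq)
qed auto

lemma prj_total: "z \<in> total_chains n \<Longrightarrow> prj p z \<in> CC p (n - p)"
proof (induction rule: total_chains_induct)
  case zero
  show ?case using CC_closed(1) by simp
next
  case (gen p' x)
  then have "frag_of x \<in> CC p' (n - p')" by (simp add: CC_iff)
  then show ?case using prj_CC[of "frag_of x" p' "n - p'" p] CC_closed(1) by auto
next
  case (diff a b)
  then show ?case using CC_closed(2) by simp
qed

lemma prj_dv: "z \<in> total_chains n \<Longrightarrow> prj p (dv M z) = dv M (prj p z)"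
proof (induction rule: total_chains_induct)
  case (gen p' x)
  then have x: "frag_of x \<in> CC p' (n - p')" by (simp add: CC_iff)
  show ?case using prj_CC[OF x] prj_CC[OF dv_Cpq[OF x]] by simp
qed auto

lemma prj_dh: "z \<in> total_chains n \<Longrightarrow> prj p (dh M z) = dh M (prj (p + 1) z)"
proof (induction rule: total_chains_induct)
  case (gen p' x)
  then have x: "frag_of x \<in> CC p' (n - p')" by (simp add: CC_iff)
  show ?case using prj_CC[OF x] prj_CC[OF dh_Cpq[OF x]] by auto
qed auto

lemma prj_eq_0:
  assumes "z \<in> total_chains n" "\<And>p. prj p z = 0"
  shows "z = 0"
proof -
  have l: "Poly_Mapping.lookup (prj p z) x = (if int (length (fst x)) = p then Poly_Mapping.lookup z x else 0)" for p x
    using subset_UNIV[of "Poly_Mapping.keys z"]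
    by (induction rule: frag_induction) (auto simp: lookup_minus, auto simp: prj_def)
  show ?thesis
  proof (rule poly_mapping_eqI)
    fix x
    show "Poly_Mapping.lookup z x = Poly_Mapping.lookup 0 x"
      using l[of "int (length (fst x))" x] assms(2) by simp
  qed
qed

lemma dd_total: "z \<in> total_chains n \<Longrightarrow> dh M (dh M z) = 0" "z \<in> total_chains n \<Longrightarrow> dv M (dv M z) = 0"
  "z \<in> total_chains n \<Longrightarrow> dh M (dv M z) = - dv M (dh M z)"
  using double_complex unfolding total_chains_def by blast+

lemma dd_CC: "z \<in> CC p q \<Longrightarrow> dh M (dh M z) = 0" "z \<in> CC p q \<Longrightarrow> dv M (dv M z) = 0"
  "z \<in> CC p q \<Longrightarrow> dh M (dv M z) = - dv M (dh M z)"
  using dd_total CC_total by blast+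

lemma dv_dh_zero: "z \<in> CC p q \<Longrightarrow> dv M z = 0 \<Longrightarrow> dv M (dh M z) = 0"
  using dd_CC(3)[of z p q] by simp

lemma dh_total: "z \<in> total_chains n \<Longrightarrow> dh M z \<in> total_chains (n - 1)"
proof (induction rule: total_chains_induct)
  case (gen p x)
  then have "frag_of x \<in> CC p (n - p)" by (simp add: CC_iff)
  from CC_total[OF dh_Cpq[OF this]] show ?case by simp
qed (auto intro: total_chains_closed)

lemma dv_total: "z \<in> total_chains n \<Longrightarrow> dv M z \<in> total_chains (n - 1)"
proof (induction rule: total_chains_induct)
  case (gen p x)
  then have "frag_of x \<in> CC p (n - p)" by (simp add: CC_iff)
  from CC_total[OF dv_Cpq[OF this]] show ?case by simp
qed (auto intro: total_chains_closed)

definition total_bd :: "(('o, 'c, 'd) bitup \<Rightarrow>\<^sub>0 int) \<Rightarrow> (('o, 'c, 'd) bitup \<Rightarrow>\<^sub>0 int)" where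
  "total_bd z = dh M z + dv M z"

lemma total_bd_linear: "total_bd 0 = 0" "total_bd (a + b) = total_bd a + total_bd b" "total_bd (a - b) = total_bd a - total_bd b" "total_bd (- a) = - total_bd a"
  by (simp_all add: total_bd_def)

lemma total_bd_total_bd: "z \<in> total_chains n \<Longrightarrow> total_bd (total_bd z) = 0"
  using dd_total by (simp add: total_bd_def)

lemma total_bd_total: "z \<in> total_chains n \<Longrightarrow> total_bd z \<in> total_chains (n - 1)"
  unfolding total_bd_def using dh_total dv_total total_chains_closed(4) by blast

lemma prj_total_bd: "z \<in> total_chains n \<Longrightarrow> prj p (total_bd z) = dh M (prj (p + 1) z) + dv M (prj p z)"
  by (simp add: total_bd_def prj_dh prj_dv)

section \<open>The filtration of the total complex by horizontal degree\<close>

definition filt :: "int \<Rightarrow> int \<Rightarrow> (('o, 'c, 'd) bitup \<Rightarrow>\<^sub>0 int) set" where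
  "filt n p = {z \<in> total_chains n. \<forall>p'>p. prj p' z = 0}"

lemma subgrp_filt: "subgrp (filt n p)"
  by (auto simp: subgrp_def filt_def total_chains_closed)

lemmas filt_closed = subgrpD[OF subgrp_filt]

lemma filt_total: "z \<in> filt n p \<Longrightarrow> z \<in> total_chains n"
  by (simp add: filt_def)

lemma filt_mono: "z \<in> filt n p \<Longrightarrow> p \<le> p' \<Longrightarrow> z \<in> filt n p'"
  by (auto simp: filt_def)

lemma CC_filt: "z \<in> CC p q \<Longrightarrow> n = p + q \<Longrightarrow> p \<le> p' \<Longrightarrow> z \<in> filt n p'"
  using CC_total[of z p q n] prj_CC[of z p q] by (auto simp: filt_def)

lemma filt_zero:
  assumes "z \<in> filt n p" "p < 0"
  shows "z = 0"
proof (rule prj_eq_0)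
  show "z \<in> total_chains n" using assms by (simp add: filt_def)
  fix p'
  show "prj p' z = 0"
    using assms prj_total[OF filt_total[OF assms(1)], of p'] CC_zero[of "prj p' z" p' "n - p'"]
    by (cases "p' < 0") (auto simp: filt_def)
qed

lemma total_filt: "z \<in> total_chains n \<Longrightarrow> z \<in> filt n n"
  using prj_total[of z n] CC_zero by (force simp: filt_def)

lemma filt_step:
  assumes "z \<in> filt n p"
  shows "z - prj p z \<in> filt n (p - 1)"
proof -
  have z: "z \<in> total_chains n" using assms by (simp add: filt_def)
  have c: "prj p z \<in> CC p (n - p)" by (rule prj_total[OF z])
  have "prj p' (z - prj p z) = 0" if "p' > p - 1" for p'
    using that assms prj_CC[OF c, of p'] by (cases "p' = p") (auto simp: filt_def)
  moreover have "prj p z \<in> total_chains n" by (rule CC_total[OF c]) simp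
  ultimately show ?thesis
    using total_chains_closed(2)[OF z] unfolding filt_def by blast
qed

text \<open>The components are killed one by one, in the order of decreasing \<open>p\<close>.\<close>

lemma filt_exact:
  assumes "z \<in> filt n p" "n - p \<ge> 2" "total_bd z = 0"
  shows "\<exists>y\<in>filt (n + 1) p. total_bd y = z"
proof -
  \<comment> \<open>The bound \<open>int k - 1\<close> leaves room for the \<open>k\<close>
    components of degrees 0 to \<open>k - 1\<close>. Lowering \<open>p\<close> raises the vertical
    degree \<open>n - p\<close>, so the columns remain exact throughout.\<close>
  have "\<exists>y\<in>filt (n + 1) (int k - 1). total_bd y = z"
    if "z \<in> filt n (int k - 1)" "n - (int k - 1) \<ge> 2" "total_bd z = 0" for k z
    using that
  proof (induction k arbitrary: z)
    case 0
    then have "z = 0" using filt_zero by auto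
    then show ?case using filt_closed(1) by (intro bexI[of _ 0]) (auto simp: total_bd_linear)
  next
    case (Suc k)
    let ?p = "int k"
    have z: "z \<in> filt n ?p" "z \<in> total_chains n" using Suc.prems by (auto simp: filt_def)
    have c: "prj ?p z \<in> CC ?p (n - ?p)" by (rule prj_total[OF z(2)])
    \<comment> \<open>Component \<open>?p\<close> of \<open>total_bd z = 0\<close>: the horizontal
      contribution comes from component \<open>?p + 1\<close>, which vanishes by the
      filtration.\<close>
    have "dv M (prj ?p z) = 0"
      using prj_total_bd[OF z(2), of ?p] Suc.prems(3) z(1) by (simp add: filt_def)
    then obtain y where y: "y \<in> CC ?p (n - ?p + 1)" "dv M y = prj ?p z"
      using columns_acyclic[OF c] Suc.prems(2) by auto
    have yf: "y \<in> filt (n + 1) ?p" by (rule CC_filt[OF y(1)]) auto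
    have "z - prj ?p z - dh M y \<in> filt n (?p - 1)"
      by (rule filt_closed(2)[OF filt_step[OF z(1)] CC_filt[OF dh_Cpq[OF y(1)]]]) auto
    moreover have "z - total_bd y = z - prj ?p z - dh M y"
      using y(2) by (simp add: total_bd_def algebra_simps)
    ultimately have f: "z - total_bd y \<in> filt n (?p - 1)" by (simp only:)
    have "total_bd (z - total_bd y) = 0"
      using Suc.prems(3) total_bd_total_bd[OF filt_total[OF yf]] by (simp add: total_bd_linear)
    with Suc.IH[OF f] Suc.prems(2) obtain w where w: "w \<in> filt (n + 1) (?p - 1)" "total_bd w = z - total_bd y"
      by auto
    have "y + w \<in> filt (n + 1) ?p"
      by (rule filt_closed(4)[OF yf filt_mono[OF w(1)]]) simp
    then show ?case
      using w(2) by (intro bexI[of _ "y + w"]) (auto simp: total_bd_linear)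
  qed
  from this[of z "nat (p + 1)"] show ?thesis
    using assms filt_zero[OF assms(1)] filt_closed(1)[of "n + 1" p]
    by (cases "p < 0") (auto simp: total_bd_linear intro: bexI[of _ 0])
qed

section \<open>The second page and the product homology, presented by chains\<close>

definition E2_cycles :: "int \<Rightarrow> int \<Rightarrow> (('o, 'c, 'd) bitup \<Rightarrow>\<^sub>0 int) set" where
  "E2_cycles p q = {x \<in> CC p q. dv M x = 0 \<and> (\<exists>y\<in>CC (p - 1) (q + 1). dh M x + dv M y = 0)}"

definition E2_boundaries :: "int \<Rightarrow> int \<Rightarrow> (('o, 'c, 'd) bitup \<Rightarrow>\<^sub>0 int) set" where
  "E2_boundaries p q = {x \<in> CC p q. dv M x = 0 \<and>
     (\<exists>y\<in>CC p (q + 1). \<exists>z\<in>CC (p + 1) q. dv M z = 0 \<and> x = dv M y + dh M z)}"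

lemma dv_E2_boundaries:
  assumes "s \<in> CC p (q + 1)"
  shows "dv M s \<in> E2_boundaries p q"
proof -
  have "dv M s \<in> CC p q" using dv_Cpq[OF assms] by simp
  moreover have "dv M (dv M s) = 0" by (rule dd_CC(2)[OF assms])
  moreover have "dv M s = dv M s + dh M 0" "dv M 0 = 0" by simp_all
  moreover have "0 \<in> CC (p + 1) q" by (rule CC_closed(1))
  ultimately show ?thesis unfolding E2_boundaries_def using assms by blast
qed

lemma presents_Hv:
  "presents (Hv M p q) (Hv_class M p q) {x \<in> CC p q. dv M x = 0} {x \<in> CC p q. \<exists>y\<in>CC p (q + 1). x = dv M y}"
proof -
  have P: "presents (Cpq M p q) (\<lambda>x. x) (CC p q) {0}" for q
    unfolding Cpq_def by (rule presents_free)
  have "presents (homology (Cpq M p) (\<lambda>_. dv M) q)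
      (\<lambda>x. (dv M ` carrier (Cpq M p (q + 1))) #>\<^bsub>Cpq M p q\<^esub> x)
      {x \<in> CC p q. dv M x \<in> {0}} {x \<in> CC p q. \<exists>y\<in>CC p (q + 1). x - dv M y \<in> {0}}"
  proof (rule presents_homology[where d = "\<lambda>_. dv M", OF P P P])
    show "\<And>x. x \<in> CC p (q + 1) \<Longrightarrow> dv M x \<in> CC p q \<and> dv M x = dv M x"
      using dv_Cpq by fastforce
    show "\<And>x. x \<in> CC p (q + 1) \<Longrightarrow> dv M (dv M x) \<in> {0}"
      using dd_CC(2) by blast
  qed (use dv_Cpq in auto)
  then show ?thesis
    unfolding Hv_def Hv_class_def[abs_def] by simp
qed

text \<open>Representatives of a vertical class differ by some \<open>dv M y\<close>, and
  \<open>dh M (dv M y) = dv M (- dh M y)\<close> is a vertical boundary again; so the classes united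
  in \<open>dh_induced\<close> coincide.\<close>

lemma dh_induced_class:
  assumes x: "x \<in> CC p q" "dv M x = 0"
  shows "dh_induced M p q (Hv_class M p q x) = Hv_class M (p - 1) q (dh M x)"
proof -
  have "Hv_class M (p - 1) q (dh M x') = Hv_class M (p - 1) q (dh M x)" if x': "x' \<in> Hv_class M p q x" for x'
  proof -
    obtain y where y: "y \<in> CC p (q + 1)" "x' = dv M y + x"
      using x' by (auto simp: Hv_class_def r_coset_def Cpq_def)
    have eq: "dh M x' - dh M x = dv M (- dh M y)"
      using dd_CC(3)[OF y(1)] y(2) by simp
    have dy: "- dh M y \<in> CC (p - 1) (q + 1)" using CC_closed(3)[OF dh_Cpq[OF y(1)]] .
    have dx: "dh M x \<in> {x \<in> CC (p - 1) q. dv M x = 0}"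
      using dh_Cpq[OF x(1)] dd_CC(3)[OF x(1)] x(2) by auto
    have "dh M x' - dh M x \<in> {x \<in> CC (p - 1) q. dv M x = 0}"
      unfolding eq using dv_Cpq[OF dy] dd_CC(2)[OF dy] by auto
    then have dx': "dh M x' \<in> {x \<in> CC (p - 1) q. dv M x = 0}"
      using CC_closed(4)[of "dh M x' - dh M x" "p - 1" q "dh M x"] dx by auto
    show ?thesis
      unfolding presents_eq[OF presents_Hv dx' dx] eq
      using dv_Cpq[OF dy, unfolded add_diff_cancel_right'] dy by blast
  qed
  moreover have "x \<in> Hv_class M p q x"
    unfolding Hv_class_def r_coset_def using CC_closed(1)[of p "q + 1"]
    by (auto simp: Cpq_def intro!: bexI[of _ 0])
  ultimately show ?thesis
    unfolding dh_induced_def by blast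
qed

lemma presents_E2: "presents (E2 M p q) (E2_class M p q) (E2_cycles p q) (E2_boundaries p q)"
proof -
  let ?Z = "\<lambda>p. {x \<in> CC p q. dv M x = 0}" and ?B = "\<lambda>p. {x \<in> CC p q. \<exists>y\<in>CC p (q + 1). x = dv M y}"
  have dh: "dh M x \<in> ?Z (p - 1)" if "x \<in> ?Z p" for p x
    using that dh_Cpq[of x p q] dv_dh_zero[of x p q] by auto
  have "presents (homology (\<lambda>p'. Hv M p' q) (\<lambda>p'. dh_induced M p' q) p)
      (\<lambda>x. (dh_induced M (p + 1) q ` carrier (Hv M (p + 1) q)) #>\<^bsub>Hv M p q\<^esub> Hv_class M p q x)
      {x \<in> ?Z p. dh M x \<in> ?B (p - 1)} {x \<in> ?Z p. \<exists>y\<in>?Z (p + 1). x - dh M y \<in> ?B p}"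
  proof (rule presents_homology[where G = "\<lambda>p'. Hv M p' q", OF presents_Hv presents_Hv presents_Hv])
    show "dh M x \<in> ?Z p \<and> dh_induced M (p + 1) q (Hv_class M (p + 1) q x) = Hv_class M p q (dh M x)"
      if "x \<in> ?Z (p + 1)" for x
      using dh[OF that] dh_induced_class[of x "p + 1" q] that by auto
    show "dh M x \<in> ?Z (p - 1) \<and> dh_induced M p q (Hv_class M p q x) = Hv_class M (p - 1) q (dh M x)"
      if "x \<in> ?Z p" for x
      using dh[OF that] dh_induced_class[of x p q] that by auto
    show "dh M (x + y) = dh M x + dh M y" for x y by simp
    show "dh M (dh M x) \<in> ?B (p - 1)" if "x \<in> ?Z (p + 1)" for x
      using dd_CC(1)[of x "p + 1" q] that CC_closed(1) by (auto intro!: bexI[of _ 0])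
  qed
  moreover have "{x \<in> ?Z p. dh M x \<in> ?B (p - 1)} = E2_cycles p q"
  proof -
    have "(\<exists>y\<in>CC (p - 1) (q + 1). dh M x = dv M y) \<longleftrightarrow> (\<exists>y\<in>CC (p - 1) (q + 1). dh M x + dv M y = 0)" for x
      using CC_closed(3) by (metis add.inverse_inverse add_eq_0_iff2 dv_linear(3))
    then show ?thesis using dh_Cpq by (auto simp: E2_cycles_def)
  qed
  moreover have "{x \<in> ?Z p. \<exists>y\<in>?Z (p + 1). x - dh M y \<in> ?B p} = E2_boundaries p q"
  proof safe
    fix x y z assume a: "x \<in> CC p q" "dv M x = 0" "y \<in> CC (p + 1) q" "dv M y = 0" "x - dh M y = dv M z" "z \<in> CC p (q + 1)"
    from a(5) have "x = dv M z + dh M y" by (simp add: algebra_simps)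
    with a show "x \<in> E2_boundaries p q" unfolding E2_boundaries_def by blast
  next
    fix x assume "x \<in> E2_boundaries p q"
    then obtain y z where a: "x \<in> CC p q" "dv M x = 0" "y \<in> CC p (q + 1)" "z \<in> CC (p + 1) q" "dv M z = 0" "x = dv M y + dh M z"
      unfolding E2_boundaries_def by blast
    then show "x \<in> CC p q" "dv M x = 0" "\<exists>y\<in>?Z (p + 1). x - dh M y \<in> ?B p"
      using dv_Cpq[OF a(3)] by (auto intro!: bexI[of _ z] bexI[of _ y])
  qed
  ultimately show ?thesis
    unfolding E2_def E2_class_def[abs_def] by simp
qed

lemma presents_cat_homology:
  "presents (H_bowtie M n) (\<lambda>x. zs_boundaries n #>\<^bsub>cat_chains (zs_product M) n\<^esub> x) (zs_cycles n) (zs_boundaries n)"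
proof -
  let ?C = "\<lambda>n. carrier (cat_chains (zs_product M) n)" and ?b = "cat_boundary (zs_product M)"
  have P: "presents (cat_chains (zs_product M) n) (\<lambda>x. x) (?C n) {0}" for n
    unfolding cat_chains_def by (rule presents_free)
  have "presents (homology (cat_chains (zs_product M)) (\<lambda>_. ?b) n)
      (\<lambda>x. (?b ` ?C (n + 1)) #>\<^bsub>cat_chains (zs_product M) n\<^esub> x)
      {x \<in> ?C n. ?b x \<in> {0}} {x \<in> ?C n. \<exists>y\<in>?C (n + 1). x - ?b y \<in> {0}}"
  proof (rule presents_homology[where d = "\<lambda>_. ?b", OF P P P])
    show "\<And>x. x \<in> ?C (n + 1) \<Longrightarrow> ?b x \<in> ?C n \<and> ?b x = ?b x"
      using K.cat_boundary_chains by fastforce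
    show "\<And>x. x \<in> ?C n \<Longrightarrow> ?b x \<in> ?C (n - 1) \<and> ?b x = ?b x"
      using K.cat_boundary_chains by blast
    show "?b (x + y) = ?b x + ?b y" for x y
      by (simp add: cat_boundary_def frag_linear)
    show "\<And>x. x \<in> ?C (n + 1) \<Longrightarrow> ?b (?b x) \<in> {0}"
      using K.cat_boundary_squared by blast
  qed
  moreover have "{x \<in> ?C n. \<exists>y\<in>?C (n + 1). x - ?b y \<in> {0}} = ?b ` ?C (n + 1)"
    using K.cat_boundary_chains[of _ "n + 1"] by auto
  ultimately show ?thesis
    by (simp add: H_bowtie_def cat_homology_def zs_cycles_def zs_boundaries_def)
qed

lemma tot_cycles_iff: "z \<in> tot_cycles n \<longleftrightarrow> z \<in> total_chains n \<and> total_bd z = 0"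
  by (simp add: tot_cycles_def total_chains_def total_bd_def)

lemma tot_boundaries_iff: "z \<in> tot_boundaries n \<longleftrightarrow> (\<exists>y\<in>total_chains (n + 1). z = total_bd y)"
  by (auto simp: tot_boundaries_def total_chains_def total_bd_def)

lemma subgrp_tot_cycles: "subgrp (tot_cycles n)"
  by (auto simp: subgrp_def tot_cycles_iff total_chains_closed total_bd_linear)

text \<open>This stands in for the convergence of the spectral sequence: from here on the product
  homology is represented by cycles of the total complex.\<close>

lemma presents_H_bowtie:
  "\<exists>cls. \<forall>n. presents (H_bowtie M n) (cls n) (tot_cycles n) (tot_boundaries n)"
proof -
  obtain \<Phi> where \<Phi>: "\<And>n z z'. \<Phi> n (z + z') = \<Phi> n z + \<Phi> n z'"
     "\<And>n z. z \<in> tot_cycles n \<Longrightarrow> \<Phi> n z \<in> zs_cycles n \<and> (\<Phi> n z \<in> zs_boundaries n \<longleftrightarrow> z \<in> tot_boundaries n)"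
     "\<And>n y. y \<in> zs_cycles n \<Longrightarrow> \<exists>z\<in>tot_cycles n. y - \<Phi> n z \<in> zs_boundaries n"
    using total_quasi_isomorphism by blast
  have "presents (H_bowtie M n) (\<lambda>z. zs_boundaries n #>\<^bsub>cat_chains (zs_product M) n\<^esub> \<Phi> n z)
     (tot_cycles n) (tot_boundaries n)" for n
  proof (rule presents_transfer[where \<Phi> = "\<Phi> n", OF presents_cat_homology subgrp_tot_cycles \<Phi>(1)])
    show "tot_boundaries n \<subseteq> tot_cycles n"
      using total_bd_total total_bd_total_bd by (fastforce simp: tot_cycles_iff tot_boundaries_iff)
  qed (use \<Phi>(2,3) in auto)
  then show ?thesis
    by (intro exI[of _ "\<lambda>n z. zs_boundaries n #>\<^bsub>cat_chains (zs_product M) n\<^esub> \<Phi> n z"] allI)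
qed

text \<open>The edge map out of the row \<open>q = 1\<close>: components of lower horizontal degree
  complete a second-page cycle to a total cycle. The completion is not unique, hence a
  relation.\<close>

definition rel_i :: "int \<Rightarrow> ((('o, 'c, 'd) bitup \<Rightarrow>\<^sub>0 int) \<times> (('o, 'c, 'd) bitup \<Rightarrow>\<^sub>0 int)) set" where
  "rel_i n = {(y, x). y \<in> E2_cycles (n - 1) 1 \<and> x \<in> filt n (n - 1) \<and> total_bd x = 0 \<and> prj (n - 1) x = y}"

text \<open>The edge map to the row \<open>q = 0\<close>, which takes the component of highest
  horizontal degree.\<close>

definition rel_e :: "int \<Rightarrow> ((('o, 'c, 'd) bitup \<Rightarrow>\<^sub>0 int) \<times> (('o, 'c, 'd) bitup \<Rightarrow>\<^sub>0 int)) set" where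
  "rel_e n = {(x, prj n x) |x. x \<in> tot_cycles n}"

definition rel_d :: "int \<Rightarrow> ((('o, 'c, 'd) bitup \<Rightarrow>\<^sub>0 int) \<times> (('o, 'c, 'd) bitup \<Rightarrow>\<^sub>0 int)) set" where
  "rel_d p = {(x, dh M y) |x y. x \<in> CC p 0 \<and> y \<in> CC (p - 1) 1 \<and> dv M x = 0 \<and> dh M x + dv M y = 0}"

lemma dv_CC0: "x \<in> CC p 0 \<Longrightarrow> dv M x = 0"
  using dv_Cpq[of x p 0] CC_zero by auto

text \<open>For \<open>q = 0\<close> the description in \<open>d2\<close> ranges over exactly the
  pairs in \<open>rel_d\<close>, so its well-definedness reduces to properties of that
  relation.\<close>

lemma d2_induced: "d2 M p 0 = induced (E2_class M p 0) (E2_class M (p - 2) 1) (rel_d p)"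
proof
  fix X
  have "(\<exists>x\<in>CC p 0. \<exists>y\<in>CC (p - 1) (0 + 1). dv M x = 0 \<and> dh M x + dv M y = 0 \<and> X = E2_class M p 0 x \<and>
      Y = E2_class M (p - 2) (0 + 1) (dh M y)) \<longleftrightarrow>
    (\<exists>a b. (a, b) \<in> rel_d p \<and> X = E2_class M p 0 a \<and> Y = E2_class M (p - 2) 1 b)" for Y
    unfolding rel_d_def by auto
  then show "d2 M p 0 X = induced (E2_class M p 0) (E2_class M (p - 2) 1) (rel_d p) X"
    unfolding d2_def induced_def by simp
qed

lemma induced_hom_d:
  "induced_hom (E2 M p 0) (E2_class M p 0) (E2_cycles p 0) (E2_boundaries p 0)
     (E2 M (p - 2) 1) (E2_class M (p - 2) 1) (E2_cycles (p - 2) 1) (E2_boundaries (p - 2) 1) (rel_d p)"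
proof (intro induced_hom.intro presents_E2)
  have dy: "dh M y \<in> CC (p - 2) 1 \<and> dv M (dh M y) = 0" if "y \<in> CC (p - 1) 1" "dv M y = - dh M x" "x \<in> CC p 0" for x y
    using dh_Cpq[OF that(1)] dd_CC(3)[OF that(1)] dd_CC(1)[OF that(3)] that(2) by auto
  show "rel_d p \<subseteq> E2_cycles p 0 \<times> E2_cycles (p - 2) 1"
  proof safe
    fix a b assume "(a, b) \<in> rel_d p"
    then obtain y where y: "a \<in> CC p 0" "y \<in> CC (p - 1) 1" "dv M a = 0" "dh M a + dv M y = 0" "b = dh M y"
      unfolding rel_d_def by blast
    then show "a \<in> E2_cycles p 0" by (auto simp: E2_cycles_def)
    have "dv M y = - dh M a" using y(4) by (simp add: eq_neg_iff_add_eq_0 add.commute)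
    from dy[OF y(2) this y(1)] show "b \<in> E2_cycles (p - 2) 1"
      using dd_CC(1)[OF y(2)] CC_closed(1) y(5) by (auto simp: E2_cycles_def intro!: bexI[of _ 0])
  qed
  fix a b
  show "(a - a', b - b') \<in> rel_d p" if "(a, b) \<in> rel_d p" "(a', b') \<in> rel_d p" for a' b'
  proof -
    from that obtain y y' where y: "a \<in> CC p 0" "y \<in> CC (p - 1) 1" "dv M a = 0" "dh M a + dv M y = 0" "b = dh M y"
      "a' \<in> CC p 0" "y' \<in> CC (p - 1) 1" "dv M a' = 0" "dh M a' + dv M y' = 0" "b' = dh M y'"
      unfolding rel_d_def by blast
    have "dh M (a - a') + dv M (y - y') = (dh M a + dv M y) - (dh M a' + dv M y')" by simp
    then have "dh M (a - a') + dv M (y - y') = 0" using y by simp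
    then show ?thesis
      unfolding rel_d_def using y CC_closed(2) by (auto intro!: exI[of _ "y - y'"])
  qed
  show "\<exists>b. (a, b) \<in> rel_d p" if "a \<in> E2_cycles p 0"
    using that by (auto simp: E2_cycles_def rel_d_def)
  show "b \<in> E2_boundaries (p - 2) 1" if R: "(a, b) \<in> rel_d p" and a: "a \<in> E2_boundaries p 0"
  proof -
    from R obtain y where y: "a \<in> CC p 0" "y \<in> CC (p - 1) 1" "dh M a + dv M y = 0" "b = dh M y"
      unfolding rel_d_def by blast
    from a obtain s t where st: "s \<in> CC p 1" "t \<in> CC (p + 1) 0" "a = dv M s + dh M t"
      unfolding E2_boundaries_def by auto
    \<comment> \<open>With \<open>a = dv M s + dh M t\<close>, the chain \<open>dh M s\<close> is
      another solution for \<open>y\<close>. The difference is a vertical cycle with the same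
      horizontal boundary as \<open>y\<close>, which exhibits \<open>b\<close> as a
      boundary.\<close>
    let ?w = "y - dh M s"
    have w: "?w \<in> CC (p - 1) 1" using y(2) dh_Cpq[OF st(1)] CC_closed(2) by blast
    have "dh M a = - dv M (dh M s)"
      using st dd_CC(3)[OF st(1)] dd_CC(1)[OF st(2)] by simp
    then have dw: "dv M ?w = 0" using y(3) by simp
    have b: "b = dh M ?w" using y(4) dd_CC(1)[OF st(1)] by simp
    have "b \<in> CC (p - 2) 1" "dv M b = 0"
      using dh_Cpq[OF w] dd_CC(3)[OF w] dw by (auto simp: b)
    moreover have "b = dv M 0 + dh M ?w" using b by simp
    moreover have "p - 2 + 1 = p - 1" by simp
    ultimately show ?thesis
      unfolding E2_boundaries_def using w dw CC_closed(1) by (auto simp del: dh_linear dv_linear)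
  qed
qed

lemma induced_hom_i:
  assumes H: "presents (H_bowtie M n) cls (tot_cycles n) (tot_boundaries n)"
  shows "induced_hom (E2 M (n - 1) 1) (E2_class M (n - 1) 1) (E2_cycles (n - 1) 1) (E2_boundaries (n - 1) 1)
     (H_bowtie M n) cls (tot_cycles n) (tot_boundaries n) (rel_i n)"
proof (intro induced_hom.intro presents_E2 H)
  show "rel_i n \<subseteq> E2_cycles (n - 1) 1 \<times> tot_cycles n"
    by (auto simp: rel_i_def tot_cycles_iff filt_total)
  fix a b
  show "(a - a', b - b') \<in> rel_i n" if "(a, b) \<in> rel_i n" "(a', b') \<in> rel_i n" for a' b'
    using that filt_closed(2) subgrpD(2)[OF presentsD(2)[OF presents_E2[of "n - 1" 1]]]
    by (auto simp: rel_i_def total_bd_linear)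
  show "\<exists>b. (a, b) \<in> rel_i n" if a: "a \<in> E2_cycles (n - 1) 1"
  proof -
    from a obtain z where z: "a \<in> CC (n - 1) 1" "dv M a = 0" "z \<in> CC (n - 2) 2" "dh M a + dv M z = 0"
      by (auto simp: E2_cycles_def)
    \<comment> \<open>The boundary of \<open>a + z\<close> is \<open>dh M z\<close>, in bidegree
      \<open>(n - 3, 2)\<close>: high enough for \<open>filt_exact\<close> to provide a correction
      \<open>w\<close> that does not touch the component \<open>a\<close>.\<close>
    have zf: "dh M z \<in> filt (n - 1) (n - 3)"
      by (rule CC_filt[OF dh_Cpq[OF z(3)]]) auto
    have eq: "total_bd (a + z) = dh M z" using z by (simp add: total_bd_def algebra_simps)
    have az: "a + z \<in> total_chains n" by (intro total_chains_closed(4) CC_total[OF z(1)] CC_total[OF z(3)]) auto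
    have "total_bd (dh M z) = 0" using total_bd_total_bd[OF az] eq by simp
    with filt_exact[OF zf] obtain w where w: "w \<in> filt n (n - 3)" "total_bd w = dh M z" by auto
    have f: "a + z - w \<in> filt n (n - 1)"
      by (intro filt_closed(2) filt_closed(4) CC_filt[OF z(1)] CC_filt[OF z(3)] filt_mono[OF w(1)]) auto
    have "prj (n - 1) (a + z - w) = a"
      using prj_CC[OF z(1)] prj_CC[OF z(3)] w(1) by (simp add: filt_def)
    moreover have "total_bd (a + z - w) = 0" using eq w(2) by (simp add: total_bd_linear(3))
    ultimately show ?thesis using a f by (auto simp: rel_i_def)
  qed
  show "b \<in> tot_boundaries n" if R: "(a, b) \<in> rel_i n" and a: "a \<in> E2_boundaries (n - 1) 1"
  proof -
    from a obtain s t where st: "a \<in> CC (n - 1) 1" "s \<in> CC (n - 1) 2" "t \<in> CC n 1" "dv M t = 0" "a = dv M s + dh M t"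
      by (auto simp: E2_boundaries_def)
    from R have b: "b \<in> filt n (n - 1)" "total_bd b = 0" "prj (n - 1) b = a" by (auto simp: rel_i_def)
    have stT: "s + t \<in> total_chains (n + 1)" by (intro total_chains_closed(4) CC_total[OF st(2)] CC_total[OF st(3)]) auto
    have eq: "total_bd (s + t) = a + dh M s" using st by (simp add: total_bd_def algebra_simps)
    \<comment> \<open>Subtracting the boundary of \<open>s + t\<close> cancels the leading component
      \<open>a\<close> and changes the rest only in degree \<open>n - 2\<close>, where
      \<open>filt_exact\<close> applies.\<close>
    have "b - prj (n - 1) b \<in> filt n (n - 1 - 1)" by (rule filt_step[OF b(1)])
    moreover have "dh M s \<in> filt n (n - 2)" by (rule CC_filt[OF dh_Cpq[OF st(2)]]) auto
    ultimately have "b - a - dh M s \<in> filt n (n - 2)" using filt_closed(2) b(3) by auto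
    moreover have e: "b - a - dh M s = b - total_bd (s + t)" using eq by (simp add: algebra_simps)
    ultimately have f: "b - total_bd (s + t) \<in> filt n (n - 2)" by (simp only:)
    have "total_bd (b - total_bd (s + t)) = 0" unfolding total_bd_linear(3) b(2) total_bd_total_bd[OF stT] by simp
    with filt_exact[OF f] obtain w where w: "w \<in> filt (n + 1) (n - 2)" "total_bd w = b - total_bd (s + t)" by auto
    then have "b = total_bd (w + (s + t))" unfolding total_bd_linear(2)[of w] by simp
    then show ?thesis using total_chains_closed(4)[OF filt_total[OF w(1)] stT] by (auto simp: tot_boundaries_iff)
  qed
qed

lemma tot_cycle_components:
  assumes "x \<in> tot_cycles n"
  shows "dh M (prj (p + 1) x) + dv M (prj p x) = 0"
  using assms prj_total_bd[of x n p] by (simp add: tot_cycles_iff)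

lemma induced_hom_e:
  assumes H: "presents (H_bowtie M n) cls (tot_cycles n) (tot_boundaries n)"
  shows "induced_hom (H_bowtie M n) cls (tot_cycles n) (tot_boundaries n)
    (E2 M n 0) (E2_class M n 0) (E2_cycles n 0) (E2_boundaries n 0) (rel_e n)"
proof (intro induced_hom.intro presents_E2 H)
  have lead: "prj n x \<in> E2_cycles n 0" if x: "x \<in> tot_cycles n" for x
  proof -
    have "x \<in> total_chains n" using x by (simp add: tot_cycles_iff)
    from prj_total[OF this, of n] prj_total[OF this, of "n - 1"] dv_CC0[of "prj n x" n] tot_cycle_components[OF x, of "n - 1"]
    show ?thesis by (auto simp: E2_cycles_def)
  qed
  then show "rel_e n \<subseteq> tot_cycles n \<times> E2_cycles n 0" by (auto simp: rel_e_def)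
  fix a b
  show "(a - a', b - b') \<in> rel_e n" if "(a, b) \<in> rel_e n" "(a', b') \<in> rel_e n" for a' b'
    using that subgrpD(2)[OF subgrp_tot_cycles[of n]] by (force simp: rel_e_def)
  show "\<exists>b. (a, b) \<in> rel_e n" if "a \<in> tot_cycles n" using that by (auto simp: rel_e_def)
  show "b \<in> E2_boundaries n 0" if R: "(a, b) \<in> rel_e n" and a: "a \<in> tot_boundaries n"
  proof -
    from a obtain u where u: "u \<in> total_chains (n + 1)" "a = total_bd u" by (auto simp: tot_boundaries_iff)
    have b: "b = prj n a" "a \<in> tot_cycles n" using R by (auto simp: rel_e_def)
    have "b = dv M (prj n u) + dh M (prj (n + 1) u)"
      using prj_total_bd[OF u(1), of n] by (simp add: b u(2) add.commute)
    moreover have "b \<in> CC n 0" using prj_total[of a n n] b by (simp add: tot_cycles_iff)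
    moreover have "prj n u \<in> CC n (0 + 1)" "prj (n + 1) u \<in> CC (n + 1) 0"
      using prj_total[OF u(1), of n] prj_total[OF u(1), of "n + 1"] by (auto simp: algebra_simps)
    ultimately show ?thesis
      unfolding E2_boundaries_def using dv_CC0 by blast
  qed
qed

theorem long_exact_sequence:
  "\<exists>i e. \<forall>p.
     exact_at (E2 M (p + 1) 0) (d2 M (p + 1) 0) (E2 M (p - 1) 1) (i p) (H_bowtie M p) \<and>
     exact_at (E2 M (p - 1) 1) (i p) (H_bowtie M p) (e p) (E2 M p 0) \<and>
     exact_at (H_bowtie M p) (e p) (E2 M p 0) (d2 M p 0) (E2 M (p - 2) 1)"
proof -
  obtain cls where H: "\<And>n. presents (H_bowtie M n) (cls n) (tot_cycles n) (tot_boundaries n)"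
    using presents_H_bowtie by blast
  show ?thesis
  proof (intro exI allI conjI)
    fix p
    let ?i = "induced (E2_class M (p - 1) 1) (cls p) (rel_i p)" and ?e = "induced (cls p) (E2_class M p 0) (rel_e p)"
    have p1: "p + 1 - 2 = p - 1" by simp
    show "exact_at (E2 M (p + 1) 0) (d2 M (p + 1) 0) (E2 M (p - 1) 1) ?i (H_bowtie M p)"
      unfolding d2_induced p1
    proof (rule exact_at_induced[OF induced_hom_d[of "p + 1", unfolded p1] induced_hom_i[OF H]])
      fix a b assume R: "(a, b) \<in> rel_d (p + 1)"
      then obtain y where y: "a \<in> CC (p + 1) 0" "y \<in> CC p 1" "dv M a = 0" "dh M a + dv M y = 0" "b = dh M y"
        unfolding rel_d_def by auto
      have ay: "a + y \<in> total_chains (p + 1)" by (intro total_chains_closed(4) CC_total[OF y(1)] CC_total[OF y(2)]) auto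
      have eq: "b = total_bd (a + y)" using y by (simp add: total_bd_def algebra_simps)
      have bc: "b \<in> CC (p - 1) 1" using dh_Cpq[OF y(2)] y(5) by simp
      have "b \<in> E2_cycles (p - 1) 1"
        using R induced_hom.R_sub[OF induced_hom_d[of "p + 1", unfolded p1]] by auto
      \<comment> \<open>The image \<open>dh M y\<close> of the differential is already a total cycle
        without lower components, namely the boundary of \<open>a + y\<close>.\<close>
      then have "(b, b) \<in> rel_i p"
        using CC_filt[OF bc, of p "p - 1"] prj_CC[OF bc] total_bd_total_bd[OF ay] eq by (simp add: rel_i_def)
      moreover have "b \<in> tot_boundaries p" using ay eq by (auto simp: tot_boundaries_iff)
      ultimately show "\<exists>z. (b, z) \<in> rel_i p \<and> z \<in> tot_boundaries p" by blast
    next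
      fix b z assume R: "(b, z) \<in> rel_i p" and z: "z \<in> tot_boundaries p"
      from R have b: "b \<in> E2_cycles (p - 1) 1" "z \<in> filt p (p - 1)" "prj (p - 1) z = b" by (auto simp: rel_i_def)
      from z obtain u where u: "u \<in> total_chains (p + 1)" "z = total_bd u" by (auto simp: tot_boundaries_iff)
      \<comment> \<open>As \<open>z\<close> has no component in degree \<open>p\<close>, the top two
        components of \<open>u\<close> satisfy the condition in \<open>rel_d\<close>; the third one
        makes \<open>b\<close> and \<open>dh M ?y\<close> agree up to a vertical boundary.\<close>
      let ?a = "prj (p + 1) u" and ?y = "prj p u" and ?s = "prj (p - 1) u"
      have c: "?a \<in> CC (p + 1) 0" "?y \<in> CC p 1" "?s \<in> CC (p - 1) 2"
        using prj_total[OF u(1), of "p + 1"] prj_total[OF u(1), of p] prj_total[OF u(1), of "p - 1"] by auto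
      have "dh M ?a + dv M ?y = 0"
        using prj_total_bd[OF u(1), of p] b(2) u(2) by (simp add: filt_def)
      then have rel_d: "(?a, dh M ?y) \<in> rel_d (p + 1)"
        using c dv_CC0[OF c(1)] by (auto simp: rel_d_def)
      have "b = dh M ?y + dv M ?s"
        using prj_total_bd[OF u(1), of "p - 1"] b(3) u(2) by simp
      then have "b - dh M ?y = dv M ?s" by simp
      moreover have "dv M ?s \<in> E2_boundaries (p - 1) 1"
        using dv_E2_boundaries[of ?s "p - 1" 1] c(3) by simp
      ultimately show "\<exists>a b'. (a, b') \<in> rel_d (p + 1) \<and> b - b' \<in> E2_boundaries (p - 1) 1"
        using rel_d by (intro exI[of _ ?a] exI[of _ "dh M ?y"]) simp
    qed
    show "exact_at (E2 M (p - 1) 1) ?i (H_bowtie M p) ?e (E2 M p 0)"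
    proof (rule exact_at_induced[OF induced_hom_i[OF H] induced_hom_e[OF H]])
      fix a b assume "(a, b) \<in> rel_i p"
      then have b: "b \<in> tot_cycles p" "prj p b = 0" by (auto simp: rel_i_def tot_cycles_iff filt_def)
      then have "(b, 0) \<in> rel_e p" unfolding rel_e_def by force
      then show "\<exists>z. (b, z) \<in> rel_e p \<and> z \<in> E2_boundaries p 0"
        using presents_boundaries(1)[OF presents_E2[of p 0]] by blast
    next
      fix b z assume "(b, z) \<in> rel_e p" "z \<in> E2_boundaries p 0"
      then obtain y t where b: "b \<in> tot_cycles p" "y \<in> CC p 1" "t \<in> CC (p + 1) 0" "prj p b = dv M y + dh M t"
        unfolding rel_e_def E2_boundaries_def by auto
      have yt: "y + t \<in> total_chains (p + 1)" by (intro total_chains_closed(4) CC_total[OF b(2)] CC_total[OF b(3)]) auto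
      \<comment> \<open>Subtracting this boundary removes the component of \<open>b\<close> in
        bidegree \<open>(p, 0)\<close>, which leaves a homologous cycle in filtration
        \<open>p - 1\<close>.\<close>
      let ?b = "b - total_bd (y + t)"
      have bT: "b \<in> total_chains p" "total_bd b = 0" using b(1) by (auto simp: tot_cycles_iff)
      have eq: "?b = (b - prj p b) - dh M y"
        using b(4) dv_CC0[OF b(3)] by (simp add: total_bd_def algebra_simps)
      have "?b \<in> filt p (p - 1)"
        unfolding eq by (rule filt_closed(2)[OF filt_step[OF total_filt[OF bT(1)]] CC_filt[OF dh_Cpq[OF b(2)]]]) auto
      moreover have tb0: "total_bd ?b = 0"
        using bT(2) total_bd_total_bd[OF yt] total_bd_linear(3)[of b "total_bd (y + t)"] by simp
      moreover have "prj (p - 1) ?b \<in> E2_cycles (p - 1) 1"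
      proof -
        have T: "?b \<in> total_chains p" "prj p ?b = 0" using calculation(1) by (auto simp: filt_def)
        have "?b \<in> tot_cycles p" using T tb0 by (simp add: tot_cycles_iff)
        from tot_cycle_components[OF this, of "p - 1"] tot_cycle_components[OF this, of "p - 2"]
        show ?thesis
          using prj_total[OF T(1), of "p - 1"] prj_total[OF T(1), of "p - 2"] T(2)
          by (auto simp: E2_cycles_def simp del: prj_linear(2,3,4))
      qed
      ultimately have "(prj (p - 1) ?b, ?b) \<in> rel_i p" by (simp add: rel_i_def del: prj_linear)
      moreover have "b - ?b \<in> tot_boundaries p" using yt by (auto simp: tot_boundaries_iff)
      ultimately show "\<exists>a b'. (a, b') \<in> rel_i p \<and> b - b' \<in> tot_boundaries p" by blast
    qed
    show "exact_at (H_bowtie M p) ?e (E2 M p 0) (d2 M p 0) (E2 M (p - 2) 1)"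
      unfolding d2_induced
    proof (rule exact_at_induced[OF induced_hom_e[OF H] induced_hom_d])
      fix a b assume "(a, b) \<in> rel_e p"
      then have a: "a \<in> tot_cycles p" "b = prj p a" by (auto simp: rel_e_def)
      have T: "a \<in> total_chains p" using a(1) by (simp add: tot_cycles_iff)
      let ?y = "prj (p - 1) a" and ?s = "prj (p - 2) a"
      have c: "b \<in> CC p 0" "?y \<in> CC (p - 1) 1" "?s \<in> CC (p - 2) 2"
        using prj_total[OF T, of p] prj_total[OF T, of "p - 1"] prj_total[OF T, of "p - 2"] a(2) by auto
      have e: "dh M b + dv M ?y = 0" "dh M ?y + dv M ?s = 0"
        using tot_cycle_components[OF a(1), of "p - 1"] tot_cycle_components[OF a(1), of "p - 2"] a(2) by auto
      have "(b, dh M ?y) \<in> rel_d p" using c e(1) dv_CC0[OF c(1)] by (auto simp: rel_d_def)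
      moreover have "dh M ?y \<in> E2_boundaries (p - 2) 1"
      proof -
        have "dh M ?y = dv M (- ?s)" using e(2) by (simp add: eq_neg_iff_add_eq_0)
        moreover have "- ?s \<in> CC (p - 2) (1 + 1)" using CC_closed(3)[OF c(3)] by simp
        ultimately show ?thesis using dv_E2_boundaries by metis
      qed
      ultimately show "\<exists>z. (b, z) \<in> rel_d p \<and> z \<in> E2_boundaries (p - 2) 1" by blast
    next
      fix b z assume R: "(b, z) \<in> rel_d p" and z: "z \<in> E2_boundaries (p - 2) 1"
      from R obtain y where y: "b \<in> CC p 0" "y \<in> CC (p - 1) 1" "dv M b = 0" "dh M b + dv M y = 0" "z = dh M y"
        unfolding rel_d_def by auto
      from z obtain s w where sw: "s \<in> CC (p - 2) 2" "w \<in> CC (p - 1) 1" "dv M w = 0" "z = dv M s + dh M w"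
        unfolding E2_boundaries_def by auto
      \<comment> \<open>Replacing \<open>y\<close> by \<open>y - w\<close> keeps the vertical
        boundary and makes \<open>dh M (y - w) = dv M s\<close>, which \<open>- s\<close> cancels.
        Only \<open>- dh M s\<close> in bidegree \<open>(p - 3, 2)\<close> is left of the total
        boundary, and \<open>filt_exact\<close> removes it.\<close>
      let ?x = "b + (y - w) - s"
      have xT: "?x \<in> total_chains p"
        by (intro total_chains_closed(2,4) CC_total[OF y(1)] CC_total[OF y(2)] CC_total[OF sw(1)] CC_total[OF sw(2)]) auto
      have "dh M y = dv M s + dh M w" using y(5) sw(4) by simp
      moreover have "dh M b = - dv M y" using y(4) by (simp add: eq_neg_iff_add_eq_0)
      ultimately have eq: "total_bd ?x = - dh M s"
        using y(3) sw(3) by (simp add: total_bd_def algebra_simps)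
      have f: "- dh M s \<in> filt (p - 1) (p - 3)"
        by (rule filt_closed(3)[OF CC_filt[OF dh_Cpq[OF sw(1)]]]) auto
      have "total_bd (- dh M s) = 0" using total_bd_total_bd[OF xT] eq by simp
      with filt_exact[OF f] obtain u where u: "u \<in> filt p (p - 3)" "total_bd u = - dh M s" by auto
      have "?x - u \<in> tot_cycles p"
        using total_chains_closed(2)[OF xT filt_total[OF u(1)]] eq u(2) total_bd_linear(3)[of ?x u] by (simp add: tot_cycles_iff)
      moreover have "prj p (?x - u) = b"
        using prj_CC[OF y(1)] prj_CC[OF y(2)] prj_CC[OF sw(1)] prj_CC[OF sw(2)] u(1) by (simp add: filt_def)
      ultimately have "(?x - u, b) \<in> rel_e p" unfolding rel_e_def by force
      moreover have "b - b \<in> E2_boundaries p 0" using presents_boundaries(1)[OF presents_E2[of p 0]] by simp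
      ultimately show "\<exists>a b'. (a, b') \<in> rel_e p \<and> b - b' \<in> E2_boundaries p 0" by blast
    qed
  qed
qed

lemma trivial_Hv:
  assumes "q \<ge> 2"
  shows "trivial_group (Hv M p q)"
proof -
  have "{x \<in> CC p q. dv M x = 0} \<subseteq> {x \<in> CC p q. \<exists>y\<in>CC p (q + 1). x = dv M y}"
    using columns_acyclic[OF _ assms] by force
  then have "Hv_class M p q x = \<one>\<^bsub>Hv M p q\<^esub>" if "x \<in> {x \<in> CC p q. dv M x = 0}" for x
    using presentsD(7)[OF presents_Hv that] that by blast
  then have "carrier (Hv M p q) \<subseteq> {\<one>\<^bsub>Hv M p q\<^esub>}"
    unfolding presentsD(4)[OF presents_Hv, symmetric] by blast
  then show ?thesis
    using presentsD(1)[OF presents_Hv[of p q]] by (auto simp: trivial_group_def group.is_monoid monoid.one_closed)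
qed

end

sublocale path_matched_pair \<subseteq> acyclic_columns where M = M
  by unfold_locales (rule C_def D_def l_def r_def columns_exact; assumption?)+

theorem proposition6p1:
  fixes C :: "('v, 'c) cat"
    and E :: "('v, 'e) pre_digraph"
    and M :: "('v, 'c, ('v, 'e) path) matched_data"
  assumes "small_category C"
    and "wf_digraph E"
    and "lcat M = C"
    and "rcat M = path_category E"
    and "matched_pair M"
    and length_preserving:
      "\<And>c \<alpha>. \<lbrakk>c \<in> Arr C; \<alpha> \<in> Arr (path_category E); src C c = rng (path_category E) \<alpha>\<rbrakk>
         \<Longrightarrow> path_length (lact M c \<alpha>) = path_length \<alpha>"
  shows
    "(\<forall>p\<ge>0. \<forall>q\<ge>0. dv M \<in> hom (Npq M p (q + 1)) (Npq M p q)) \<and>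
     (\<forall>p\<ge>0. \<forall>q\<ge>1. sv E M \<in> hom (Npq M p q) (Npq M p (q + 1))) \<and>
     (\<forall>p\<ge>0. \<forall>q\<ge>2. \<forall>x \<in> carrier (Npq M p q).
        dv M (sv E M x) + sv E M (dv M x) = frag_cmul ((-1) ^ nat p) x \<and>
        dv M (frag_cmul ((-1) ^ nat p) (sv E M x)) + frag_cmul ((-1) ^ nat p) (sv E M (dv M x)) = x) \<and>
     (\<forall>p\<ge>0. \<forall>q\<ge>2. trivial_group (Hv M p q)) \<and>
     (\<exists>i e. \<forall>p.
        exact_at (E2 M (p + 1) 0) (d2 M (p + 1) 0) (E2 M (p - 1) 1) (i p) (H_bowtie M p) \<and>
        exact_at (E2 M (p - 1) 1) (i p) (H_bowtie M p) (e p) (E2 M p 0) \<and>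
        exact_at (H_bowtie M p) (e p) (E2 M p 0) (d2 M p 0) (E2 M (p - 2) 1))"
proof -
  interpret path_matched_pair
    where M = M and C = "lcat M" and D = "rcat M" and l = "lact M" and r = "ract M" and E = E
    by (intro path_matched_pair.intro path_matched_pair_axioms.intro assms)
  \<comment> \<open>Multiplying the identity for \<open>sv\<close> by its own sign \<open>c\<close>
    gives the one for the corrected homotopy, because \<open>c * c = 1\<close>.\<close>
  have "dv M (frag_cmul c (sv E M x)) + frag_cmul c (sv E M (dv M x)) = frag_cmul (c * c) x"
    if "x \<in> carrier (Npq M p q)" "q \<ge> 2" "c = (-1) ^ nat p" for x p q c
    using arg_cong[OF sv_homotopy[OF that(1,2)], of "frag_cmul c"] that(3)
    by (simp add: frag_cmul_distrib2)
  then have "dv M (frag_cmul ((-1) ^ nat p) (sv E M x)) + frag_cmul ((-1) ^ nat p) (sv E M (dv M x)) = x"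
    if "x \<in> carrier (Npq M p q)" "q \<ge> 2" for x p q
    using that by (simp flip: power_add)
  then show ?thesis
    using dv_hom_Npq sv_hom_Npq sv_homotopy trivial_Hv long_exact_sequence by blast
qed

end
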